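(* Let $k \geq 1$, let $N_1, \ldots, N_k$ be pairwise non-isomorphic finitely generated torsion-free non-abelian nilpotent groups and let $r_1, \ldots, r_k$ be positive integers. Put $N = N_1^{r_1} \times \cdots \times N_k^{r_k}$. Suppose that, for each $i \in \{1, \ldots, k\}$, $N_i$ is rationally indecomposable. Then $$\operatorname{Spec}_R(N) = \prod_{i=1}^{k} \left( \bigcup_{j=1}^{r_i} \operatorname{Spec}_R(N_i)^{(j)} \right).$$ In particular, $N$ has the $R_\infty$-property if and only if $N_i$ has the $R_\infty$-property for some $i \in \{1, \ldots, k\}$.
   Context: The rational Malcev completion $N^{\mathbb{Q}}$ of a finitely generated torsion-free nilpotent group $N$ is the unique (up to isomorphism) torsion-free nilpotent group such that: (1) $N$ embeds into $N^{\mathbb{Q}}$; (2) for all $n \in N$ and all integers $m \geq 1$ there is a unique $x \in N^{\mathbb{Q}}$ with $x^m = n$; (3) for all $x \in N^{\mathbb{Q}}$ there is an integer $m \geq 1$ with $x^m \in N$. A group $G$ is directly indecomposable if $G \cong H \times K$ implies $H = 1$ or $K = 1$. A finitely generated torsion-free nilpotent group $N$ is rationally indecomposable if $N^{\mathbb{Q}}$ is directly indecomposable. For a group $G$ and $\varphi \in \operatorname{End}(G)$, elements $x, y \in G$ are $\varphi$-conjugate if $x = z y \varphi(z)^{-1}$ for some $z \in G$; this is an equivalence relation, and the number of its classes is the Reidemeister number $R(\varphi) \in \{1, 2, \ldots\} \cup \{\infty\}$ (any infinite number of classes is recorded as $\infty$). The Reidemeister spectrum is $\operatorname{Spec}_R(G)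 = \{R(\psi) \mid \psi \in \operatorname{Aut}(G)\}$. $G$ has the $R_\infty$-property if $\operatorname{Spec}_R(G) = \{\infty\}$. For subsets $A_1, \ldots, A_n$ of $\{1, 2, \ldots\} \cup \{\infty\}$, define $\prod_{i=1}^n A_i = A_1 \cdots A_n = \{a_1 \cdots a_n \mid a_i \in A_i \text{ for all } i\}$, where $a \cdot \infty = \infty$ for all $a$; $A^{(n)}$ denotes the $n$-fold product of $A$ with itself in this sense. *)

theory Defs
  imports
    "HOL-Algebra.Algebra"
    "HOL-Library.Extended_Nat"
    "HOL-Library.Set_Algebras"
begin

section \<open>Nilpotent, torsion-free and finitely generated groups\<close>

primrec lower_central :: "('a, 'm) monoid_scheme \<Rightarrow> nat \<Rightarrow> 'a set" where
  "lower_central G 0 = carrier G"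
| "lower_central G (Suc n) =
     generate G {x \<otimes>\<^bsub>G\<^esub> y \<otimes>\<^bsub>G\<^esub> inv\<^bsub>G\<^esub> x \<otimes>\<^bsub>G\<^esub> inv\<^bsub>G\<^esub> y | x y. x \<in> lower_central G n \<and> y \<in> carrier G}"

definition nilpotent_group :: "('a, 'm) monoid_scheme \<Rightarrow> bool" where
  "nilpotent_group G \<longleftrightarrow> group G \<and> (\<exists>n. lower_central G n = {\<one>\<^bsub>G\<^esub>})"

definition torsion_free_group :: "('a, 'm) monoid_scheme \<Rightarrow> bool" where
  "torsion_free_group G \<longleftrightarrow>
     group G \<and> (\<forall>x \<in> carrier G. \<forall>n::nat. n \<ge> 1 \<longrightarrow> x [^]\<^bsub>G\<^esub> n = \<one>\<^bsub>G\<^esub> \<longrightarrow> x = \<one>\<^bsub>G\<^esub>)"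

definition finitely_generated_group :: "('a, 'm) monoid_scheme \<Rightarrow> bool" where
  "finitely_generated_group G \<longleftrightarrow>
     group G \<and> (\<exists>S. finite S \<and> S \<subseteq> carrier G \<and> generate G S = carrier G)"


section \<open>Rational indecomposability\<close>

text \<open>Both factors of a direct decomposition of \<open>G\<close> embed into \<open>G\<close>, so it is no
  restriction that they live on the element type of \<open>G\<close>; see \<open>directly_indecomposableD\<close>
  below.\<close>

definition directly_indecomposable :: "('a, 'm) monoid_scheme \<Rightarrow> bool" where
  "directly_indecomposable G \<longleftrightarrow>
     (\<forall>(H :: 'a monoid) (K :: 'a monoid).
        group H \<and> group K \<and> G \<cong> H \<times>\<times> K \<longrightarrow> trivial_group H \<or> trivial_group K)"

text \<open>\<open>M\<close> together with the embedding \<open>\<iota>\<close> is a rational Malcev completion of \<open>N\<close>.\<close>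

definition rational_malcev_completion ::
  "('a, 'm) monoid_scheme \<Rightarrow> ('b, 'n) monoid_scheme \<Rightarrow> ('a \<Rightarrow> 'b) \<Rightarrow> bool" where
  "rational_malcev_completion N M \<iota> \<longleftrightarrow>
     nilpotent_group M \<and> torsion_free_group M \<and>
     \<iota> \<in> mon N M \<and>
     (\<forall>n \<in> carrier N. \<forall>m::nat. m \<ge> 1 \<longrightarrow> (\<exists>!x. x \<in> carrier M \<and> x [^]\<^bsub>M\<^esub> m = \<iota> n)) \<and>
     (\<forall>x \<in> carrier M. \<exists>m::nat. m \<ge> 1 \<and> x [^]\<^bsub>M\<^esub> m \<in> \<iota> ` carrier N)"

text \<open>The completion is unique only up to isomorphism. An element \<open>x\<close> of it is determined
  by a pair \<open>(n, m)\<close> with \<open>x\<^sup>m = n \<in> N\<close>, so every completion has an isomorphic copy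
  on the type \<open>'a \<times> nat\<close>, and nothing is lost by quantifying over this type only; see
  \<open>rationally_indecomposableI\<close> below.\<close>

definition rationally_indecomposable :: "('a, 'm) monoid_scheme \<Rightarrow> bool" where
  "rationally_indecomposable N \<longleftrightarrow>
     (\<exists>(M :: ('a \<times> nat) monoid) \<iota>. rational_malcev_completion N M \<iota> \<and> directly_indecomposable M)"


section \<open>Reidemeister numbers and spectra\<close>

definition twisted_conj :: "('a, 'm) monoid_scheme \<Rightarrow> ('a \<Rightarrow> 'a) \<Rightarrow> ('a \<times> 'a) set" where
  "twisted_conj G \<phi> =
     {(x, y). x \<in> carrier G \<and> y \<in> carrier G \<and>
        (\<exists>z \<in> carrier G. x = z \<otimes>\<^bsub>G\<^esub> y \<otimes>\<^bsub>G\<^esub> inv\<^bsub>G\<^esub> (\<phi> z))}"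

definition reidemeister_number :: "('a, 'm) monoid_scheme \<Rightarrow> ('a \<Rightarrow> 'a) \<Rightarrow> enat" where
  "reidemeister_number G \<phi> =
     (let C = carrier G // twisted_conj G \<phi> in if finite C then enat (card C) else \<infinity>)"

definition reidemeister_spectrum :: "('a, 'm) monoid_scheme \<Rightarrow> enat set" where
  "reidemeister_spectrum G = {reidemeister_number G \<psi> | \<psi>. \<psi> \<in> auto G}"

definition R_infinity :: "('a, 'm) monoid_scheme \<Rightarrow> bool" where
  "R_infinity G \<longleftrightarrow> reidemeister_spectrum G = {\<infinity>}"

text \<open>Products and powers of sets of extended naturals are the elementwise ones of
  \<open>HOL-Library.Set_Algebras\<close>; for a finite index set, \<open>set_prod_alt\<close> describes the product
  as the set of all products \<open>\<Prod>i\<in>I. a i\<close> with \<open>a i \<in> A i\<close>. In \<open>enat\<close> one has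
  \<open>0 * \<infinity> = 0\<close>, which is harmless because Reidemeister numbers are positive.\<close>


section \<open>Independence of the choice of element types\<close>

lemma image_group_iso:
  assumes "inj_on f (carrier G)"
  shows "f \<in> iso G (image_group f G)"
  using assms by (auto simp: iso_def hom_def bij_betw_def image_group_def)

lemma group_image_group:
  assumes "group G" "inj_on f (carrier G)"
  shows "group (image_group f G)"
proof -
  have "group ((image_group f G)\<lparr>one := f \<one>\<^bsub>G\<^esub>\<rparr>)"
    using group.iso_imp_img_group[OF assms(1) image_group_iso[OF assms(2)]] .
  then show ?thesis by (simp add: image_group_def)
qed

lemma directly_indecomposableD:
  fixes G :: "('a, 'm) monoid_scheme" and H :: "('b, 'n) monoid_scheme" and K :: "('c, 'l) monoid_scheme"
  assumes "directly_indecomposable G" "group G" "group H" "group K" "G \<cong> H \<times>\<times> K"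
  shows "trivial_group H \<or> trivial_group K"
proof -
  interpret H: group H by fact
  interpret K: group K by fact
  have HK: "group (H \<times>\<times> K)" using DirProd_group assms by blast
  then obtain g where g: "g \<in> iso (H \<times>\<times> K) G"
    using group.iso_sym[OF assms(2) assms(5)] by (auto simp: is_iso_def)
  define f1 where "f1 x = g (x, \<one>\<^bsub>K\<^esub>)" for x
  define f2 where "f2 y = g (\<one>\<^bsub>H\<^esub>, y)" for y
  have inj: "inj_on g (carrier H \<times> carrier K)"
    using g by (simp add: iso_def bij_betw_def)
  have i1: "inj_on f1 (carrier H)" and i2: "inj_on f2 (carrier K)"
    unfolding f1_def f2_def using inj by (auto intro!: inj_onI dest: inj_onD)
  let ?H = "image_group f1 H" and ?K = "image_group f2 K"
  have gr: "group ?H" "group ?K" using group_image_group i1 i2 assms by blast+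
  have iH: "H \<cong> ?H" and iK: "K \<cong> ?K"
    using image_group_iso i1 i2 by (auto intro: is_isoI)
  have "H \<times>\<times> K \<cong> ?H \<times>\<times> ?K"
    using group.DirProd_iso_trans[OF assms(3) iH iK] .
  with assms(5) have "G \<cong> ?H \<times>\<times> ?K" by (rule iso_trans)
  with assms(1) gr have "trivial_group ?H \<or> trivial_group ?K"
    unfolding directly_indecomposable_def by blast
  then show ?thesis
    using isomorphic_group_triviality[OF iH] isomorphic_group_triviality[OF iK] gr assms by blast
qed

lemma directly_indecomposable_iso:
  assumes "directly_indecomposable G" "group G" "group G'" "G \<cong> G'"
  shows "directly_indecomposable G'"
  unfolding directly_indecomposable_def
  using directly_indecomposableD[OF assms(1,2)] iso_trans[OF assms(4)] by blast

lemma lower_central_subset: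
  assumes "group G"
  shows "lower_central G n \<subseteq> carrier G"
proof (induction n)
  case (Suc n)
  interpret group G by fact
  have "{x \<otimes>\<^bsub>G\<^esub> y \<otimes>\<^bsub>G\<^esub> inv\<^bsub>G\<^esub> x \<otimes>\<^bsub>G\<^esub> inv\<^bsub>G\<^esub> y | x y. x \<in> lower_central G n \<and> y \<in> carrier G} \<subseteq> carrier G"
    using Suc by auto
  then show ?case unfolding lower_central.simps by (rule generate_incl)
qed simp

lemma lower_central_iso:
  assumes "group G" "group H" "h \<in> iso G H"
  shows "lower_central H n = h ` lower_central G n"
proof -
  have h: "h \<in> hom G H" and surj: "h ` carrier G = carrier H"
    using assms(3) by (auto simp: iso_def bij_betw_def)
  interpret group_hom G H h
    using assms h by (simp add: group_hom_def group_hom_axioms_def)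
  show ?thesis
  proof (induction n)
    case 0
    then show ?case using surj by simp
  next
    case (Suc n)
    let ?C = "{x \<otimes>\<^bsub>G\<^esub> y \<otimes>\<^bsub>G\<^esub> inv\<^bsub>G\<^esub> x \<otimes>\<^bsub>G\<^esub> inv\<^bsub>G\<^esub> y | x y. x \<in> lower_central G n \<and> y \<in> carrier G}"
    let ?D = "{x \<otimes>\<^bsub>H\<^esub> y \<otimes>\<^bsub>H\<^esub> inv\<^bsub>H\<^esub> x \<otimes>\<^bsub>H\<^esub> inv\<^bsub>H\<^esub> y | x y. x \<in> lower_central H n \<and> y \<in> carrier H}"
    have sub: "x \<in> carrier G" if "x \<in> lower_central G n" for x
      using lower_central_subset[OF assms(1)] that by blast
    have C: "?C \<subseteq> carrier G" using sub by auto
    have hc: "h (x \<otimes>\<^bsub>G\<^esub> y \<otimes>\<^bsub>G\<^esub> inv\<^bsub>G\<^esub> x \<otimes>\<^bsub>G\<^esub> inv\<^bsub>G\<^esub> y) = h x \<otimes>\<^bsub>H\<^esub> h y \<otimes>\<^bsub>H\<^esub> inv\<^bsub>H\<^esub> h x \<otimes>\<^bsub>H\<^esub> inv\<^bsub>H\<^esub> h y"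
      if "x \<in> lower_central G n" "y \<in> carrier G" for x y
      using sub[OF that(1)] that(2) by simp
    have "?D = h ` ?C"
    proof
      show "?D \<subseteq> h ` ?C"
      proof
        fix z assume "z \<in> ?D"
        then obtain x y where xy: "x \<in> lower_central G n" "y \<in> carrier G"
          "z = h x \<otimes>\<^bsub>H\<^esub> h y \<otimes>\<^bsub>H\<^esub> inv\<^bsub>H\<^esub> h x \<otimes>\<^bsub>H\<^esub> inv\<^bsub>H\<^esub> h y"
          unfolding Suc.IH surj[symmetric] by blast
        then have "z = h (x \<otimes>\<^bsub>G\<^esub> y \<otimes>\<^bsub>G\<^esub> inv\<^bsub>G\<^esub> x \<otimes>\<^bsub>G\<^esub> inv\<^bsub>G\<^esub> y)" using hc by simp
        then show "z \<in> h ` ?C" using xy by blast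
      qed
      show "h ` ?C \<subseteq> ?D"
      proof
        fix z assume "z \<in> h ` ?C"
        then obtain x y where xy: "x \<in> lower_central G n" "y \<in> carrier G"
          "z = h (x \<otimes>\<^bsub>G\<^esub> y \<otimes>\<^bsub>G\<^esub> inv\<^bsub>G\<^esub> x \<otimes>\<^bsub>G\<^esub> inv\<^bsub>G\<^esub> y)"
          by blast
        then have "z = h x \<otimes>\<^bsub>H\<^esub> h y \<otimes>\<^bsub>H\<^esub> inv\<^bsub>H\<^esub> h x \<otimes>\<^bsub>H\<^esub> inv\<^bsub>H\<^esub> h y" using hc by simp
        then show "z \<in> ?D" using xy unfolding Suc.IH surj[symmetric] by blast
      qed
    qed
    then show ?case using generate_img[OF C] by simp
  qed
qed

lemma rational_malcev_completion_iso:
  assumes M: "rational_malcev_completion N M \<iota>" and N: "group N"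
    and f: "f \<in> iso M M'" and M': "group M'"
  shows "rational_malcev_completion N M' (f \<circ> \<iota>)"
proof -
  have gM: "group M" and nM: "nilpotent_group M" and tM: "torsion_free_group M"
    and mon: "\<iota> \<in> mon N M"
    using M by (auto simp: rational_malcev_completion_def nilpotent_group_def)
  have inj: "inj_on f (carrier M)" and surj: "f ` carrier M = carrier M'" and hom: "f \<in> hom M M'"
    using f by (auto simp: iso_def bij_betw_def)
  interpret f: group_hom M M' f
    using gM M' hom by (simp add: group_hom_def group_hom_axioms_def)
  have \<iota>: "\<iota> n \<in> carrier M" if "n \<in> carrier N" for n
    using mon that by (auto simp: mon_def hom_def)
  have pow: "f (x [^]\<^bsub>M\<^esub> m) = f x [^]\<^bsub>M'\<^esub> m" if "x \<in> carrier M" for x and m :: nat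
    using that by (rule f.hom_nat_pow)
  have eq: "f x [^]\<^bsub>M'\<^esub> m = f y \<longleftrightarrow> x [^]\<^bsub>M\<^esub> m = y"
    if "x \<in> carrier M" "y \<in> carrier M" for x y and m :: nat
    unfolding pow[OF that(1), symmetric] using inj that by (simp add: inj_on_eq_iff)
  have "nilpotent_group M'"
    unfolding nilpotent_group_def lower_central_iso[OF gM M' f]
    using nM M' by (metis f.hom_one image_empty image_insert nilpotent_group_def)
  moreover have "torsion_free_group M'"
    unfolding torsion_free_group_def
  proof (intro conjI ballI allI impI M')
    fix x and n :: nat assume x: "x \<in> carrier M'" "n \<ge> 1" "x [^]\<^bsub>M'\<^esub> n = \<one>\<^bsub>M'\<^esub>"
    obtain y where y: "y \<in> carrier M" "x = f y" using x(1) surj by blast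
    have "y [^]\<^bsub>M\<^esub> n = \<one>\<^bsub>M\<^esub>"
      using x(3) y eq[OF y(1) f.G.one_closed, of n] by simp
    then have "y = \<one>\<^bsub>M\<^esub>" using tM x(2) y(1) by (simp add: torsion_free_group_def)
    then show "x = \<one>\<^bsub>M'\<^esub>" using y(2) by simp
  qed
  moreover have "f \<circ> \<iota> \<in> mon N M'"
    using mon f by (auto intro: mon_compose simp: iso_iff_mon_epi)
  moreover have "\<exists>!x. x \<in> carrier M' \<and> x [^]\<^bsub>M'\<^esub> m = (f \<circ> \<iota>) n"
    if "n \<in> carrier N" "m \<ge> 1" for n and m :: nat
  proof -
    from M that have "\<exists>!x. x \<in> carrier M \<and> x [^]\<^bsub>M\<^esub> m = \<iota> n"
      by (simp add: rational_malcev_completion_def)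
    then obtain x where x: "x \<in> carrier M" "x [^]\<^bsub>M\<^esub> m = \<iota> n"
      and uniq: "\<And>y. y \<in> carrier M \<Longrightarrow> y [^]\<^bsub>M\<^esub> m = \<iota> n \<Longrightarrow> y = x" by blast
    show ?thesis
    proof (rule ex1I[of _ "f x"])
      show "f x \<in> carrier M' \<and> f x [^]\<^bsub>M'\<^esub> m = (f \<circ> \<iota>) n"
        using x eq[OF x(1) \<iota>[OF that(1)], of m] by simp
      fix z assume z: "z \<in> carrier M' \<and> z [^]\<^bsub>M'\<^esub> m = (f \<circ> \<iota>) n"
      then obtain y where y: "y \<in> carrier M" "z = f y" using surj by blast
      then show "z = f x" using z uniq[OF y(1)] eq[OF y(1) \<iota>[OF that(1)], of m] by simp
    qed
  qed
  moreover have "\<exists>m::nat. m \<ge> 1 \<and> x [^]\<^bsub>M'\<^esub> m \<in> (f \<circ> \<iota>) ` carrier N" if x: "x \<in> carrier M'" for x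
  proof -
    obtain y where y: "y \<in> carrier M" "x = f y" using x surj by blast
    with M obtain m n where "m \<ge> (1::nat)" "n \<in> carrier N" "y [^]\<^bsub>M\<^esub> m = \<iota> n"
      unfolding rational_malcev_completion_def by (metis imageE)
    moreover from this have "x [^]\<^bsub>M'\<^esub> m = (f \<circ> \<iota>) n" using y eq[OF y(1) \<iota>] by simp
    ultimately show ?thesis by blast
  qed
  ultimately show ?thesis by (simp add: rational_malcev_completion_def)
qed

lemma rationally_indecomposableI:
  fixes N :: "('a, 'm) monoid_scheme" and M :: "('b, 'n) monoid_scheme"
  assumes N: "group N" and M: "rational_malcev_completion N M \<iota>" and ind: "directly_indecomposable M"
  shows "rationally_indecomposable N"
proof -
  have gM: "group M" using M by (simp add: rational_malcev_completion_def nilpotent_group_def)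
  have "\<forall>x \<in> carrier M. \<exists>p. fst p \<in> carrier N \<and> snd p \<ge> 1 \<and> x [^]\<^bsub>M\<^esub> (snd p :: nat) = \<iota> (fst p)"
    using M unfolding rational_malcev_completion_def by (metis fst_conv snd_conv imageE)
  then obtain f where f: "fst (f x) \<in> carrier N" "snd (f x) \<ge> 1" "x [^]\<^bsub>M\<^esub> (snd (f x) :: nat) = \<iota> (fst (f x))"
    if "x \<in> carrier M" for x
    by metis
  have inj: "inj_on f (carrier M)"
  proof (rule inj_onI)
    fix x y assume xy: "x \<in> carrier M" "y \<in> carrier M" "f x = f y"
    have "\<exists>!z. z \<in> carrier M \<and> z [^]\<^bsub>M\<^esub> snd (f x) = \<iota> (fst (f x))"
      using M f[OF xy(1)] by (simp add: rational_malcev_completion_def)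
    moreover have "y [^]\<^bsub>M\<^esub> snd (f x) = \<iota> (fst (f x))" using f[OF xy(2)] xy(3) by simp
    ultimately show "x = y" using f(3)[OF xy(1)] xy(1,2) by blast
  qed
  let ?M = "image_group f M"
  have iso: "f \<in> iso M ?M" and gM': "group ?M"
    using image_group_iso group_image_group gM inj by blast+
  have "rational_malcev_completion N ?M (f \<circ> \<iota>)"
    by (rule rational_malcev_completion_iso[OF M N iso gM'])
  moreover have "directly_indecomposable ?M"
    by (rule directly_indecomposable_iso[OF ind gM gM' is_isoI[OF iso]])
  ultimately show ?thesis unfolding rationally_indecomposable_def by blast
qed

end

theory Submission
  imports Defs
begin

text \<open>Malcev completions enter only through two consequences for each factor \<open>G\<close>: roots in \<open>G\<close> are
  unique, and no two nontrivial commuting subgroups \<open>A\<close>, \<open>B\<close> with \<open>A \<inter> B = 1\<close> have a product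
  containing a power of every element. A Fitting lemma for endomorphisms commuting with
  conjugations then needs only the ascending chain condition, and the Krull--Schmidt argument shows
  that an automorphism of a product of such groups is a permutation of isomorphic factors,
  composed with automorphisms of the factors, up to homomorphisms into the center. The latter kill
  the center of each factor, because in a non-abelian factor some power of every central element
  lies in the derived group.

  They do not affect the Reidemeister number: if it is finite on \<open>N\<close> modulo its center, then
  twisted conjugation there is free, and the count on \<open>N\<close> depends only on the induced maps on
  the center and on the quotient. Finally, a cycle of the permutation contributes the Reidemeister
  number of the composite of the automorphisms along it, so \<open>r\<close> copies of \<open>G\<close> contribute a product
  of as many elements of the spectrum of \<open>G\<close> as the permutation has cycles.\<close>

section \<open>Commutators and the lower central series\<close>

text \<open>The Krull-Schmidt argument is classical for groups with both chain conditions, where an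
  injective normal endomorphism is onto. Here it need not be: doubling on the integers is injective.
  Hence surjectivity and direct decompositions are first obtained only up to powers, as statements
  \<open>roots G L = carrier G\<close>, and indecomposability has to exclude even such virtual
  decompositions. This is what indecomposability of the completion says when it is read inside the
  group itself. Uniqueness of roots turns statements about powers back into statements about
  elements: commuting with \<open>x [^] k\<close> forces commuting with \<open>x\<close>. It makes
  the entries of an automorphism away from the permuted diagonal central, and then trivial on
  centers, so that on the center the automorphism merely permutes and transforms coordinates. Only
  after that do the diagonal entries, so far known to be onto up to powers, turn out to be
  isomorphisms.\<close>

lemma (in group) inv_mult_cancel [simp]:
  assumes "x \<in> carrier G" "y \<in> carrier G"
  shows "inv x \<otimes> (x \<otimes> y) = y" "x \<otimes> (inv x \<otimes> y) = y"
  using assms by (simp_all flip: m_assoc)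

text \<open>Written with the word used in \<open>lower_central\<close>, so that the series can be
  restated by \<open>lower_central_Suc\<close>.\<close>

definition commutator :: "('a, 'm) monoid_scheme \<Rightarrow> 'a \<Rightarrow> 'a \<Rightarrow> 'a" where
  "commutator G x y = x \<otimes>\<^bsub>G\<^esub> y \<otimes>\<^bsub>G\<^esub> inv\<^bsub>G\<^esub> x \<otimes>\<^bsub>G\<^esub> inv\<^bsub>G\<^esub> y"

definition center :: "('a, 'm) monoid_scheme \<Rightarrow> 'a set" where
  "center G = {z \<in> carrier G. \<forall>g \<in> carrier G. z \<otimes>\<^bsub>G\<^esub> g = g \<otimes>\<^bsub>G\<^esub> z}"

context group
begin

lemma center_closed: "z \<in> center G \<Longrightarrow> z \<in> carrier G"
  by (simp add: center_def)

lemma center_commute: "z \<in> center G \<Longrightarrow> g \<in> carrier G \<Longrightarrow> z \<otimes> g = g \<otimes> z"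
  by (simp add: center_def)

lemma commute_mult:
  assumes "x \<in> carrier G" "y \<in> carrier G" "g \<in> carrier G" "x \<otimes> g = g \<otimes> x" "y \<otimes> g = g \<otimes> y"
  shows "(x \<otimes> y) \<otimes> g = g \<otimes> (x \<otimes> y)"
  using assms by (metis m_assoc)

lemma commute_inv:
  assumes "x \<in> carrier G" "g \<in> carrier G" "x \<otimes> g = g \<otimes> x"
  shows "inv x \<otimes> g = g \<otimes> inv x"
  using assms by (metis inv_closed inv_solve_left inv_solve_right m_assoc m_closed)

text \<open>Turns commutation with a fixed set into membership in a subgroup, so that it only has to
  be checked on generators.\<close>

lemma subgroup_centralizer:
  assumes "U \<subseteq> carrier G"
  shows "subgroup {x \<in> carrier G. \<forall>u\<in>U. x \<otimes> u = u \<otimes> x} G"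
  by (rule subgroupI) (use assms in \<open>auto simp: commute_mult commute_inv subset_iff\<close>)

lemma subgroup_center: "subgroup (center G) G"
  using subgroup_centralizer[of "carrier G"] by (simp add: center_def)

lemma normal_central:
  assumes "subgroup H G" "H \<subseteq> center G"
  shows "H \<lhd> G"
  unfolding normal_inv_iff
proof (intro conjI ballI assms(1))
  fix x h assume "x \<in> carrier G" "h \<in> H"
  moreover from this have "h \<in> center G" using assms by blast
  ultimately show "x \<otimes> h \<otimes> inv x \<in> H"
    by (metis center_closed center_commute inv_closed inv_mult_cancel(1) m_assoc r_inv r_one)
qed

lemma commutator_closed [simp, intro]:
  "x \<in> carrier G \<Longrightarrow> y \<in> carrier G \<Longrightarrow> commutator G x y \<in> carrier G"
  by (simp add: commutator_def)

lemma commutator_one_iff: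
  assumes "x \<in> carrier G" "y \<in> carrier G"
  shows "commutator G x y = \<one> \<longleftrightarrow> x \<otimes> y = y \<otimes> x"
  using assms unfolding commutator_def
  by (metis inv_closed inv_equality inv_inv inv_mult_group l_inv m_assoc m_closed r_inv)

lemma commutator_mult_left:
  assumes "x \<in> carrier G" "x' \<in> carrier G" "y \<in> carrier G" "commutator G x' y \<in> center G"
  shows "commutator G (x \<otimes> x') y = commutator G x y \<otimes> commutator G x' y"
proof -
  have "commutator G (x \<otimes> x') y = x \<otimes> (commutator G x' y \<otimes> (y \<otimes> inv x \<otimes> inv y))"
    using assms by (simp add: commutator_def m_assoc inv_mult_group)
  also have "\<dots> = x \<otimes> ((y \<otimes> inv x \<otimes> inv y) \<otimes> commutator G x' y)"
    using assms by (simp add: center_commute[OF assms(4), of "y \<otimes> inv x \<otimes> inv y"])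
  also have "\<dots> = commutator G x y \<otimes> commutator G x' y"
    using assms by (simp add: commutator_def m_assoc)
  finally show ?thesis .
qed

lemma commutator_mult_right:
  assumes "x \<in> carrier G" "y \<in> carrier G" "y' \<in> carrier G" "commutator G x y' \<in> center G"
  shows "commutator G x (y \<otimes> y') = commutator G x y \<otimes> commutator G x y'"
proof -
  have "commutator G x (y \<otimes> y') = x \<otimes> y \<otimes> inv x \<otimes> (commutator G x y' \<otimes> inv y)"
    using assms by (simp add: commutator_def m_assoc inv_mult_group)
  also have "\<dots> = x \<otimes> y \<otimes> inv x \<otimes> (inv y \<otimes> commutator G x y')"
    using assms by (simp add: center_commute[OF assms(4), of "inv y"])
  also have "\<dots> = commutator G x y \<otimes> commutator G x y'"
    using assms by (simp add: commutator_def m_assoc)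
  finally show ?thesis .
qed

lemma commutator_pow_left:
  assumes "x \<in> carrier G" "y \<in> carrier G" "commutator G x y \<in> center G"
  shows "commutator G (x [^] (k::nat)) y = commutator G x y [^] k"
proof (induction k)
  case 0
  show ?case using assms by (simp add: commutator_one_iff)
next
  case (Suc k)
  then show ?case using assms by (simp add: commutator_mult_left)
qed

lemma commutator_pow_right:
  assumes "x \<in> carrier G" "y \<in> carrier G" "commutator G x y \<in> center G"
  shows "commutator G x (y [^] (k::nat)) = commutator G x y [^] k"
proof (induction k)
  case 0
  show ?case using assms by (simp add: commutator_one_iff)
next
  case (Suc k)
  then show ?case using assms by (simp add: commutator_mult_right)
qed

lemma center_pow: "z \<in> center G \<Longrightarrow> z [^] (k::nat) \<in> center G"
  using subgroup_center by (induction k) (auto simp: subgroup.m_closed subgroup.one_closed)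

lemma commutator_pow:
  assumes "x \<in> carrier G" "y \<in> carrier G" "commutator G x y \<in> center G"
  shows "commutator G (x [^] (k::nat)) (y [^] (l::nat)) = commutator G x y [^] (k * l)"
  using assms by (simp add: commutator_pow_right commutator_pow_left center_pow nat_pow_pow)

text \<open>Commutators depend only on classes modulo the center. This is what lets generators of a
  quotient control the last term of the lower central series.\<close>

lemma commutator_mult_center:
  assumes "x \<in> carrier G" "y \<in> carrier G" "z \<in> center G" "w \<in> center G"
  shows "commutator G (x \<otimes> z) (y \<otimes> w) = commutator G x y"
proof -
  have c: "z \<in> carrier G" "w \<in> carrier G" using assms center_closed by auto
  have "commutator G x w = \<one>" "commutator G z (y \<otimes> w) = \<one>"
    using assms c center_commute[OF assms(3)] center_commute[OF assms(4)]
    by (simp_all add: commutator_one_iff)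
  then have "commutator G (x \<otimes> z) (y \<otimes> w) = commutator G x (y \<otimes> w)"
    using assms c by (subst commutator_mult_left) (auto simp: subgroup.one_closed[OF subgroup_center])
  also have "\<dots> = commutator G x y"
    using assms c \<open>commutator G x w = \<one>\<close>
    by (subst commutator_mult_right) (auto simp: subgroup.one_closed[OF subgroup_center])
  finally show ?thesis .
qed

lemma commutator_inv_left:
  assumes "x \<in> carrier G" "y \<in> carrier G" "commutator G x y \<in> center G"
  shows "commutator G (inv x) y = inv (commutator G x y)"
proof -
  have "commutator G (inv x) y \<otimes> commutator G x y = \<one>"
    using commutator_mult_left[of "inv x" x y] assms commutator_one_iff[of \<one> y] by simp
  then show ?thesis using assms inv_equality by simp
qed

lemma commutator_inv_right:
  assumes "x \<in> carrier G" "y \<in> carrier G" "commutator G x y \<in> center G"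
  shows "commutator G x (inv y) = inv (commutator G x y)"
proof -
  have "commutator G x (inv y) \<otimes> commutator G x y = \<one>"
    using commutator_mult_right[of x "inv y" y] assms commutator_one_iff[of x \<one>] by simp
  then show ?thesis using assms inv_equality by simp
qed

end

lemma (in group_hom) hom_commutator:
  "x \<in> carrier G \<Longrightarrow> y \<in> carrier G \<Longrightarrow> h (commutator G x y) = commutator H (h x) (h y)"
  by (simp add: commutator_def)

lemma lower_central_Suc:
  "lower_central G (Suc n) = generate G {commutator G x y | x y. x \<in> lower_central G n \<and> y \<in> carrier G}"
  by (simp add: commutator_def)

declare lower_central.simps(2) [simp del]

lemma (in group) subgroup_lower_central: "subgroup (lower_central G n) G"
proof (cases n)
  case 0
  then show ?thesis by (simp add: subgroup_self)
next
  case (Suc m)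
  have "{commutator G x y | x y. x \<in> lower_central G m \<and> y \<in> carrier G} \<subseteq> carrier G"
    using lower_central_subset[OF is_group] by fastforce
  then show ?thesis unfolding Suc lower_central_Suc by (rule generate_is_subgroup)
qed

lemma (in group) commutator_in_lower_central:
  "x \<in> lower_central G n \<Longrightarrow> y \<in> carrier G \<Longrightarrow> commutator G x y \<in> lower_central G (Suc n)"
  unfolding lower_central_Suc by (rule generate.incl) blast

lemma (in group) lower_central_central:
  assumes "lower_central G (Suc n) = {\<one>}"
  shows "lower_central G n \<subseteq> center G"
proof
  fix x assume x: "x \<in> lower_central G n"
  have "x \<in> carrier G" using x lower_central_subset[OF is_group] by blast
  then show "x \<in> center G"
    using commutator_in_lower_central[OF x] assms by (simp add: center_def commutator_one_iff)
qed

text \<open>Raises the class at will: to give all factors of a product one common class, and to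
  write a class as a successor where the quotient by the center is taken.\<close>

lemma (in group) lower_central_trivial_add:
  assumes "lower_central G c = {\<one>}"
  shows "lower_central G (c + d) = {\<one>}"
proof (induction d)
  case 0
  show ?case using assms by simp
next
  case (Suc d)
  have "commutator G x y = \<one>" if "x \<in> lower_central G (c + d)" "y \<in> carrier G" for x y
    using that unfolding Suc.IH by (simp add: commutator_one_iff)
  then have "lower_central G (Suc (c + d)) \<subseteq> {\<one>}"
    unfolding lower_central_Suc by (intro generate_subgroup_incl[OF _ triv_subgroup]) blast
  then show ?case using subgroup.one_closed[OF subgroup_lower_central, of "Suc (c + d)"] by auto
qed

text \<open>Commutators of images are images of commutators, so surjectivity suffices and the result
  covers quotients.\<close>

lemma (in group_hom) lower_central_epi:
  assumes "h ` carrier G = carrier H"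
  shows "lower_central H n = h ` lower_central G n"
proof (induction n)
  case 0
  then show ?case using assms by simp
next
  case (Suc n)
  have sub: "\<And>x. x \<in> lower_central G n \<Longrightarrow> x \<in> carrier G"
    using lower_central_subset[OF G.is_group] by blast
  have "{commutator H x y | x y. x \<in> lower_central H n \<and> y \<in> carrier H}
      = h ` {commutator G x y | x y. x \<in> lower_central G n \<and> y \<in> carrier G}"
  proof (intro equalityI subsetI)
    fix z assume "z \<in> {commutator H x y | x y. x \<in> lower_central H n \<and> y \<in> carrier H}"
    then obtain x y where xy: "x \<in> lower_central G n" "y \<in> carrier G" "z = commutator H (h x) (h y)"
      unfolding Suc.IH assms[symmetric] by blast
    then have "z = h (commutator G x y)" by (simp add: hom_commutator sub)
    with xy show "z \<in> h ` {commutator G x y | x y. x \<in> lower_central G n \<and> y \<in> carrier G}" by blast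
  next
    fix z assume "z \<in> h ` {commutator G x y | x y. x \<in> lower_central G n \<and> y \<in> carrier G}"
    then obtain x y where xy: "x \<in> lower_central G n" "y \<in> carrier G" "z = h (commutator G x y)"
      by blast
    then have "z = commutator H (h x) (h y)" by (simp add: hom_commutator sub)
    with xy show "z \<in> {commutator H x y | x y. x \<in> lower_central H n \<and> y \<in> carrier H}"
      unfolding Suc.IH using sub by (blast intro: hom_closed)
  qed
  moreover have "{commutator G x y | x y. x \<in> lower_central G n \<and> y \<in> carrier G} \<subseteq> carrier G"
    using sub by auto
  ultimately show ?case
    unfolding lower_central_Suc by (simp only: generate_img)
qed

text \<open>The quotient is transported back to the element type of \<open>G\<close>, so that one can argue by
  induction over all groups on a fixed type.\<close>

lemma (in normal) quotient_on_same_type: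
  obtains Q :: "'a monoid" and p where "group_hom G Q p" "p ` carrier G = carrier Q"
    "\<And>x. x \<in> carrier G \<Longrightarrow> p x = \<one>\<^bsub>Q\<^esub> \<longleftrightarrow> x \<in> H"
proof
  \<comment> \<open>A coset is named by a chosen element of it; disjointness of cosets makes this
    naming injective.\<close>
  define f :: "'a set \<Rightarrow> 'a" where "f C = (SOME x. x \<in> C)" for C
  let ?Q = "image_group f (G Mod H)"
  have ne: "f C \<in> C" if "C \<in> rcosets H" for C
    using rcosets_non_empty[OF that] unfolding f_def by (simp add: some_in_eq)
  have inj: "inj_on f (carrier (G Mod H))"
  proof (rule inj_onI)
    fix C D assume "C \<in> carrier (G Mod H)" "D \<in> carrier (G Mod H)" "f C = f D"
    then have CD: "C \<in> rcosets H" "D \<in> rcosets H" "f C \<in> C" "f C \<in> D"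
      using ne[of C] ne[of D] by (auto simp: FactGroup_def)
    then show "C = D" using rcos_disjoint[OF subgroup_axioms]
      by (metis disjnt_iff ne pairwiseD)
  qed
  have Q: "group ?Q" using group_image_group[OF factorgroup_is_group inj] .
  define p where "p = f \<circ> (\<lambda>x. H #> x)"
  have "p \<in> hom G ?Q"
    unfolding p_def by (rule Group.hom_compose[OF r_coset_hom_Mod])
      (use image_group_iso[OF inj] in \<open>simp add: iso_def\<close>)
  with Q show gh: "group_hom G ?Q (f \<circ> (\<lambda>x. H #> x))" by (simp add: group_hom_def group_hom_axioms_def p_def)
  show "(f \<circ> (\<lambda>x. H #> x)) ` carrier G = carrier ?Q"
    by (auto simp: image_group_def carrier_FactGroup)
  fix x assume x: "x \<in> carrier G"
  have "f (H #> x) = f H \<longleftrightarrow> H #> x = H"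
    using x by (intro inj_on_eq_iff[OF inj]) (auto simp: FactGroup_def rcosetsI subset subgroup_in_rcosets[OF is_group])
  also have "\<dots> \<longleftrightarrow> x \<in> H"
    using x coset_join1 coset_join2 subgroup_axioms subset by metis
  finally show "(f \<circ> (\<lambda>x. H #> x)) x = \<one>\<^bsub>?Q\<^esub> \<longleftrightarrow> x \<in> H"
    by (simp add: image_group_def)
qed

section \<open>The ascending chain condition on subgroups\<close>

lemma (in group_hom) hom_eq_iff:
  assumes "x \<in> carrier G" "y \<in> carrier G"
  shows "h x = h y \<longleftrightarrow> h (x \<otimes> inv y) = \<one>\<^bsub>H\<^esub>"
  using assms by (metis G.inv_closed H.inv_equality H.inv_inv H.r_inv hom_closed hom_inv hom_mult)

text \<open>Chains are bounded by a set \<open>K\<close> that need not be a subgroup, so images and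
  intersections can take the place of \<open>K\<close> without further proof. For
  \<open>K = carrier G\<close> this is the maximal condition on subgroups.\<close>

definition noetherian_on :: "('a, 'm) monoid_scheme \<Rightarrow> 'a set \<Rightarrow> bool" where
  "noetherian_on G K \<longleftrightarrow> (\<forall>A :: nat \<Rightarrow> 'a set.
     (\<forall>n. subgroup (A n) G \<and> A n \<subseteq> K \<and> A n \<subseteq> A (Suc n)) \<longrightarrow> (\<exists>m. \<forall>n\<ge>m. A n = A m))"

abbreviation noetherian_group :: "('a, 'm) monoid_scheme \<Rightarrow> bool" where
  "noetherian_group G \<equiv> noetherian_on G (carrier G)"

lemma noetherian_onD:
  assumes "noetherian_on G K" "\<And>n. subgroup (A n) G" "\<And>n. A n \<subseteq> K" "\<And>n. A n \<subseteq> A (Suc n)"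
  obtains m where "\<And>n. n \<ge> m \<Longrightarrow> A n = A m"
  using assms unfolding noetherian_on_def by meson

lemma (in group) noetherian_on_trivial: "noetherian_on G {\<one>}"
  unfolding noetherian_on_def
proof (intro allI impI)
  fix A :: "nat \<Rightarrow> 'a set"
  assume "\<forall>n. subgroup (A n) G \<and> A n \<subseteq> {\<one>} \<and> A n \<subseteq> A (Suc n)"
  then have "A n = {\<one>}" for n using subgroup.one_closed by blast
  then show "\<exists>m. \<forall>n\<ge>m. A n = A m" by auto
qed

text \<open>A chain is stable as soon as both its image and its intersection with the kernel are: an
  element of a later term differs from one of the earlier term by an element of the kernel.\<close>

lemma (in group_hom) noetherian_on_extension:
  assumes "noetherian_on H (h ` K)" "noetherian_on G (K \<inter> kernel G H h)"
  shows "noetherian_on G K"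
  unfolding noetherian_on_def
proof (intro allI impI)
  fix A :: "nat \<Rightarrow> 'a set"
  assume "\<forall>n. subgroup (A n) G \<and> A n \<subseteq> K \<and> A n \<subseteq> A (Suc n)"
  then have A: "subgroup (A n) G" "A n \<subseteq> K" "A n \<subseteq> A (Suc n)" for n by simp_all
  have carr: "A n \<subseteq> carrier G" for n using subgroup.subset[OF A(1)] .
  have mono: "A m \<subseteq> A n" if "m \<le> n" for m n
    using lift_Suc_mono_le[of A m n, OF A(3) that] .
  obtain m1 where m1: "\<And>n. n \<ge> m1 \<Longrightarrow> h ` A n = h ` A m1"
  proof (rule noetherian_onD[OF assms(1), of "\<lambda>n. h ` A n"])
    show "subgroup (h ` A n) H" for n using A(1) subgroup_img_is_subgroup by blast
  qed (use A(2) image_mono[OF A(3), of h] in \<open>blast+\<close>)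
  obtain m2 where m2: "\<And>n. n \<ge> m2 \<Longrightarrow> A n \<inter> kernel G H h = A m2 \<inter> kernel G H h"
  proof (rule noetherian_onD[OF assms(2), of "\<lambda>n. A n \<inter> kernel G H h"])
    show "subgroup (A n \<inter> kernel G H h) G" for n
      using A(1) subgroup_kernel G.subgroups_Inter_pair by blast
  qed (use A(2,3) in \<open>blast+\<close>)
  let ?m = "max m1 m2"
  have "A n \<subseteq> A ?m" if n: "n \<ge> ?m" for n
  proof
    fix x assume x: "x \<in> A n"
    have "h ` A n = h ` A ?m" using m1[of n] m1[of ?m] n by simp
    then obtain y where y: "y \<in> A ?m" "h x = h y" using x by blast
    have c: "x \<in> carrier G" "y \<in> carrier G" using x y carr by auto
    have "x \<otimes> inv y \<in> A n"
      using x y mono[OF n] subgroup.m_closed[OF A(1)] subgroup.m_inv_closed[OF A(1)] by blast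
    moreover have "x \<otimes> inv y \<in> kernel G H h"
      using c y hom_eq_iff[OF c] by (simp add: kernel_def)
    ultimately have "x \<otimes> inv y \<in> A ?m" using m2[of n] m2[of ?m] n by auto
    then have "x \<otimes> inv y \<otimes> y \<in> A ?m" using y subgroup.m_closed[OF A(1)] by blast
    then show "x \<in> A ?m" using c by (simp add: G.m_assoc)
  qed
  then show "\<exists>m. \<forall>n\<ge>m. A n = A m" using mono by blast
qed

text \<open>The preimages of a chain form a chain, and surjectivity recovers each term from its
  preimage.\<close>

lemma (in group_hom) noetherian_epi:
  assumes "noetherian_group G" "h ` carrier G = carrier H"
  shows "noetherian_group H"
  unfolding noetherian_on_def
proof (intro allI impI)
  fix A :: "nat \<Rightarrow> 'c set"
  assume "\<forall>n. subgroup (A n) H \<and> A n \<subseteq> carrier H \<and> A n \<subseteq> A (Suc n)"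
  then have A: "subgroup (A n) H" "A n \<subseteq> carrier H" "A n \<subseteq> A (Suc n)" for n by simp_all
  let ?B = "\<lambda>n. {x \<in> carrier G. h x \<in> A n}"
  have sub: "subgroup (?B n) G" for n
  proof -
    interpret A: subgroup "A n" H by (rule A(1))
    show ?thesis by (rule G.subgroupI) auto
  qed
  obtain m where m: "\<And>n. n \<ge> m \<Longrightarrow> ?B n = ?B m"
    by (rule noetherian_onD[OF assms(1), of ?B, OF sub]) (use A(3) in \<open>blast+\<close>)
  have "A n = h ` ?B n" for n
  proof -
    have "A n \<subseteq> h ` carrier G" using A(2)[of n] assms(2) by simp
    then show ?thesis by blast
  qed
  then show "\<exists>m. \<forall>n\<ge>m. A n = A m" using m by metis
qed

text \<open>Otherwise elements could be added one at a time for ever, each outside the subgroup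
  generated so far.\<close>

lemma (in group) noetherian_imp_finitely_generated:
  assumes "noetherian_on G K" "subgroup H G" "H \<subseteq> K"
  obtains S where "finite S" "S \<subseteq> H" "generate G S = H"
proof (rule ccontr)
  assume "\<not> thesis"
  then have ne: "\<And>S. finite S \<Longrightarrow> S \<subseteq> H \<Longrightarrow> generate G S \<noteq> H" using that by blast
  have carr: "H \<subseteq> carrier G" using assms(2) subgroup.subset by blast
  have ex: "\<exists>x. x \<in> H \<and> x \<notin> generate G S" if "finite S" "S \<subseteq> H" for S
    using ne[OF that] generate_subgroup_incl[OF that(2) assms(2)] by blast
  define S where "S = rec_nat {} (\<lambda>n S. insert (SOME x. x \<in> H \<and> x \<notin> generate G S) S)"
  have S0: "S 0 = {}" and SS: "S (Suc n) = insert (SOME x. x \<in> H \<and> x \<notin> generate G (S n)) (S n)" for n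
    by (simp_all add: S_def)
  have fin: "finite (S n) \<and> S n \<subseteq> H" for n
  proof (induction n)
    case (Suc n)
    then show ?case unfolding SS using someI_ex[OF ex[of "S n"]] by simp
  qed (simp add: S0)
  have new: "(SOME x. x \<in> H \<and> x \<notin> generate G (S n)) \<notin> generate G (S n)" for n
    using someI_ex[OF ex[of "S n"]] fin by simp
  obtain m where m: "\<And>n. n \<ge> m \<Longrightarrow> generate G (S n) = generate G (S m)"
  proof (rule noetherian_onD[OF assms(1), of "\<lambda>n. generate G (S n)"])
    show "subgroup (generate G (S n)) G" for n
      using fin[of n] carr by (intro generate_is_subgroup) auto
    show "generate G (S n) \<subseteq> K" for n
      using generate_subgroup_incl[OF _ assms(2)] fin[of n] assms(3) by blast
    show "generate G (S n) \<subseteq> generate G (S (Suc n))" for n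
      by (rule mono_generate) (simp add: SS subset_insertI)
  qed auto
  have "(SOME x. x \<in> H \<and> x \<notin> generate G (S m)) \<in> generate G (S (Suc m))"
    by (rule generate.incl) (simp add: SS)
  then show False using m[of "Suc m"] new[of m] by simp
qed

text \<open>The exponents occurring in a term form a subgroup of the integers, so the proof is
  division with remainder.\<close>

lemma (in group) noetherian_on_cyclic:
  assumes y: "y \<in> carrier G"
  shows "noetherian_on G (generate G {y})"
  unfolding noetherian_on_def
proof (intro allI impI)
  fix A :: "nat \<Rightarrow> 'a set"
  assume "\<forall>n. subgroup (A n) G \<and> A n \<subseteq> generate G {y} \<and> A n \<subseteq> A (Suc n)"
  then have A: "subgroup (A n) G" "A n \<subseteq> generate G {y}" "A n \<subseteq> A (Suc n)" for n by simp_all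
  have mono: "A m \<subseteq> A n" if "m \<le> n" for m n
    using lift_Suc_mono_le[of A m n, OF A(3) that] .
  have pw: "\<exists>k::int. a = y [^] k" if "a \<in> A n" for a n
    using A(2)[of n] that generate_pow[OF y] by blast
  show "\<exists>m. \<forall>n\<ge>m. A n = A m"
  proof (cases "\<exists>d::nat. d > 0 \<and> (\<exists>n. y [^] (int d) \<in> A n)")
    case True
    \<comment> \<open>\<open>d\<close> is least over the whole chain and not over a single term;
      from a term containing \<open>y [^] int d\<close> on, nothing new can appear.\<close>
    define d where "d = (LEAST d::nat. d > 0 \<and> (\<exists>n. y [^] (int d) \<in> A n))"
    have d: "d > 0" "\<exists>n. y [^] (int d) \<in> A n"
      using LeastI_ex[OF True] by (auto simp: d_def)
    then obtain m where m: "y [^] (int d) \<in> A m" by blast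
    have "A n \<subseteq> A m" if n: "n \<ge> m" for n
    proof
      fix a assume a: "a \<in> A n"
      then obtain k :: int where k: "a = y [^] k" using pw by blast
      have dn: "y [^] (int d) \<in> A n" using m mono[OF n] by blast
      have q: "y [^] (int d * (k div int d)) \<in> A l" if "y [^] (int d) \<in> A l" for l
        using subgroup_int_pow_closed[of "A l" "y [^] (int d)" "k div int d", OF A(1) that] y
        by (simp add: int_pow_pow)
      have "y [^] (k mod int d) = y [^] k \<otimes> inv (y [^] (int d * (k div int d)))"
        using y by (simp add: minus_mult_div_eq_mod flip: int_pow_diff)
      also have "\<dots> \<in> A n"
        using q[OF dn] a k subgroup.m_closed[OF A(1)] subgroup.m_inv_closed[OF A(1)] by blast
      finally have "y [^] (int (nat (k mod int d))) \<in> A n" using d by simp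
      moreover have "nat (k mod int d) < d" using d by (simp add: nat_less_iff)
      ultimately have "nat (k mod int d) = 0"
        using not_less_Least[of "nat (k mod int d)" "\<lambda>d. d > 0 \<and> (\<exists>n. y [^] (int d) \<in> A n)", folded d_def]
        by (metis neq0_conv)
      moreover have "k mod int d \<ge> 0" using d by simp
      ultimately have "k mod int d = 0" by simp
      then have "k = int d * (k div int d)" by auto
      then show "a \<in> A m" using q[OF m] k by simp
    qed
    then show ?thesis using mono by blast
  next
    case False
    have F: "y [^] int d \<notin> A n" if "d > 0" for d n
      using False that by blast
    have "A n = {\<one>}" for n
    proof -
      have "a = \<one>" if a: "a \<in> A n" for a
      proof -
        obtain k :: int where k: "a = y [^] k" using pw a by blast
        have "y [^] (- k) \<in> A n"
          using subgroup.m_inv_closed[OF A(1) a] k y by (simp add: int_pow_neg)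
        then have "y [^] (int (nat \<bar>k\<bar>)) \<in> A n" using a k by (auto simp: abs_if)
        then have "k = 0" using F[of "nat \<bar>k\<bar>" n] by linarith
        then show ?thesis using k by simp
      qed
      then show ?thesis using subgroup.one_closed[OF A(1)] by blast
    qed
    then show ?thesis by auto
  qed
qed

text \<open>Induction on the number of generators, dividing out the central cyclic subgroup
  generated by one of them.\<close>

lemma noetherian_on_central:
  fixes G :: "'a monoid"
  assumes "group G" "finite S" "S \<subseteq> center G"
  shows "noetherian_on G (generate G S)"
proof -
  \<comment> \<open>The group varies and the size is only bounded, because the quotient is a new
    group in which generators may collide.\<close>
  have "noetherian_on G (generate G S)"
    if "group G" "finite S" "S \<subseteq> center G" "card S \<le> n" for n and G :: "'a monoid" and S
    using that
  proof (induction n arbitrary: G S)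
    case 0
    then show ?case
      by (simp add: group.noetherian_on_trivial group.generate_empty)
  next
    case (Suc n)
    interpret group G by fact
    show ?case
    proof (cases "S = {}")
      case True
      then show ?thesis by (simp add: noetherian_on_trivial generate_empty)
    next
      case False
      then obtain y Y where Y: "S = insert y Y" "y \<notin> Y" by (metis mk_disjoint_insert equals0I)
      have Xc: "S \<subseteq> carrier G" using Suc.prems center_closed by blast
      then have y: "y \<in> carrier G" "y \<in> center G" using Y Suc.prems by auto
      have "generate G {y} \<subseteq> center G"
        using generate_subgroup_incl[OF _ subgroup_center] y by simp
      then have "generate G {y} \<lhd> G"
        using normal_central generate_is_subgroup y by simp
      then interpret K: normal "generate G {y}" G .
      obtain Q :: "'a monoid" and p where Q: "group_hom G Q p" "p ` carrier G = carrier Q"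
        "\<And>x. x \<in> carrier G \<Longrightarrow> p x = \<one>\<^bsub>Q\<^esub> \<longleftrightarrow> x \<in> generate G {y}"
        using K.quotient_on_same_type by blast
      interpret p: group_hom G Q p by fact
      have "noetherian_on Q (generate Q (p ` Y))"
      proof (rule Suc.IH[OF p.H.is_group])
        show "card (p ` Y) \<le> n"
          using card_image_le[of Y p] Suc.prems Y by simp
        show "p ` Y \<subseteq> center Q"
        proof
          fix w assume "w \<in> p ` Y"
          then obtain v where v: "v \<in> Y" "w = p v" by blast
          then have vc: "v \<in> center G" using Y Suc.prems by auto
          have "p v \<otimes>\<^bsub>Q\<^esub> p g = p g \<otimes>\<^bsub>Q\<^esub> p v" if "g \<in> carrier G" for g
            using center_commute[OF vc that] that center_closed[OF vc] by (metis p.hom_mult)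
          then show "w \<in> center Q"
            using v center_closed[OF vc] by (auto simp: center_def simp flip: Q(2))
        qed
      qed (use Suc.prems Y in auto)
      moreover have "p ` generate G S = generate Q (p ` Y)"
      proof -
        have "p y = \<one>\<^bsub>Q\<^esub>" using Q(3)[OF y(1)] by (simp add: generate.incl)
        moreover have "p ` Y \<subseteq> carrier Q" using Xc Y by auto
        ultimately have "generate Q (p ` S) = generate Q (p ` Y)"
          unfolding Y(1) image_insert
          by (intro equalityI p.H.generate_subgroup_incl p.H.mono_generate p.H.generate_is_subgroup)
            (auto intro: generate.incl generate.one)
        then show ?thesis using p.generate_img[OF Xc] by simp
      qed
      moreover have "noetherian_on G (generate G S \<inter> kernel G Q p)"
      proof -
        have "generate G S \<inter> kernel G Q p = generate G {y}"
          using Q(3) mono_generate[of "{y}" S] generate_incl[OF Xc] Y by (auto simp: kernel_def)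
        then show ?thesis using noetherian_on_cyclic y by simp
      qed
      ultimately show ?thesis using p.noetherian_on_extension by metis
    qed
  qed
  then show ?thesis using assms by blast
qed

text \<open>The last nontrivial term is central and hence normal, and a surjection carries the lower
  central series onto the lower central series.\<close>

lemma last_lower_central_quotient:
  fixes G :: "'a monoid"
  assumes "group G" "lower_central G (Suc c) = {\<one>\<^bsub>G\<^esub>}"
  obtains Q :: "'a monoid" and p where "group_hom G Q p" "p ` carrier G = carrier Q"
    "\<And>x. x \<in> carrier G \<Longrightarrow> p x = \<one>\<^bsub>Q\<^esub> \<longleftrightarrow> x \<in> lower_central G c"
    "lower_central Q c = {\<one>\<^bsub>Q\<^esub>}"
proof -
  interpret group G by fact
  interpret C: normal "lower_central G c" G
    using normal_central[OF subgroup_lower_central] lower_central_central assms by blast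
  obtain Q :: "'a monoid" and p where Q: "group_hom G Q p" "p ` carrier G = carrier Q"
    "\<And>x. x \<in> carrier G \<Longrightarrow> p x = \<one>\<^bsub>Q\<^esub> \<longleftrightarrow> x \<in> lower_central G c"
    using C.quotient_on_same_type by blast
  interpret p: group_hom G Q p by fact
  have "p x = \<one>\<^bsub>Q\<^esub>" if "x \<in> lower_central G c" for x using Q(3)[of x] C.subset that by blast
  then have "p ` lower_central G c = (\<lambda>_. \<one>\<^bsub>Q\<^esub>) ` lower_central G c" by (intro image_cong) auto
  then have "p ` lower_central G c = {\<one>\<^bsub>Q\<^esub>}" using C.one_closed by (simp add: image_constant)
  then have "lower_central Q c = {\<one>\<^bsub>Q\<^esub>}" using p.lower_central_epi Q(2) by metis
  with Q show thesis using that by blast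
qed

text \<open>Induction on the class: the last nontrivial term \<open>C\<close> of the lower central series consists of
  products of commutators which modulo \<open>C\<close> only depend on finitely many generators.\<close>

lemma noetherian_nilpotent_step:
  fixes G :: "'a monoid" (structure) and Q :: "'a monoid"
  assumes "group G" "lower_central G (Suc (Suc n)) = {\<one>}"
    "finite S" "S \<subseteq> carrier G" "generate G S = carrier G"
    and Q: "group_hom G Q p" "p ` carrier G = carrier Q"
      "\<And>x. x \<in> carrier G \<Longrightarrow> p x = \<one>\<^bsub>Q\<^esub> \<longleftrightarrow> x \<in> lower_central G (Suc n)"
    and noethQ: "noetherian_group Q"
  shows "noetherian_group G"
proof -
  interpret group G by fact
  interpret p: group_hom G Q p by fact
  let ?C = "lower_central G (Suc n)"
  have Cc: "?C \<subseteq> center G" using lower_central_central[of "Suc n"] assms by simp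
  have one_c: "\<one> \<in> center G" using subgroup.one_closed[OF subgroup_center] .
  interpret C: subgroup ?C G by (rule subgroup_lower_central)
  have lc: "lower_central Q i = p ` lower_central G i" for i using p.lower_central_epi Q(2) .
  let ?D = "lower_central G n"
  have D: "subgroup ?D G" "?D \<subseteq> carrier G" using subgroup_lower_central subgroup.subset by blast+
  \<comment> \<open>The image of \<open>?D\<close> is finitely generated by the maximal condition in
    the quotient; \<open>T\<close> lifts such generators into \<open>?D\<close>.\<close>
  obtain Y where Y: "finite Y" "Y \<subseteq> p ` ?D" "generate Q Y = p ` ?D"
    using p.H.noetherian_imp_finitely_generated[OF noethQ p.H.subgroup_lower_central[of n]]
      lower_central_subset[OF p.H.is_group] lc by metis
  obtain T where T: "finite T" "T \<subseteq> ?D" "Y = p ` T" using finite_subset_image[OF Y(1,2)] by blast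
  \<comment> \<open>Generated by the finitely many commutators of lifted with original generators;
    the aim is \<open>?C = ?E\<close>.\<close>
  let ?E = "generate G {commutator G x s | x s. x \<in> T \<and> s \<in> S}"
  have cmtC: "commutator G x y \<in> ?C" "commutator G x y \<in> center G" if "x \<in> ?D" "y \<in> carrier G" for x y
    using commutator_in_lower_central[OF that] Cc by auto
  have gens: "{commutator G x s | x s. x \<in> T \<and> s \<in> S} \<subseteq> ?C" using cmtC T assms by blast
  then have E: "subgroup ?E G" using C.subset by (intro generate_is_subgroup) auto
  \<comment> \<open>Commutators with central values are multiplicative in each argument. So
    membership in \<open>?E\<close> spreads from \<open>S\<close> to the whole group here, and from
    \<open>T\<close> to the subgroup it generates through \<open>?U\<close>.\<close>
  have TE: "commutator G x y \<in> ?E" if x: "x \<in> T" and y: "y \<in> carrier G" for x y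
  proof -
    have xD: "x \<in> ?D" "x \<in> carrier G" using x T D by auto
    have "subgroup {y \<in> carrier G. commutator G x y \<in> ?E} G"
    proof (rule subgroupI)
      have "commutator G x \<one> = \<one>" using xD by (simp add: commutator_one_iff)
      then have "\<one> \<in> {y \<in> carrier G. commutator G x y \<in> ?E}"
        using subgroup.one_closed[OF E] by simp
      then show "{y \<in> carrier G. commutator G x y \<in> ?E} \<noteq> {}" by blast
      show "inv a \<in> {y \<in> carrier G. commutator G x y \<in> ?E}"
        if "a \<in> {y \<in> carrier G. commutator G x y \<in> ?E}" for a
        using that xD cmtC(2)[OF xD(1), of a] subgroup.m_inv_closed[OF E]
        by (simp add: commutator_inv_right)
      show "a \<otimes> b \<in> {y \<in> carrier G. commutator G x y \<in> ?E}"
        if "a \<in> {y \<in> carrier G. commutator G x y \<in> ?E}" "b \<in> {y \<in> carrier G. commutator G x y \<in> ?E}" for a b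
        using that xD cmtC(2)[OF xD(1), of b] subgroup.m_closed[OF E]
        by (simp add: commutator_mult_right)
    qed auto
    moreover have "S \<subseteq> {y \<in> carrier G. commutator G x y \<in> ?E}"
      using x assms by (auto intro!: generate.incl)
    ultimately show ?thesis using generate_subgroup_incl[of S] y assms by blast
  qed
  let ?U = "{x \<in> ?D. \<forall>y \<in> carrier G. commutator G x y \<in> ?E}"
  have U: "subgroup ?U G"
  proof (rule subgroupI)
    show "?U \<subseteq> carrier G" using D by auto
    have "commutator G \<one> y = \<one>" if "y \<in> carrier G" for y using that by (simp add: commutator_one_iff)
    then have "\<one> \<in> ?U" using subgroup.one_closed[OF E] subgroup.one_closed[OF D(1)] by simp
    then show "?U \<noteq> {}" by blast
    show "inv x \<in> ?U" if "x \<in> ?U" for x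
    proof -
      have x: "x \<in> ?D" "inv x \<in> ?D" "x \<in> carrier G" using that D subgroup.m_inv_closed[OF D(1)] by auto
      then have "commutator G (inv x) y = inv (commutator G x y)" if "y \<in> carrier G" for y
        using cmtC(2)[of x y] that by (simp add: commutator_inv_left)
      then show ?thesis using that x subgroup.m_inv_closed[OF E] by simp
    qed
    show "x \<otimes> x' \<in> ?U" if "x \<in> ?U" "x' \<in> ?U" for x x'
    proof -
      have x: "x \<in> ?D" "x' \<in> ?D" "x \<otimes> x' \<in> ?D" "x \<in> carrier G" "x' \<in> carrier G"
        using that D subgroup.m_closed[OF D(1)] by auto
      then have "commutator G (x \<otimes> x') y = commutator G x y \<otimes> commutator G x' y" if "y \<in> carrier G" for y
        using cmtC(2)[of x' y] that by (simp add: commutator_mult_left)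
      then show ?thesis using that x subgroup.m_closed[OF E] by simp
    qed
  qed
  \<comment> \<open>Modulo the center every \<open>x\<close> in \<open>?D\<close> agrees with an
    element generated by \<open>T\<close>, and commutators do not see the difference.\<close>
  have DU: "?D \<subseteq> ?U"
  proof
    fix x assume x: "x \<in> ?D"
    have Tc: "T \<subseteq> carrier G" using T D by auto
    have "p x \<in> p ` generate G T" using x Y T p.generate_img[OF Tc] by auto
    then obtain u where u: "u \<in> generate G T" "p x = p u" by blast
    have "T \<subseteq> ?U" using T TE by blast
    then have uU: "u \<in> ?U" using u generate_subgroup_incl[OF _ U] by blast
    have c: "x \<in> carrier G" "u \<in> carrier G" using x uU D by auto
    have "p (inv u \<otimes> x) = \<one>\<^bsub>Q\<^esub>" using u c by simp
    then have z: "inv u \<otimes> x \<in> center G" using Q(3)[of "inv u \<otimes> x"] c Cc by auto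
    have "commutator G x y = commutator G u y" if "y \<in> carrier G" for y
      using commutator_mult_center[OF c(2) that z one_c] c that by simp
    then show "x \<in> ?U" using x uU by auto
  qed
  have "?C = ?E"
  proof
    show "?E \<subseteq> ?C" using generate_subgroup_incl[OF gens subgroup_lower_central] .
    have "{commutator G x y | x y. x \<in> ?D \<and> y \<in> carrier G} \<subseteq> ?E" using DU by blast
    then show "?C \<subseteq> ?E" unfolding lower_central_Suc using generate_subgroup_incl[OF _ E] by blast
  qed
  moreover have "finite {commutator G x s | x s. x \<in> T \<and> s \<in> S}"
    using T assms by (intro finite_image_set2) auto
  ultimately have "noetherian_on G ?C" using noetherian_on_central[OF is_group] gens Cc by auto
  moreover have "carrier G \<inter> kernel G Q p = ?C" using Q(3) C.subset by (auto simp: kernel_def)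
  ultimately show ?thesis using p.noetherian_on_extension[of "carrier G"] noethQ Q(2) by simp
qed

text \<open>Classes 0 and 1 are both base cases: the step describes the last term by commutators
  with elements of the term before it, and that needs class at least two.\<close>

lemma noetherian_nilpotent:
  fixes G :: "'a monoid"
  assumes "group G" "lower_central G c = {\<one>\<^bsub>G\<^esub>}" "finite S" "S \<subseteq> carrier G" "generate G S = carrier G"
  shows "noetherian_group G"
  using assms
proof (induction c arbitrary: G S rule: induct_nat_012)
  case 0
  then show ?case by (simp add: group.noetherian_on_trivial)
next
  case 1
  then interpret group G by simp
  have "carrier G \<subseteq> center G" using lower_central_central[of 0] 1 by simp
  then show ?case using noetherian_on_central[OF is_group 1(3)] 1 by auto
next
  case (ge2 n)
  interpret group G by fact
  obtain Q :: "'a monoid" and p where Q: "group_hom G Q p" "p ` carrier G = carrier Q"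
    "\<And>x. x \<in> carrier G \<Longrightarrow> p x = \<one>\<^bsub>Q\<^esub> \<longleftrightarrow> x \<in> lower_central G (Suc n)"
    and cQ: "lower_central Q (Suc n) = {\<one>\<^bsub>Q\<^esub>}"
    using last_lower_central_quotient[OF is_group ge2.prems(2)] by metis
  interpret p: group_hom G Q p by fact
  have "noetherian_group Q"
  proof (rule ge2.IH(2)[OF p.H.is_group cQ])
    show "generate Q (p ` S) = carrier Q" using p.generate_img ge2.prems Q(2) by simp
  qed (use ge2.prems in auto)
  then show ?case using noetherian_nilpotent_step[OF ge2.prems Q] by blast
qed

section \<open>Roots\<close>

text \<open>The isolator of \<open>L\<close>. It is a subgroup only in good cases, such as nilpotent
  groups, and is therefore kept as a set. The exponent 0 is excluded because it would put every
  element into the isolator of any subgroup.\<close>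

definition roots :: "('a, 'm) monoid_scheme \<Rightarrow> 'a set \<Rightarrow> 'a set" where
  "roots G L = {x \<in> carrier G. \<exists>k::nat. k \<ge> 1 \<and> x [^]\<^bsub>G\<^esub> k \<in> L}"

context group
begin

lemma rootsI: "x \<in> carrier G \<Longrightarrow> (k::nat) \<ge> 1 \<Longrightarrow> x [^] k \<in> L \<Longrightarrow> x \<in> roots G L"
  by (auto simp: roots_def)

lemma rootsE:
  assumes "x \<in> roots G L"
  obtains k :: nat where "k \<ge> 1" "x \<in> carrier G" "x [^] k \<in> L"
  using assms by (auto simp: roots_def)

lemma subset_roots: "L \<subseteq> carrier G \<Longrightarrow> L \<subseteq> roots G L"
  using rootsI[of _ 1] by auto

lemma subgroup_pow_closed: "subgroup L G \<Longrightarrow> x \<in> L \<Longrightarrow> x [^] (k::nat) \<in> L"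
  by (induction k) (auto simp: subgroup.m_closed subgroup.one_closed)

lemma roots_roots:
  assumes "subgroup L G"
  shows "roots G (roots G L) = roots G L"
proof
  show "roots G (roots G L) \<subseteq> roots G L"
  proof
    fix x assume "x \<in> roots G (roots G L)"
    then obtain k l :: nat where "k \<ge> 1" "l \<ge> 1" "x \<in> carrier G" "(x [^] k) [^] l \<in> L"
      by (metis rootsE)
    then show "x \<in> roots G L" by (intro rootsI[of _ "k * l"]) (auto simp: nat_pow_pow)
  qed
  show "roots G L \<subseteq> roots G (roots G L)" by (rule subset_roots) (auto simp: roots_def)
qed

lemma roots_mult_commuting:
  assumes "subgroup L G" "x \<in> roots G L" "y \<in> roots G L" "x \<otimes> y = y \<otimes> x"
  shows "x \<otimes> y \<in> roots G L"
proof -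
  obtain k l :: nat where k: "k \<ge> 1" "x \<in> carrier G" "x [^] k \<in> L" and l: "l \<ge> 1" "y \<in> carrier G" "y [^] l \<in> L"
    using assms by (metis rootsE)
  have "(x \<otimes> y) [^] (k * l) = x [^] (k * l) \<otimes> y [^] (k * l)"
    using assms(4) k(2) l(2) by (rule pow_mult_distrib)
  also have "\<dots> = (x [^] k) [^] l \<otimes> (y [^] l) [^] k"
    using k l by (simp add: nat_pow_pow mult.commute)
  also have "\<dots> \<in> L" using k l assms(1) by (simp add: subgroup_pow_closed subgroup.m_closed)
  finally show ?thesis using k l by (intro rootsI[of _ "k * l"]) auto
qed

lemma roots_inv:
  assumes "subgroup L G" "x \<in> roots G L"
  shows "inv x \<in> roots G L"
proof -
  obtain k :: nat where k: "k \<ge> 1" "x \<in> carrier G" "x [^] k \<in> L" using assms by (metis rootsE)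
  then show ?thesis using subgroup.m_inv_closed[OF assms(1) k(3)]
    by (intro rootsI[of _ k]) (auto simp: nat_pow_inv)
qed

lemma generate_roots_commuting:
  assumes "subgroup L G" "S \<subseteq> roots G L" "\<And>x y. x \<in> generate G S \<Longrightarrow> y \<in> generate G S \<Longrightarrow> x \<otimes> y = y \<otimes> x"
  shows "generate G S \<subseteq> roots G L"
proof
  fix x assume "x \<in> generate G S"
  then show "x \<in> roots G L"
  proof (induction rule: generate.induct)
    case one
    then show ?case using subgroup.one_closed[OF assms(1)] by (intro rootsI[of _ 1]) auto
  next
    case (eng h1 h2)
    then show ?case using roots_mult_commuting[OF assms(1)] assms(3) by blast
  qed (use assms(2) roots_inv[OF assms(1)] in auto)
qed

end

text \<open>If \<open>x\<close> and \<open>y\<close> have powers that lie in \<open>L\<close> up to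
  central factors, then a power of their commutator is a commutator of elements of \<open>L\<close>.
  So the last term of the series consists of roots of \<open>L\<close>. As it is central, a power of
  any element is a product of two commuting roots.\<close>

lemma nilpotent_generate_roots_step:
  fixes G :: "'a monoid" (structure) and Q :: "'a monoid"
  assumes "group G" "lower_central G (Suc (Suc n)) = {\<one>}" "subgroup L G"
    and Q: "group_hom G Q p" "p ` carrier G = carrier Q"
      "\<And>x. x \<in> carrier G \<Longrightarrow> p x = \<one>\<^bsub>Q\<^esub> \<longleftrightarrow> x \<in> lower_central G (Suc n)"
    and rootsQ: "roots Q (p ` L) = carrier Q"
  shows "roots G L = carrier G"
proof -
  interpret group G by fact
  interpret p: group_hom G Q p by fact
  let ?C = "lower_central G (Suc n)"
  have Cc: "?C \<subseteq> center G" using lower_central_central[of "Suc n"] assms by simp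
  interpret C: subgroup ?C G by (rule subgroup_lower_central)
  interpret L: subgroup L G by fact
  have Lc: "L \<subseteq> carrier G" using L.subset .
  have split: "\<exists>(k::nat) l z. k \<ge> 1 \<and> l \<in> L \<and> z \<in> ?C \<and> x [^] k = l \<otimes> z" if x: "x \<in> carrier G" for x
  proof -
    have "p x \<in> roots Q (p ` L)" using rootsQ x by simp
    then obtain k :: nat and l where k: "k \<ge> 1" "l \<in> L" "p x [^]\<^bsub>Q\<^esub> k = p l"
      by (blast elim: p.H.rootsE)
    have l: "l \<in> carrier G" using k Lc by blast
    have "p (x [^] k) = p l" using k x by (simp add: p.hom_nat_pow)
    then have "inv l \<otimes> x [^] k \<in> ?C" using Q(3)[of "inv l \<otimes> x [^] k"] x l by simp
    moreover have "x [^] k = l \<otimes> (inv l \<otimes> x [^] k)" using x l by simp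
    ultimately show ?thesis using k by blast
  qed
  have Croots: "?C \<subseteq> roots G L"
    unfolding lower_central_Suc
  proof (rule generate_roots_commuting[OF L.is_subgroup])
    show "{commutator G x y | x y. x \<in> lower_central G n \<and> y \<in> carrier G} \<subseteq> roots G L"
    proof clarify
      fix x y assume x: "x \<in> lower_central G n" and y: "y \<in> carrier G"
      have xc: "x \<in> carrier G" using x lower_central_subset[OF is_group] by blast
      have cen: "commutator G x y \<in> center G" using commutator_in_lower_central[OF x y] Cc by blast
      obtain k l z where k: "(k::nat) \<ge> 1" "l \<in> L" "z \<in> ?C" "x [^] k = l \<otimes> z" using split[OF xc] by blast
      obtain k' l' z' where k': "(k'::nat) \<ge> 1" "l' \<in> L" "z' \<in> ?C" "y [^] k' = l' \<otimes> z'" using split[OF y] by blast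
      have "commutator G x y [^] (k * k') = commutator G (l \<otimes> z) (l' \<otimes> z')"
        using commutator_pow[OF xc y cen, of k k'] k k' by simp
      also have "\<dots> = commutator G l l'"
        using k k' Cc Lc by (intro commutator_mult_center) auto
      also have "\<dots> \<in> L" using k k' by (simp add: commutator_def)
      finally show "commutator G x y \<in> roots G L" using k k' xc y by (intro rootsI[of _ "k * k'"]) auto
    qed
    show "x \<otimes> y = y \<otimes> x"
      if "x \<in> generate G {commutator G x y | x y. x \<in> lower_central G n \<and> y \<in> carrier G}"
        "y \<in> generate G {commutator G x y | x y. x \<in> lower_central G n \<and> y \<in> carrier G}" for x y
      using that[folded lower_central_Suc] Cc C.subset center_commute by blast
  qed
  have "x \<in> roots G L" if x: "x \<in> carrier G" for x
  proof -
    obtain k l z where k: "(k::nat) \<ge> 1" "l \<in> L" "z \<in> ?C" "x [^] k = l \<otimes> z" using split[OF x] by blast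
    have "l \<otimes> z \<in> roots G L"
    proof (rule roots_mult_commuting[OF L.is_subgroup])
      show "l \<in> roots G L" "z \<in> roots G L" using k subset_roots[OF Lc] Croots by auto
      show "l \<otimes> z = z \<otimes> l" using k Cc Lc by (metis center_commute subsetD)
    qed
    then have "x \<in> roots G (roots G L)" using rootsI[OF x k(1)] k(4) by simp
    then show ?thesis using roots_roots[OF L.is_subgroup] by simp
  qed
  then show ?thesis by (auto simp: roots_def)
qed

text \<open>Nilpotency is essential: for trivial \<open>L\<close> the roots are the torsion
  elements, and the infinite dihedral group is generated by such elements without being a torsion
  group.\<close>

lemma nilpotent_generate_roots:
  fixes G :: "'a monoid"
  assumes "group G" "lower_central G c = {\<one>\<^bsub>G\<^esub>}" "S \<subseteq> carrier G" "generate G S = carrier G"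
    "subgroup L G" "S \<subseteq> roots G L"
  shows "roots G L = carrier G"
  using assms
proof (induction c arbitrary: G S L rule: induct_nat_012)
  case 0
  then interpret group G by simp
  show ?case using 0 subgroup.one_closed[OF 0(5)] rootsI[OF one_closed, of 1 L] by (auto simp: roots_def)
next
  case 1
  then interpret group G by simp
  have "carrier G \<subseteq> center G" using lower_central_central[of 0] 1 by simp
  then show ?case using generate_roots_commuting[OF 1(5,6)] 1(4)
    by (auto simp: roots_def subset_iff center_commute)
next
  case (ge2 n)
  interpret group G by fact
  obtain Q :: "'a monoid" and p where Q: "group_hom G Q p" "p ` carrier G = carrier Q"
    "\<And>x. x \<in> carrier G \<Longrightarrow> p x = \<one>\<^bsub>Q\<^esub> \<longleftrightarrow> x \<in> lower_central G (Suc n)"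
    and cQ: "lower_central Q (Suc n) = {\<one>\<^bsub>Q\<^esub>}"
    using last_lower_central_quotient[OF is_group ge2.prems(2)] by metis
  interpret p: group_hom G Q p by fact
  have "roots Q (p ` L) = carrier Q"
  proof (rule ge2.IH(2)[OF p.H.is_group cQ])
    show "generate Q (p ` S) = carrier Q" using p.generate_img ge2.prems Q(2) by simp
    show "subgroup (p ` L) Q" using p.subgroup_img_is_subgroup ge2.prems by blast
    show "p ` S \<subseteq> roots Q (p ` L)"
    proof
      fix s assume "s \<in> p ` S"
      then obtain t where t: "t \<in> S" "s = p t" by blast
      then obtain k :: nat where k: "k \<ge> 1" "t \<in> carrier G" "t [^]\<^bsub>G\<^esub> k \<in> L"
        using ge2.prems by (blast elim: rootsE)
      have "p t [^]\<^bsub>Q\<^esub> k = p (t [^]\<^bsub>G\<^esub> k)" using k by (simp add: p.hom_nat_pow)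
      then show "s \<in> roots Q (p ` L)" using k t by (intro p.H.rootsI[of _ k]) auto
    qed
  qed (use ge2.prems in auto)
  then show ?case using nilpotent_generate_roots_step[OF ge2.prems(1,2,5) Q] by blast
qed

section \<open>Malcev completions\<close>

definition unique_roots :: "('a, 'm) monoid_scheme \<Rightarrow> bool" where
  "unique_roots G \<longleftrightarrow> (\<forall>x \<in> carrier G. \<forall>y \<in> carrier G. \<forall>k::nat.
     k \<ge> 1 \<longrightarrow> x [^]\<^bsub>G\<^esub> k = y [^]\<^bsub>G\<^esub> k \<longrightarrow> x = y)"

text \<open>A commuting product \<open>A <#> B\<close> with trivial intersection that contains a
  power of every element becomes a direct decomposition of the completion. Excluding such products
  is the trace that indecomposability of the completion leaves in the group itself.\<close>

definition virtually_indecomposable :: "('a, 'm) monoid_scheme \<Rightarrow> bool" where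
  "virtually_indecomposable G \<longleftrightarrow> (\<forall>A B. subgroup A G \<and> subgroup B G \<and>
     (\<forall>a \<in> A. \<forall>b \<in> B. a \<otimes>\<^bsub>G\<^esub> b = b \<otimes>\<^bsub>G\<^esub> a) \<and> A \<inter> B = {\<one>\<^bsub>G\<^esub>} \<and> roots G (A <#>\<^bsub>G\<^esub> B) = carrier G
     \<longrightarrow> A = {\<one>\<^bsub>G\<^esub>} \<or> B = {\<one>\<^bsub>G\<^esub>})"

context group
begin

lemma unique_rootsD:
  "unique_roots G \<Longrightarrow> (k::nat) \<ge> 1 \<Longrightarrow> x [^] k = y [^] k \<Longrightarrow> x \<in> carrier G \<Longrightarrow> y \<in> carrier G \<Longrightarrow> x = y"
  unfolding unique_roots_def by blast

lemma conj_pow: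
  assumes "x \<in> carrier G" "y \<in> carrier G"
  shows "(inv y \<otimes> x \<otimes> y) [^] (k::nat) = inv y \<otimes> x [^] k \<otimes> y"
  using assms by (induction k) (auto simp: m_assoc)

text \<open>Conjugating \<open>x\<close> by \<open>y\<close> gives a second \<open>k\<close>-th root
  of \<open>x [^] k\<close>.\<close>

lemma unique_roots_commute:
  assumes "unique_roots G" "(k::nat) \<ge> 1" "x \<in> carrier G" "y \<in> carrier G" "x [^] k \<otimes> y = y \<otimes> x [^] k"
  shows "x \<otimes> y = y \<otimes> x"
proof -
  have "(inv y \<otimes> x \<otimes> y) [^] k = x [^] k"
    unfolding conj_pow[OF assms(3,4)] using assms by (simp add: m_assoc)
  then have "inv y \<otimes> x \<otimes> y = x"
    using unique_rootsD[OF assms(1,2)] assms by blast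
  then have "y \<otimes> (inv y \<otimes> x \<otimes> y) = y \<otimes> x" by simp
  then show ?thesis using assms by (simp add: m_assoc)
qed

text \<open>Uniqueness of roots is applied once for each of the two elements.\<close>

lemma unique_roots_commute_roots:
  assumes "unique_roots G" "x \<in> roots G A" "y \<in> roots G B" "A \<subseteq> carrier G" "B \<subseteq> carrier G"
    "\<And>a b. a \<in> A \<Longrightarrow> b \<in> B \<Longrightarrow> a \<otimes> b = b \<otimes> a"
  shows "x \<otimes> y = y \<otimes> x"
proof -
  obtain k l :: nat where k: "k \<ge> 1" "x \<in> carrier G" "x [^] k \<in> A" and l: "l \<ge> 1" "y \<in> carrier G" "y [^] l \<in> B"
    using assms(2,3) by (metis rootsE)
  have "y [^] l \<otimes> x [^] k = x [^] k \<otimes> y [^] l" using assms(6)[OF k(3) l(3)] by simp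
  then have "y \<otimes> x [^] k = x [^] k \<otimes> y"
    using unique_roots_commute[OF assms(1) l(1,2)] k by simp
  then show ?thesis using unique_roots_commute[OF assms(1) k(1,2) l(2)] by simp
qed

section \<open>Isolators in nilpotent groups and in completions\<close>

lemma lower_central_subgroup:
  assumes "subgroup K G"
  shows "lower_central (G\<lparr>carrier := K\<rparr>) n \<subseteq> lower_central G n"
proof (induction n)
  case 0
  then show ?case using subgroup.subset[OF assms] by simp
next
  case (Suc n)
  let ?K = "G\<lparr>carrier := K\<rparr>"
  interpret K: group ?K by (rule subgroup_imp_group[OF assms])
  have lK: "lower_central ?K n \<subseteq> K" using lower_central_subset[OF K.is_group, of n] by simp
  have eq: "commutator ?K x y = commutator G x y" if "x \<in> K" "y \<in> K" for x y
    using that assms by (simp add: commutator_def)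
  let ?S = "{commutator ?K x y | x y. x \<in> lower_central ?K n \<and> y \<in> K}"
  have "?S \<subseteq> K" using K.commutator_closed lK by fastforce
  then have "generate ?K ?S = generate G ?S" using generate_consistent assms by blast
  moreover have "?S \<subseteq> {commutator G x y | x y. x \<in> lower_central G n \<and> y \<in> carrier G}"
  proof clarify
    fix x y assume "x \<in> lower_central ?K n" "y \<in> K"
    then show "\<exists>x' y'. commutator ?K x y = commutator G x' y' \<and> x' \<in> lower_central G n \<and> y' \<in> carrier G"
      using Suc.IH lK eq subgroup.subset[OF assms] by blast
  qed
  ultimately show ?case unfolding lower_central_Suc using mono_generate by simp
qed

end

text \<open>The subgroup \<open>K\<close> generated by all roots is nilpotent and generated by roots
  of \<open>L\<close>, so it consists of roots; hence the set of roots is \<open>K\<close>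
  itself.\<close>

lemma subgroup_roots:
  fixes G :: "'a monoid"
  assumes "nilpotent_group G" "subgroup L G"
  shows "subgroup (roots G L) G"
proof -
  interpret group G using assms by (simp add: nilpotent_group_def)
  obtain c where c: "lower_central G c = {\<one>\<^bsub>G\<^esub>}" using assms by (auto simp: nilpotent_group_def)
  define K where "K = generate G (roots G L)"
  have rc: "roots G L \<subseteq> carrier G" by (auto simp: roots_def)
  have K: "subgroup K G" unfolding K_def by (rule generate_is_subgroup[OF rc])
  have rK: "roots G L \<subseteq> K" unfolding K_def by (auto intro: generate.incl)
  let ?K = "G\<lparr>carrier := K\<rparr>"
  interpret K: group ?K by (rule subgroup_imp_group[OF K])
  have LK: "L \<subseteq> K" using subset_roots[OF subgroup.subset[OF assms(2)]] rK by blast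
  have eq: "roots ?K L = roots G L"
    using rK subgroup.subset[OF K] by (auto simp: roots_def simp flip: nat_pow_consistent)
  have "roots ?K L = carrier ?K"
  proof (rule nilpotent_generate_roots[OF K.is_group])
    show "lower_central ?K c = {\<one>\<^bsub>?K\<^esub>}"
      using lower_central_subgroup[OF K, of c] c subgroup.one_closed[OF K.subgroup_lower_central, of c] by auto
    show "generate ?K (roots G L) = carrier ?K"
      using generate_consistent[OF rK K] by (simp add: K_def)
    show "subgroup L ?K" using subgroup_incl[OF assms(2) K LK] .
  qed (use rK eq in auto)
  then have "roots G L = K" using eq by simp
  with K show ?thesis by simp
qed

text \<open>The axioms give uniqueness only for roots of elements of \<open>N\<close>. Two equal
  powers in \<open>M\<close> are raised further until they land in the image of
  \<open>N\<close>.\<close>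

lemma rational_malcev_completion_unique_roots:
  assumes "rational_malcev_completion N M \<iota>" "group N"
  shows "unique_roots M" "unique_roots N"
proof -
  interpret M: group M using assms by (simp add: rational_malcev_completion_def nilpotent_group_def)
  interpret N: group N by fact
  have uniq: "\<exists>!x. x \<in> carrier M \<and> x [^]\<^bsub>M\<^esub> m = \<iota> n" if "n \<in> carrier N" "m \<ge> 1" for n and m :: nat
    using assms that by (simp add: rational_malcev_completion_def)
  have ex: "\<exists>m::nat. m \<ge> 1 \<and> x [^]\<^bsub>M\<^esub> m \<in> \<iota> ` carrier N" if "x \<in> carrier M" for x
    using assms that by (simp add: rational_malcev_completion_def)
  show u: "unique_roots M"
    unfolding unique_roots_def
  proof (intro ballI allI impI)
    fix x y and k :: nat
    assume x: "x \<in> carrier M" and y: "y \<in> carrier M" and k: "k \<ge> 1" "x [^]\<^bsub>M\<^esub> k = y [^]\<^bsub>M\<^esub> k"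
    obtain m :: nat and n where m: "m \<ge> 1" "n \<in> carrier N" "(x [^]\<^bsub>M\<^esub> k) [^]\<^bsub>M\<^esub> m = \<iota> n"
      using ex[of "x [^]\<^bsub>M\<^esub> k"] x by auto
    have "x [^]\<^bsub>M\<^esub> (k * m) = \<iota> n" "y [^]\<^bsub>M\<^esub> (k * m) = \<iota> n"
      using m k x y by (simp_all flip: M.nat_pow_pow)
    moreover have "k * m \<ge> 1" using k m by simp
    ultimately show "x = y" using uniq[OF m(2), of "k * m"] x y by blast
  qed
  have mon: "\<iota> \<in> hom N M" "inj_on \<iota> (carrier N)"
    using assms by (auto simp: rational_malcev_completion_def mon_def)
  interpret \<iota>: group_hom N M \<iota> using mon by unfold_locales
  show "unique_roots N"
    unfolding unique_roots_def
  proof (intro ballI allI impI)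
    fix x y and k :: nat
    assume x: "x \<in> carrier N" and y: "y \<in> carrier N" and k: "k \<ge> 1" "x [^]\<^bsub>N\<^esub> k = y [^]\<^bsub>N\<^esub> k"
    then have "\<iota> x [^]\<^bsub>M\<^esub> k = \<iota> y [^]\<^bsub>M\<^esub> k" by (metis \<iota>.hom_nat_pow)
    then have "\<iota> x = \<iota> y" using M.unique_rootsD[OF u k(1)] x y by simp
    then show "x = y" using mon x y by (auto dest: inj_onD)
  qed
qed

text \<open>The isolators in \<open>M\<close> of the images of \<open>A\<close> and \<open>B\<close>
  commute elementwise, meet trivially and have product \<open>M\<close>. Indecomposability makes one
  of them trivial, and with it \<open>A\<close> or \<open>B\<close>.\<close>

lemma rational_malcev_completion_virtually_indecomposable:
  fixes N :: "('a, 'm) monoid_scheme" and M :: "'b monoid"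
  assumes mal: "rational_malcev_completion N M \<iota>" and N: "group N" and ind: "directly_indecomposable M"
  shows "virtually_indecomposable N"
  unfolding virtually_indecomposable_def
proof (intro allI impI, elim conjE)
  fix A B
  assume A: "subgroup A N" and B: "subgroup B N" and comm: "\<forall>a\<in>A. \<forall>b\<in>B. a \<otimes>\<^bsub>N\<^esub> b = b \<otimes>\<^bsub>N\<^esub> a"
    and int: "A \<inter> B = {\<one>\<^bsub>N\<^esub>}" and gen: "roots N (A <#>\<^bsub>N\<^esub> B) = carrier N"
  have nil: "nilpotent_group M" and tf: "torsion_free_group M"
    using mal by (auto simp: rational_malcev_completion_def)
  interpret M: group M using nil by (simp add: nilpotent_group_def)
  interpret N: group N by fact
  have mon: "\<iota> \<in> hom N M" "inj_on \<iota> (carrier N)"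
    using mal by (auto simp: rational_malcev_completion_def mon_def)
  interpret \<iota>: group_hom N M \<iota> using mon by unfold_locales
  have ur: "unique_roots M" using rational_malcev_completion_unique_roots[OF mal N] by simp
  have Ac: "A \<subseteq> carrier N" "B \<subseteq> carrier N" using A B subgroup.subset by blast+
  define A' B' where "A' = roots M (\<iota> ` A)" and "B' = roots M (\<iota> ` B)"
  have img: "subgroup (\<iota> ` A) M" "subgroup (\<iota> ` B) M"
    using \<iota>.subgroup_img_is_subgroup A B by auto
  have A': "subgroup A' M" and B': "subgroup B' M"
    unfolding A'_def B'_def using subgroup_roots[OF nil] img by auto
  interpret AB: group_disjoint_sum M A' B'
    using A' B' M.is_group by (simp add: group_disjoint_sum_def)
  have comm': "x \<otimes>\<^bsub>M\<^esub> y = y \<otimes>\<^bsub>M\<^esub> x" if "x \<in> A'" "y \<in> B'" for x y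
  proof (rule M.unique_roots_commute_roots[OF ur that[unfolded A'_def B'_def]])
    fix a b assume "a \<in> \<iota> ` A" "b \<in> \<iota> ` B"
    then show "a \<otimes>\<^bsub>M\<^esub> b = b \<otimes>\<^bsub>M\<^esub> a"
      using comm Ac by clarify (metis \<iota>.hom_mult subsetD)
  qed (use img subgroup.subset in \<open>blast+\<close>)
  have "A' \<inter> B' = {\<one>\<^bsub>M\<^esub>}"
  proof -
    have "x = \<one>\<^bsub>M\<^esub>" if x: "x \<in> A'" "x \<in> B'" for x
    proof -
      obtain k :: nat where k: "k \<ge> 1" "x \<in> carrier M" "x [^]\<^bsub>M\<^esub> k \<in> \<iota> ` A"
        using x unfolding A'_def by (metis M.rootsE)
      obtain l :: nat where l: "l \<ge> 1" "x [^]\<^bsub>M\<^esub> l \<in> \<iota> ` B"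
        using x unfolding B'_def by (metis M.rootsE)
      have "x [^]\<^bsub>M\<^esub> (k * l) \<in> \<iota> ` A"
        using M.subgroup_pow_closed[OF img(1) k(3), of l] k by (simp add: M.nat_pow_pow)
      moreover have "x [^]\<^bsub>M\<^esub> (k * l) \<in> \<iota> ` B"
        using M.subgroup_pow_closed[OF img(2) l(2), of k] k by (simp add: M.nat_pow_pow mult.commute)
      ultimately obtain a b where "a \<in> A" "b \<in> B" "x [^]\<^bsub>M\<^esub> (k * l) = \<iota> a" "\<iota> a = \<iota> b" by auto
      moreover from this have "a = b" using mon Ac by (auto dest: inj_onD)
      ultimately have "a = \<one>\<^bsub>N\<^esub>" "x [^]\<^bsub>M\<^esub> (k * l) = \<iota> a" using int by blast+
      then have "x [^]\<^bsub>M\<^esub> (k * l) = \<one>\<^bsub>M\<^esub>" by simp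
      moreover have "k * l \<ge> 1" using k l by simp
      ultimately show ?thesis using tf k unfolding torsion_free_group_def by blast
    qed
    then show ?thesis using subgroup.one_closed[OF A'] subgroup.one_closed[OF B'] by blast
  qed
  moreover have "A' <#>\<^bsub>M\<^esub> B' = carrier M"
  proof
    show "A' <#>\<^bsub>M\<^esub> B' \<subseteq> carrier M"
      using M.setmult_subset_G subgroup.subset[OF A'] subgroup.subset[OF B'] .
    show "carrier M \<subseteq> A' <#>\<^bsub>M\<^esub> B'"
    proof
      fix x assume x: "x \<in> carrier M"
      then obtain m :: nat and n where m: "m \<ge> 1" "n \<in> carrier N" "x [^]\<^bsub>M\<^esub> m = \<iota> n"
        using mal unfolding rational_malcev_completion_def by (metis imageE)
      obtain k :: nat where k: "k \<ge> 1" "n [^]\<^bsub>N\<^esub> k \<in> A <#>\<^bsub>N\<^esub> B"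
        using gen m(2) by (metis N.rootsE)
      then obtain a b where ab: "a \<in> A" "b \<in> B" "n [^]\<^bsub>N\<^esub> k = a \<otimes>\<^bsub>N\<^esub> b"
        by (auto simp: set_mult_def)
      \<comment> \<open>One common exponent for all roots: the \<open>m * k\<close>-th roots of
        \<open>a\<close> and \<open>b\<close> commute and multiply to an element with the same
        \<open>m * k\<close>-th power as \<open>x\<close>.\<close>
      have mk: "m * k \<ge> 1" using m k by simp
      have root: "\<exists>y \<in> carrier M. y [^]\<^bsub>M\<^esub> (m * k) = \<iota> c" if "c \<in> carrier N" for c
        using mal that mk unfolding rational_malcev_completion_def by blast
      obtain \<alpha> where \<alpha>: "\<alpha> \<in> carrier M" "\<alpha> [^]\<^bsub>M\<^esub> (m * k) = \<iota> a" using root ab Ac by blast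
      obtain \<beta> where \<beta>: "\<beta> \<in> carrier M" "\<beta> [^]\<^bsub>M\<^esub> (m * k) = \<iota> b" using root ab Ac by blast
      have mem: "\<alpha> \<in> A'" "\<beta> \<in> B'"
        unfolding A'_def B'_def using \<alpha> \<beta> ab mk by (auto intro!: M.rootsI[of _ "m * k"])
      have "(\<alpha> \<otimes>\<^bsub>M\<^esub> \<beta>) [^]\<^bsub>M\<^esub> (m * k) = \<iota> a \<otimes>\<^bsub>M\<^esub> \<iota> b"
        using M.pow_mult_distrib[OF comm'[OF mem] \<alpha>(1) \<beta>(1), of "m * k"] \<alpha> \<beta> by simp
      also have "\<dots> = \<iota> (n [^]\<^bsub>N\<^esub> k)" using ab Ac by (simp add: subset_iff)
      also have "\<dots> = x [^]\<^bsub>M\<^esub> (m * k)"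
        using m x by (simp add: \<iota>.hom_nat_pow flip: M.nat_pow_pow)
      finally have "\<alpha> \<otimes>\<^bsub>M\<^esub> \<beta> = x" using M.unique_rootsD[OF ur mk] \<alpha> \<beta> x by simp
      then show "x \<in> A' <#>\<^bsub>M\<^esub> B'" using mem by (auto simp: set_mult_def)
    qed
  qed
  ultimately have "(\<lambda>(x,y). x \<otimes>\<^bsub>M\<^esub> y) \<in> iso (subgroup_generated M A' \<times>\<times> subgroup_generated M B') M"
    using AB.iso_group_mul_alt comm' by blast
  then have "M \<cong> subgroup_generated M A' \<times>\<times> subgroup_generated M B'"
    using group.iso_sym[OF DirProd_group] is_isoI M.group_subgroup_generated by blast
  then have "trivial_group (subgroup_generated M A') \<or> trivial_group (subgroup_generated M B')"
    using ind M.group_subgroup_generated unfolding directly_indecomposable_def by blast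
  then have "A' \<subseteq> {\<one>\<^bsub>M\<^esub>} \<or> B' \<subseteq> {\<one>\<^bsub>M\<^esub>}"
    using subgroup.subset[OF A'] subgroup.subset[OF B']
    by (auto simp: M.trivial_group_subgroup_generated_eq Int_absorb1)
  moreover have "\<iota> ` A \<subseteq> A'" "\<iota> ` B \<subseteq> B'"
    unfolding A'_def B'_def using M.subset_roots[OF subgroup.subset] img by auto
  ultimately have "\<iota> ` A \<subseteq> {\<one>\<^bsub>M\<^esub>} \<or> \<iota> ` B \<subseteq> {\<one>\<^bsub>M\<^esub>}" by (meson order_trans)
  moreover have "C \<subseteq> {\<one>\<^bsub>N\<^esub>}" if "C \<subseteq> carrier N" "\<iota> ` C \<subseteq> {\<one>\<^bsub>M\<^esub>}" for C
  proof
    fix c assume "c \<in> C"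
    then have "c \<in> carrier N" "\<iota> c = \<iota> \<one>\<^bsub>N\<^esub>" using that by auto
    then show "c \<in> {\<one>\<^bsub>N\<^esub>}" using inj_onD[OF mon(2)] by simp
  qed
  ultimately have "A \<subseteq> {\<one>\<^bsub>N\<^esub>} \<or> B \<subseteq> {\<one>\<^bsub>N\<^esub>}" using Ac by metis
  then show "A = {\<one>\<^bsub>N\<^esub>} \<or> B = {\<one>\<^bsub>N\<^esub>}"
    using subgroup.one_closed[OF A] subgroup.one_closed[OF B] by blast
qed

section \<open>Central elements and the derived group\<close>

lemma (in group) derived_le_imp_normal:
  assumes "subgroup B G" "lower_central G (Suc 0) \<subseteq> B"
  shows "B \<lhd> G"
  unfolding normal_inv_iff
proof (intro conjI ballI assms(1))
  fix x h assume x: "x \<in> carrier G" and h: "h \<in> B"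
  have hc: "h \<in> carrier G" using h subgroup.subset[OF assms(1)] by blast
  have "commutator G x h \<in> B" using commutator_in_lower_central[of x 0 h] x hc assms(2) by auto
  then have "commutator G x h \<otimes> h \<in> B" using h subgroup.m_closed[OF assms(1)] by blast
  then show "x \<otimes> h \<otimes> inv x \<in> B" using x hc by (simp add: commutator_def m_assoc)
qed

text \<open>Otherwise a subgroup containing the derived group which is maximal with respect to meeting
  \<open>\<langle>z\<rangle>\<close> trivially would be a virtual complement of \<open>\<langle>z\<rangle>\<close>.\<close>

lemma (in group) center_subset_roots_derived:
  assumes vi: "virtually_indecomposable G" and nc: "\<not> comm_group G"
  shows "center G \<subseteq> roots G (lower_central G (Suc 0))"
proof (rule ccontr)
  assume "\<not> ?thesis"
  then obtain z where z: "z \<in> center G" "z \<notin> roots G (lower_central G (Suc 0))" by blast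
  have zc: "z \<in> carrier G" using z center_closed by blast
  let ?D = "lower_central G (Suc 0)"
  \<comment> \<open>Containing the derived group makes every member normal, so that its product with
    a cyclic subgroup is again a subgroup.\<close>
  define \<F> where "\<F> = {B. subgroup B G \<and> ?D \<subseteq> B \<and> (\<forall>k::nat. k \<ge> 1 \<longrightarrow> z [^] k \<notin> B)}"
  have "?D \<in> \<F>" using subgroup_lower_central[of "Suc 0"] z zc by (auto simp: \<F>_def roots_def)
  have chain: "\<Union>\<C> \<in> \<F>" if ne: "\<C> \<noteq> {}" and ch: "subset.chain \<F> \<C>" for \<C>
  proof -
    have sub: "subgroup B G" "?D \<subseteq> B" if "B \<in> \<C>" for B
      using that ch by (auto simp: subset_chain_def \<F>_def)
    have tot: "B \<subseteq> B' \<or> B' \<subseteq> B" if "B \<in> \<C>" "B' \<in> \<C>" for B B'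
      using that ch by (auto simp: subset_chain_def)
    have "subgroup (\<Union>\<C>) G"
    proof (rule subgroupI)
      show "\<Union>\<C> \<subseteq> carrier G" using subgroup.subset[OF sub(1)] by blast
      show "\<Union>\<C> \<noteq> {}" using ne subgroup.one_closed[OF sub(1)] by blast
      show "inv a \<in> \<Union>\<C>" if "a \<in> \<Union>\<C>" for a using that subgroup.m_inv_closed[OF sub(1)] by blast
      show "a \<otimes> b \<in> \<Union>\<C>" if ab: "a \<in> \<Union>\<C>" "b \<in> \<Union>\<C>" for a b
      proof -
        obtain B B' where B: "a \<in> B" "B \<in> \<C>" "b \<in> B'" "B' \<in> \<C>" using ab by blast
        have "a \<otimes> b \<in> B \<union> B'"
          using tot[OF B(2,4)] B subgroup.m_closed[OF sub(1)[OF B(2)]] subgroup.m_closed[OF sub(1)[OF B(4)]]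
          by blast
        then show ?thesis using B by blast
      qed
    qed
    moreover have "?D \<subseteq> \<Union>\<C>" using ne sub(2) by blast
    moreover have "\<forall>k::nat. k \<ge> 1 \<longrightarrow> z [^] k \<notin> \<Union>\<C>"
      using ch by (auto simp: subset_chain_def \<F>_def)
    ultimately show ?thesis by (simp add: \<F>_def)
  qed
  obtain B where B: "B \<in> \<F>" and max: "\<And>B'. B' \<in> \<F> \<Longrightarrow> B \<subseteq> B' \<Longrightarrow> B' = B"
    using subset_Zorn_nonempty[of \<F>, OF _ chain] \<open>?D \<in> \<F>\<close> by blast
  have Bs: "subgroup B G" and DB: "?D \<subseteq> B" and zB: "\<And>k::nat. k \<ge> 1 \<Longrightarrow> z [^] k \<notin> B"
    using B by (auto simp: \<F>_def)
  have Bc: "B \<subseteq> carrier G" using subgroup.subset[OF Bs] .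
  let ?A = "generate G {z}"
  have As: "subgroup ?A G" using zc by (simp add: generate_is_subgroup)
  have Acen: "?A \<subseteq> center G" using generate_subgroup_incl[OF _ subgroup_center] z by simp
  have zz: "z [^] (k::int) \<in> ?A" for k using generate_pow[OF zc] by auto
  have comm: "a \<otimes> b = b \<otimes> a" if "a \<in> ?A" "b \<in> B" for a b
    using that Acen Bc by (auto intro: center_commute)
  have zint: "k = 0" if "z [^] (k::int) \<in> B" for k
  proof (rule ccontr)
    assume "k \<noteq> 0"
    have "z [^] \<bar>k\<bar> \<in> B"
      using that subgroup.m_inv_closed[OF Bs that] zc by (auto simp: abs_if int_pow_neg)
    then have "z [^] (nat \<bar>k\<bar>) \<in> B" by (simp flip: int_pow_int)
    moreover have "nat \<bar>k\<bar> \<ge> 1" using \<open>k \<noteq> 0\<close> by linarith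
    ultimately show False using zB by blast
  qed
  have int: "?A \<inter> B = {\<one>}"
  proof -
    have "a = \<one>" if "a \<in> ?A" "a \<in> B" for a
    proof -
      obtain k :: int where "a = z [^] k" using \<open>a \<in> ?A\<close> generate_pow[OF zc] by auto
      then show ?thesis using zint[of k] \<open>a \<in> B\<close> by simp
    qed
    then show ?thesis using subgroup.one_closed[OF As] subgroup.one_closed[OF Bs] by blast
  qed
  \<comment> \<open>If no power of \<open>y\<close> lies in \<open>?A <#> B\<close>, adjoining
    \<open>y\<close> to \<open>B\<close> stays inside \<open>\<F>\<close>: in an equation
    \<open>z [^] l = b \<otimes> y [^] k\<close> the case \<open>k = 0\<close> puts a power of
    \<open>z\<close> into \<open>B\<close>, and \<open>k \<noteq> 0\<close> puts a power of
    \<open>y\<close> into \<open>?A <#> B\<close>. Maximality then gives \<open>y \<in> B\<close>,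
    which is absurd as well.\<close>
  have inAB: "y \<in> roots G (?A <#> B)" if y: "y \<in> carrier G" for y
  proof (rule ccontr)
    assume nr: "y \<notin> roots G (?A <#> B)"
    let ?B' = "B <#> generate G {y}"
    have Ys: "subgroup (generate G {y}) G" using y by (simp add: generate_is_subgroup)
    have B's: "subgroup ?B' G"
      by (rule mult_norm_subgroup[OF derived_le_imp_normal[OF Bs DB] Ys])
    have incl: "B \<subseteq> ?B'" "y \<in> ?B'"
    proof -
      have "b \<otimes> \<one> \<in> ?B'" if "b \<in> B" for b
        using that subgroup.one_closed[OF Ys] unfolding set_mult_def by blast
      then show "B \<subseteq> ?B'" using Bc by (auto simp: subset_iff)
      have "\<one> \<otimes> y \<in> ?B'"
        using generate.incl[of y "{y}" G] subgroup.one_closed[OF Bs] unfolding set_mult_def by blast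
      then show "y \<in> ?B'" using y by simp
    qed
    have "z [^] l \<notin> ?B'" if l: "l \<ge> 1" for l :: nat
    proof
      assume "z [^] l \<in> ?B'"
      then obtain b k where b: "b \<in> B" and k: "z [^] l = b \<otimes> y [^] (k::int)"
        using generate_pow[OF y] by (auto simp: set_mult_def)
      have bc: "b \<in> carrier G" using b Bc by blast
      have yk: "y [^] k = z [^] l \<otimes> inv b"
      proof -
        have "y [^] k = inv b \<otimes> z [^] l" using k bc y by simp
        also have "\<dots> = z [^] l \<otimes> inv b" using center_commute[OF center_pow[OF z(1)], of "inv b" l] bc by simp
        finally show ?thesis .
      qed
      have ynk: "y [^] (- k) = z [^] (- int l) \<otimes> b"
      proof -
        have "y [^] (- k) = b \<otimes> inv (z [^] l)"
          using yk bc y zc by (simp add: int_pow_neg inv_mult_group)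
        also have "\<dots> = z [^] (- int l) \<otimes> b"
          using comm[OF zz b, of "- int l"] zc by (simp add: int_pow_neg int_pow_int)
        finally show ?thesis .
      qed
      have "k \<noteq> 0" using k zB[OF l] b bc by auto
      have "y [^] \<bar>k\<bar> \<in> ?A <#> B"
      proof (cases "k > 0")
        case True
        then show ?thesis using yk zz[of "int l"] subgroup.m_inv_closed[OF Bs b]
          unfolding set_mult_def by (auto simp: int_pow_int)
      next
        case False
        then show ?thesis using ynk zz[of "- int l"] b
          unfolding set_mult_def by auto
      qed
      then have "y [^] (nat \<bar>k\<bar>) \<in> ?A <#> B" by (simp flip: int_pow_int)
      moreover have "nat \<bar>k\<bar> \<ge> 1" using \<open>k \<noteq> 0\<close> by linarith
      ultimately show False using nr rootsI[OF y] by blast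
    qed
    then have "?B' \<in> \<F>" using B's DB incl by (auto simp: \<F>_def)
    then have "y \<in> B" using max incl by blast
    then have "\<one> \<otimes> y \<in> ?A <#> B" using subgroup.one_closed[OF As] unfolding set_mult_def by blast
    then show False using nr rootsI[OF y, of 1] y by simp
  qed
  have "roots G (?A <#> B) = carrier G" using inAB by (auto simp: roots_def)
  then have "?A = {\<one>} \<or> B = {\<one>}"
    using vi As Bs comm int unfolding virtually_indecomposable_def by blast
  then show False
  proof
    assume "?A = {\<one>}"
    then have "z = \<one>" using generate.incl[of z "{z}" G] by simp
    then show False using z(2) rootsI[OF zc, of 1] subgroup.one_closed[OF subgroup_lower_central] by simp
  next
    \<comment> \<open>\<open>B\<close> contains the derived group, so its triviality would make the
      group abelian.\<close>
    assume "B = {\<one>}"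
    then have "commutator G x y = \<one>" if "x \<in> carrier G" "y \<in> carrier G" for x y
      using commutator_in_lower_central[of x 0 y] DB that by auto
    then have "comm_group G" by (intro group_comm_groupI) (simp add: commutator_one_iff)
    then show False using nc by blast
  qed
qed

section \<open>Normal endomorphisms\<close>

text \<open>Endomorphisms in the sense of groups with operators, the operators being the inner
  automorphisms. For these the kernel and the image commute elementwise, which is what Fitting's
  argument needs for a direct product.\<close>

definition normal_endo :: "('a, 'm) monoid_scheme \<Rightarrow> ('a \<Rightarrow> 'a) \<Rightarrow> bool" where
  "normal_endo G e \<longleftrightarrow> e \<in> hom G G \<and>
     (\<forall>g \<in> carrier G. \<forall>x \<in> carrier G. e (g \<otimes>\<^bsub>G\<^esub> x \<otimes>\<^bsub>G\<^esub> inv\<^bsub>G\<^esub> g) = g \<otimes>\<^bsub>G\<^esub> e x \<otimes>\<^bsub>G\<^esub> inv\<^bsub>G\<^esub> g)"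

context group
begin

lemma normal_endo_hom: "normal_endo G e \<Longrightarrow> group_hom G G e"
  by (simp add: normal_endo_def group_hom_def group_hom_axioms_def)

lemma normal_endoD:
  "normal_endo G e \<Longrightarrow> g \<in> carrier G \<Longrightarrow> x \<in> carrier G \<Longrightarrow> e (g \<otimes> x \<otimes> inv g) = g \<otimes> e x \<otimes> inv g"
  unfolding normal_endo_def by blast

lemma normal_endo_comp:
  assumes "normal_endo G e" "normal_endo G f"
  shows "normal_endo G (e \<circ> f)"
proof -
  interpret e: group_hom G G e by (rule normal_endo_hom[OF assms(1)])
  interpret f: group_hom G G f by (rule normal_endo_hom[OF assms(2)])
  show ?thesis unfolding normal_endo_def
    using normal_endoD[OF assms(1)] normal_endoD[OF assms(2)] by (auto intro!: homI)
qed

lemma normal_endo_funpow: "normal_endo G e \<Longrightarrow> normal_endo G (e ^^ n)"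
proof (induction n)
  case 0
  then show ?case by (auto simp: normal_endo_def intro!: homI)
next
  case (Suc n)
  then show ?case using normal_endo_comp[of e "e ^^ n"] by (simp add: comp_def)
qed

lemma normal_endo_commute:
  assumes "normal_endo G e" "x \<in> carrier G"
  shows "e x \<otimes> x = x \<otimes> e x"
proof -
  interpret e: group_hom G G e by (rule normal_endo_hom[OF assms(1)])
  have "e x = x \<otimes> e x \<otimes> inv x" using normal_endoD[OF assms(1), of x x] assms(2) by (simp add: m_assoc)
  then have "e x \<otimes> x = x \<otimes> e x \<otimes> inv x \<otimes> x" by simp
  then show ?thesis using assms(2) by (simp add: m_assoc)
qed

text \<open>Normality and multiplicativity evaluate \<open>e\<close> in two ways at the conjugate of
  \<open>x\<close> by \<open>k\<close>.\<close>

lemma normal_endo_kernel_image_commute: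
  assumes "normal_endo G e" "k \<in> carrier G" "x \<in> carrier G" "e k = \<one>"
  shows "k \<otimes> e x = e x \<otimes> k"
proof -
  interpret e: group_hom G G e by (rule normal_endo_hom[OF assms(1)])
  have "k \<otimes> e x \<otimes> inv k = e x" using normal_endoD[OF assms(1,2,3)] assms by simp
  then have "k \<otimes> e x \<otimes> inv k \<otimes> k = e x \<otimes> k" by simp
  then show ?thesis using assms by (simp add: m_assoc)
qed

text \<open>The orbit \<open>a, f a, f\<^sup>2 a, \<dots>\<close> of an element under a normal endomorphism generates an abelian
  group. If no power of \<open>a\<close> lies in \<open>f ` I\<close>, injectivity makes the orbit independent, contradicting
  the chain condition.\<close>

lemma normal_endo_inj_roots:
  assumes noeth: "noetherian_group G" and f: "normal_endo G f" and I: "subgroup I G" "f ` I \<subseteq> I" "inj_on f I"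
  shows "I \<subseteq> roots G (f ` I)"
proof
  fix a assume a: "a \<in> I"
  interpret f: group_hom G G f by (rule normal_endo_hom[OF f])
  interpret I: subgroup I G by (rule I(1))
  show "a \<in> roots G (f ` I)"
  proof (rule ccontr)
    assume na: "a \<notin> roots G (f ` I)"
    have ac: "a \<in> carrier G" using a by simp
    have fI: "subgroup (f ` I) G" by (rule f.subgroup_img_is_subgroup[OF I(1)])
    have c0: "c = 0" if "a [^] (c::int) \<in> f ` I" for c
    proof (rule ccontr)
      assume "c \<noteq> 0"
      have "a [^] \<bar>c\<bar> \<in> f ` I"
        using that subgroup.m_inv_closed[OF fI that] ac by (auto simp: abs_if int_pow_neg)
      then have "a [^] (nat \<bar>c\<bar>) \<in> f ` I" by (simp flip: int_pow_int)
      moreover have "nat \<bar>c\<bar> \<ge> 1" using \<open>c \<noteq> 0\<close> by linarith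
      ultimately show False using na rootsI[OF ac] by blast
    qed
    have fa: "(f ^^ i) a \<in> I" for i using a I(2) by (induction i) auto
    have orbit_comm: "(f ^^ i) a \<otimes> a = a \<otimes> (f ^^ i) a" for i
      using normal_endo_commute[OF normal_endo_funpow[OF f] ac] .
    define A where "A n = generate G ((\<lambda>i. (f ^^ i) a) ` {..<n})" for n
    have gI: "(\<lambda>i. (f ^^ i) a) ` {..<n} \<subseteq> I" for n using fa by auto
    have AI: "A n \<subseteq> I" for n unfolding A_def by (rule generate_subgroup_incl[OF gI I(1)])
    have As: "subgroup (A n) G" for n
      unfolding A_def using gI I.subset by (blast intro: generate_is_subgroup)
    have cen: "subgroup {x \<in> carrier G. \<forall>u\<in>{a}. x \<otimes> u = u \<otimes> x} G"
      by (rule subgroup_centralizer) (use ac in simp)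
    have fAcomm: "f u \<otimes> a = a \<otimes> f u" if "u \<in> A n" for u n
    proof -
      have sub: "(\<lambda>i. (f ^^ i) a) ` {..<n} \<subseteq> carrier G" using gI I.subset by blast
      have "f ` A n = generate G (f ` (\<lambda>i. (f ^^ i) a) ` {..<n})"
        unfolding A_def using f.generate_img[OF sub] by simp
      also have "\<dots> \<subseteq> {x \<in> carrier G. \<forall>u\<in>{a}. x \<otimes> u = u \<otimes> x}"
      proof (rule generate_subgroup_incl[OF _ cen], clarify)
        fix i
        show "f ((f ^^ i) a) \<in> carrier G \<and> (\<forall>u\<in>{a}. f ((f ^^ i) a) \<otimes> u = u \<otimes> f ((f ^^ i) a))"
          using orbit_comm[of "Suc i"] fa[of "Suc i"] by simp
      qed
      finally show ?thesis using that by blast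
    qed
    \<comment> \<open>Splits off the power of \<open>a\<close> itself. Everything else generated by
      the first \<open>Suc n\<close> iterates is the image under \<open>f\<close> of something
      generated by the first \<open>n\<close>.\<close>
    have step: "\<exists>c u. u \<in> A n \<and> x = a [^] (c::int) \<otimes> f u" if x: "x \<in> A (Suc n)" for x n
    proof -
      let ?U = "{a [^] (c::int) \<otimes> f u | c u. u \<in> A n}"
      interpret An: subgroup "A n" G by (rule As)
      have Uc: "a [^] (c::int) \<otimes> f u \<in> carrier G" if "u \<in> A n" for c u using that ac by simp
      have pc: "f u \<otimes> a [^] (c::int) = a [^] c \<otimes> f u" if u: "u \<in> A n" for u c
      proof -
        have "subgroup {x \<in> carrier G. \<forall>v\<in>{f u}. x \<otimes> v = v \<otimes> x} G"
          by (rule subgroup_centralizer) (use u in simp)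
        moreover have "a \<in> {x \<in> carrier G. \<forall>v\<in>{f u}. x \<otimes> v = v \<otimes> x}"
          using ac fAcomm[OF u] by simp
        ultimately have "a [^] c \<in> {x \<in> carrier G. \<forall>v\<in>{f u}. x \<otimes> v = v \<otimes> x}"
          by (rule subgroup_int_pow_closed)
        then show ?thesis by simp
      qed
      have Us: "subgroup ?U G"
      proof (rule subgroupI)
        show "?U \<subseteq> carrier G" using Uc by blast
        show "?U \<noteq> {}" using An.one_closed by blast
      next
        fix y assume "y \<in> ?U"
        then obtain c u where u: "u \<in> A n" "y = a [^] (c::int) \<otimes> f u" by blast
        have "inv y = f (inv u) \<otimes> a [^] (- c)"
          using u ac by (simp add: inv_mult_group int_pow_neg)
        also have "\<dots> = a [^] (- c) \<otimes> f (inv u)" using pc u by blast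
        finally show "inv y \<in> ?U" using u by blast
      next
        fix y y' assume "y \<in> ?U" "y' \<in> ?U"
        then obtain c u c' u' where u: "u \<in> A n" "y = a [^] (c::int) \<otimes> f u"
          "u' \<in> A n" "y' = a [^] (c'::int) \<otimes> f u'" by blast
        have "y \<otimes> y' = a [^] c \<otimes> (f u \<otimes> a [^] c') \<otimes> f u'" using u ac by (simp add: m_assoc)
        also have "\<dots> = a [^] (c + c') \<otimes> f (u \<otimes> u')"
          using u ac by (simp add: pc m_assoc int_pow_mult)
        finally show "y \<otimes> y' \<in> ?U" using u by blast
      qed
      have "(\<lambda>i. (f ^^ i) a) ` {..<Suc n} \<subseteq> ?U"
      proof clarify
        fix i assume i: "i < Suc n"
        show "\<exists>c u. (f ^^ i) a = a [^] (c::int) \<otimes> f u \<and> u \<in> A n"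
        proof (cases i)
          case 0
          have "(f ^^ i) a = a [^] (1::int) \<otimes> f \<one>" using 0 ac by simp
          then show ?thesis using An.one_closed by blast
        next
          case (Suc j)
          then have "(f ^^ j) a \<in> A n" using i unfolding A_def by (auto intro: generate.incl)
          moreover have "(f ^^ i) a = a [^] (0::int) \<otimes> f ((f ^^ j) a)"
            using Suc fa[of j] by simp
          ultimately show ?thesis by blast
        qed
      qed
      then have "A (Suc n) \<subseteq> ?U" using generate_subgroup_incl[OF _ Us] by (simp add: A_def)
      then show ?thesis using x by blast
    qed
    \<comment> \<open>A relation for the next iterate expresses a power \<open>a [^] c\<close> as a
      value of \<open>f\<close> on \<open>I\<close>, which forces \<open>c = 0\<close>; injectivity
      then cancels one application of \<open>f\<close>.\<close>
    have new: "(f ^^ n) a \<notin> A n" for n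
    proof (induction n)
      case 0
      have "A 0 = {\<one>}" by (simp add: A_def generate_empty)
      moreover have "a \<noteq> \<one>"
        using na rootsI[OF one_closed, of 1 "f ` I"] subgroup.one_closed[OF fI] by force
      ultimately show ?case by simp
    next
      case (Suc n)
      show ?case
      proof
        assume "(f ^^ Suc n) a \<in> A (Suc n)"
        then obtain c u where u: "u \<in> A n" "(f ^^ Suc n) a = a [^] (c::int) \<otimes> f u" using step by blast
        have uI: "u \<in> I" "(f ^^ n) a \<in> I" using u AI fa by blast+
        have "f ((f ^^ n) a \<otimes> inv u) = a [^] c \<otimes> f u \<otimes> inv (f u)" using u uI by simp
        also have "\<dots> = a [^] c" using uI ac by (simp add: m_assoc)
        finally have "a [^] c = f ((f ^^ n) a \<otimes> inv u)" ..
        then have "a [^] c \<in> f ` I" using uI by blast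
        then have "c = 0" by (rule c0)
        then have "f ((f ^^ n) a) = f u" using u uI by simp
        then have "(f ^^ n) a = u" using I(3) uI by (auto dest: inj_onD)
        then show False using u Suc.IH by simp
      qed
    qed
    obtain m where m: "\<And>n. n \<ge> m \<Longrightarrow> A n = A m"
    proof (rule noetherian_onD[OF noeth As])
      show "A n \<subseteq> carrier G" for n using AI I.subset by blast
      show "A n \<subseteq> A (Suc n)" for n unfolding A_def by (intro mono_generate image_mono) auto
    qed blast
    have "(f ^^ m) a \<in> A (Suc m)" unfolding A_def by (auto intro: generate.incl)
    then show False using m[of "Suc m"] new[of m] by simp
  qed
qed

text \<open>Fitting's lemma up to powers. For \<open>f = e ^^ m\<close>, with \<open>m\<close> past
  the point where the kernels are stable, \<open>f\<close> is injective on its image. Hence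
  \<open>f x\<close> has a power of the form \<open>f (f w)\<close>, and dividing by
  \<open>f w\<close> shows that a power of \<open>x\<close> lies in kernel times image. Virtual
  indecomposability makes one of the two trivial.\<close>

lemma normal_endo_inj_or_nilpotent:
  assumes noeth: "noetherian_group G" and vi: "virtually_indecomposable G" and e: "normal_endo G e"
    and ninj: "\<not> inj_on e (carrier G)"
  obtains n where "\<And>x. x \<in> carrier G \<Longrightarrow> (e ^^ n) x = \<one>"
proof -
  define K where "K n = {x \<in> carrier G. (e ^^ n) x = \<one>}" for n
  have hom: "group_hom G G (e ^^ n)" for n by (rule normal_endo_hom[OF normal_endo_funpow[OF e]])
  interpret e: group_hom G G e by (rule normal_endo_hom[OF e])
  have K_kernel: "K n = kernel G G (e ^^ n)" for n by (simp add: K_def kernel_def)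
  have Ks: "subgroup (K n) G" for n unfolding K_kernel using group_hom.subgroup_kernel[OF hom] .
  obtain m where m: "\<And>n. n \<ge> m \<Longrightarrow> K n = K m"
  proof (rule noetherian_onD[OF noeth Ks])
    show "K n \<subseteq> carrier G" "K n \<subseteq> K (Suc n)" for n by (auto simp: K_def)
  qed blast
  define f where "f = e ^^ m"
  have f: "normal_endo G f" unfolding f_def by (rule normal_endo_funpow[OF e])
  interpret f: group_hom G G f by (rule normal_endo_hom[OF f])
  let ?I = "f ` carrier G"
  have Is: "subgroup ?I G" by (rule f.img_is_subgroup)
  have ff: "f x = \<one>" if "x \<in> carrier G" "f (f x) = \<one>" for x
  proof -
    have "x \<in> K (m + m)" using that by (simp add: K_def f_def funpow_add)
    then have "x \<in> K m" using m[of "m + m"] by simp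
    then show ?thesis by (simp add: K_def f_def)
  qed
  have inj: "inj_on f ?I"
  proof (rule inj_onI)
    fix x y assume xy: "x \<in> ?I" "y \<in> ?I" "f x = f y"
    then obtain v w where v: "v \<in> carrier G" "x = f v" "w \<in> carrier G" "y = f w" by blast
    then have "f (f v) = f (f w)" using xy(3) by simp
    then have "f (f (v \<otimes> inv w)) = \<one>" using v by simp
    then have "f (v \<otimes> inv w) = \<one>" using ff[of "v \<otimes> inv w"] v by blast
    then show "x = y" using v f.hom_eq_iff[of v w] by simp
  qed
  have rootsI': "?I \<subseteq> roots G (f ` ?I)"
    by (rule normal_endo_inj_roots[OF noeth f Is _ inj]) auto
  have comm: "\<forall>a \<in> K m. \<forall>b \<in> ?I. a \<otimes> b = b \<otimes> a"
    using normal_endo_kernel_image_commute[OF f] by (auto simp: K_def f_def)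
  have int: "K m \<inter> ?I = {\<one>}"
  proof -
    have "x = \<one>" if "x \<in> K m" "x \<in> ?I" for x
    proof -
      obtain w where "w \<in> carrier G" "x = f w" using \<open>x \<in> ?I\<close> by blast
      then show ?thesis using ff[of w] \<open>x \<in> K m\<close> by (simp add: K_def flip: f_def)
    qed
    then show ?thesis using subgroup.one_closed[OF Ks] subgroup.one_closed[OF Is] by blast
  qed
  have "x \<in> roots G (K m <#> ?I)" if x: "x \<in> carrier G" for x
  proof -
    have "f x \<in> roots G (f ` ?I)" using rootsI' x by blast
    then obtain k :: nat where k: "k \<ge> 1" "f x [^] k \<in> f ` ?I" by (rule rootsE)
    then obtain w where w: "w \<in> carrier G" "f x [^] k = f (f w)" by blast
    let ?y = "x [^] k \<otimes> inv (f w)"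
    have "f ?y = \<one>" using w x by (simp add: f.hom_nat_pow)
    then have "?y \<in> K m" using w x by (simp add: K_def flip: f_def)
    moreover have "x [^] k = ?y \<otimes> f w" using w x by (simp add: m_assoc)
    ultimately have "x [^] k \<in> K m <#> ?I" using w unfolding set_mult_def by blast
    then show ?thesis using rootsI[OF x k(1)] by blast
  qed
  then have "roots G (K m <#> ?I) = carrier G" by (auto simp: roots_def)
  then have "K m = {\<one>} \<or> ?I = {\<one>}"
    using vi Ks Is comm int unfolding virtually_indecomposable_def by blast
  then show thesis
  proof
    assume "K m = {\<one>}"
    \<comment> \<open>Passing to \<open>Suc m\<close> covers \<open>m = 0\<close>: the kernel of
      \<open>e\<close> lies in that of \<open>e ^^ Suc m\<close>, but not in that of the identity
      \<open>e ^^ 0\<close>, unless it is trivial.\<close>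
    then have "K (Suc m) = {\<one>}" using m[of "Suc m"] by simp
    moreover have "K 1 \<subseteq> K (Suc m)"
      using group_hom.hom_one[OF hom] by (auto simp: K_def funpow_swap1)
    ultimately have "x = \<one>" if "x \<in> carrier G" "e x = \<one>" for x using that by (auto simp: K_def)
    then have "inj_on e (carrier G)" using e.inj_on_one_iff by blast
    then show thesis using ninj by blast
  next
    assume "?I = {\<one>}"
    then show thesis using that[of m] by (auto simp: f_def)
  qed
qed

text \<open>The counterpart of a local endomorphism ring. After composition with the inverse of
  \<open>h\<close> one has \<open>x = e x \<otimes> d x\<close>; if \<open>e\<close> is not
  injective it is nilpotent, and then \<open>d\<close> is bijective. The two alternatives differ on
  purpose: bijectivity of the remaining sum is what an induction over summands passes on.\<close>

lemma normal_endo_sum_bij: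
  assumes noeth: "noetherian_group G" and vi: "virtually_indecomposable G"
    and f: "normal_endo G f" and g: "normal_endo G g" and h: "normal_endo G h"
    and sum: "\<And>x. x \<in> carrier G \<Longrightarrow> h x = f x \<otimes> g x" and bij: "bij_betw h (carrier G) (carrier G)"
  shows "inj_on f (carrier G) \<or> bij_betw g (carrier G) (carrier G)"
proof (rule disjCI)
  assume nbij: "\<not> bij_betw g (carrier G) (carrier G)"
  show "inj_on f (carrier G)"
  proof (rule ccontr)
    assume ninj: "\<not> inj_on f (carrier G)"
    define h' where "h' = inv_into (carrier G) h"
    have hiso: "h \<in> iso G G" using h bij by (simp add: iso_def normal_endo_def)
    then have h'iso: "h' \<in> iso G G" unfolding h'_def by (rule iso_set_sym)
    interpret h: group_hom G G h by (rule normal_endo_hom[OF h])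
    interpret h': group_hom G G h' using h'iso by (simp add: iso_def group_hom_def group_hom_axioms_def)
    have hh': "h (h' x) = x" if "x \<in> carrier G" for x
      unfolding h'_def using bij that by (simp add: bij_betw_inv_into_right)
    have h'h: "h' (h x) = x" if "x \<in> carrier G" for x
      unfolding h'_def using bij that by (simp add: bij_betw_inv_into_left)
    have h': "normal_endo G h'"
      unfolding normal_endo_def
    proof (intro conjI ballI)
      show "h' \<in> hom G G" using h'iso by (simp add: iso_def)
      fix y x assume y: "y \<in> carrier G" and x: "x \<in> carrier G"
      have "y \<otimes> x \<otimes> inv y = h (y \<otimes> h' x \<otimes> inv y)"
        using normal_endoD[OF h y, of "h' x"] x hh' by simp
      then show "h' (y \<otimes> x \<otimes> inv y) = y \<otimes> h' x \<otimes> inv y" using h'h x y by simp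
    qed
    define e d where "e = f \<circ> h'" and "d = g \<circ> h'"
    have e: "normal_endo G e" and d: "normal_endo G d"
      unfolding e_def d_def using f g h' by (auto intro: normal_endo_comp)
    interpret e: group_hom G G e by (rule normal_endo_hom[OF e])
    interpret d: group_hom G G d by (rule normal_endo_hom[OF d])
    have ed: "x = e x \<otimes> d x" if "x \<in> carrier G" for x
      using sum[of "h' x"] hh' that by (simp add: e_def d_def)
    have "\<not> inj_on e (carrier G)"
    proof
      assume inj: "inj_on e (carrier G)"
      have "inj_on f (carrier G)"
      proof (rule inj_onI)
        fix x y assume xy: "x \<in> carrier G" "y \<in> carrier G" "f x = f y"
        then have "e (h x) = e (h y)" by (simp add: e_def h'h)
        then have "h x = h y" using inj xy by (auto dest: inj_onD)
        then show "x = y" using h'h xy by metis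
      qed
      then show False using ninj by blast
    qed
    then obtain n where n: "\<And>x. x \<in> carrier G \<Longrightarrow> (e ^^ n) x = \<one>"
      using normal_endo_inj_or_nilpotent[OF noeth vi e] by blast
    have ds: "subgroup (d ` carrier G) G" by (rule d.img_is_subgroup)
    \<comment> \<open>Induction on the nilpotency exponent: in \<open>x = e x \<otimes> d x\<close>
      the first factor is killed one step earlier than \<open>x\<close>.\<close>
    have surj: "x \<in> carrier G \<Longrightarrow> (e ^^ k) x = \<one> \<Longrightarrow> x \<in> d ` carrier G" for x k
    proof (induction k arbitrary: x)
      case 0
      then show ?case using subgroup.one_closed[OF ds] by simp
    next
      case (Suc k)
      have "e x \<in> d ` carrier G" using Suc by (simp add: funpow_swap1)
      then have "e x \<otimes> d x \<in> d ` carrier G" using Suc.prems subgroup.m_closed[OF ds] by blast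
      then show ?case using ed Suc.prems by simp
    qed
    have "inj_on d (carrier G)"
      unfolding d.inj_on_one_iff
    proof (intro allI impI)
      fix x assume x: "x \<in> carrier G" "d x = \<one>"
      then have "e x = x" using ed[OF x(1)] by simp
      then have "(e ^^ k) x = x" for k by (induction k) auto
      then show "x = \<one>" using n[OF x(1)] by simp
    qed
    moreover have "d ` carrier G = carrier G" using surj n by auto
    ultimately have "bij_betw d (carrier G) (carrier G)" by (simp add: bij_betw_def)
    then have "bij_betw (d \<circ> h) (carrier G) (carrier G)" using bij_betw_trans[OF bij] by blast
    moreover have "(d \<circ> h) x = g x" if "x \<in> carrier G" for x using that by (simp add: d_def h'h)
    ultimately have "bij_betw g (carrier G) (carrier G)" using bij_betw_cong[of "carrier G" "d \<circ> h" g] by simp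
    then show False using nbij by blast
  qed
qed

end

section \<open>Automorphisms of direct products\<close>

lemma (in group_hom) commutator_kernel:
  assumes "h ` carrier G \<subseteq> center H"
  shows "lower_central G (Suc 0) \<subseteq> kernel G H h"
  unfolding lower_central_Suc
proof (rule G.generate_subgroup_incl[OF _ subgroup_kernel], clarify)
  fix x y assume "x \<in> lower_central G 0" "y \<in> carrier G"
  then have xy: "x \<in> carrier G" "y \<in> carrier G" by simp_all
  then have "h x \<in> center H" using assms by blast
  then have "commutator H (h x) (h y) = \<one>\<^bsub>H\<^esub>"
    using xy H.center_commute[of "h x" "h y"] by (simp add: H.commutator_one_iff)
  then show "commutator G x y \<in> kernel G H h" using xy by (simp add: kernel_def hom_commutator)
qed

lemma (in group_hom) iso_center:
  assumes "h \<in> iso G H"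
  shows "h ` center G = center H"
proof -
  have surj: "h ` carrier G = carrier H" and inj: "inj_on h (carrier G)"
    using assms by (auto simp: iso_def bij_betw_def)
  have *: "h z \<otimes>\<^bsub>H\<^esub> h g = h g \<otimes>\<^bsub>H\<^esub> h z \<longleftrightarrow> z \<otimes> g = g \<otimes> z" if z: "z \<in> carrier G" and g: "g \<in> carrier G" for z g
    unfolding hom_mult[OF z g, symmetric] hom_mult[OF g z, symmetric]
    by (rule inj_on_eq_iff[OF inj]) (use z g in auto)
  have "h z \<in> center H \<longleftrightarrow> z \<in> center G" if z: "z \<in> carrier G" for z
    unfolding center_def surj[symmetric] using z * by blast
  moreover have "center G \<subseteq> carrier G" "center H \<subseteq> h ` carrier G"
    using surj by (auto simp: center_def)
  ultimately show ?thesis by blast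
qed

lemma center_product_group:
  assumes "\<And>i. i \<in> I \<Longrightarrow> group (H i)"
  shows "center (product_group I H) = (\<Pi>\<^sub>E i\<in>I. center (H i))"
proof (intro equalityI subsetI)
  fix z assume z: "z \<in> center (product_group I H)"
  have zP: "z \<in> (\<Pi>\<^sub>E i\<in>I. carrier (H i))" using z by (simp add: center_def)
  have "z i \<in> center (H i)" if i: "i \<in> I" for i
    unfolding center_def
  proof (intro CollectI conjI ballI)
    show "z i \<in> carrier (H i)" using zP i by auto
    fix g assume g: "g \<in> carrier (H i)"
    \<comment> \<open>A test element supported at the single coordinate \<open>i\<close>.\<close>
    let ?g = "\<lambda>j\<in>I. if j = i then g else \<one>\<^bsub>H j\<^esub>"
    have "?g \<in> (\<Pi>\<^sub>E i\<in>I. carrier (H i))" using g assms by (auto simp: group.is_monoid monoid.one_closed)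
    then have "z \<otimes>\<^bsub>product_group I H\<^esub> ?g = ?g \<otimes>\<^bsub>product_group I H\<^esub> z"
      using z unfolding center_def carrier_product_group by blast
    then have "(z \<otimes>\<^bsub>product_group I H\<^esub> ?g) i = (?g \<otimes>\<^bsub>product_group I H\<^esub> z) i"
      by (rule fun_cong)
    then show "z i \<otimes>\<^bsub>H i\<^esub> g = g \<otimes>\<^bsub>H i\<^esub> z i" using i by simp
  qed
  with zP show "z \<in> (\<Pi>\<^sub>E i\<in>I. center (H i))" by (auto simp: PiE_iff)
next
  fix z assume z: "z \<in> (\<Pi>\<^sub>E i\<in>I. center (H i))"
  have "z \<otimes>\<^bsub>product_group I H\<^esub> g = g \<otimes>\<^bsub>product_group I H\<^esub> z" if g: "g \<in> carrier (product_group I H)" for g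
    unfolding mult_product_group by (rule restrict_ext) (use z g in \<open>auto simp: PiE_iff center_def\<close>)
  then show "z \<in> center (product_group I H)" using z by (auto simp: center_def PiE_iff)
qed

lemma roots_mono: "A \<subseteq> B \<Longrightarrow> roots G A \<subseteq> roots G B"
  by (auto simp: roots_def)

section \<open>Coordinates in the product of a family\<close>

locale group_family =
  fixes I :: "'i set" and H :: "'i \<Rightarrow> 'a monoid"
  assumes grp: "\<And>i. i \<in> I \<Longrightarrow> group (H i)"
begin

abbreviation P :: "('i \<Rightarrow> 'a) monoid" where "P \<equiv> product_group I H"

definition emb :: "'i \<Rightarrow> 'a \<Rightarrow> 'i \<Rightarrow> 'a" where
  "emb a x = (\<lambda>i\<in>I. if i = a then x else \<one>\<^bsub>H i\<^esub>)"

definition proj_on :: "'i set \<Rightarrow> ('i \<Rightarrow> 'a) \<Rightarrow> 'i \<Rightarrow> 'a" where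
  "proj_on B w = (\<lambda>i\<in>I. if i \<in> B then w i else \<one>\<^bsub>H i\<^esub>)"

sublocale P: group P using grp by simp

lemma one_c: "i \<in> I \<Longrightarrow> \<one>\<^bsub>H i\<^esub> \<in> carrier (H i)"
  by (rule monoid.one_closed[OF group.is_monoid[OF grp]])

lemma P_ext: "x \<in> carrier P \<Longrightarrow> y \<in> carrier P \<Longrightarrow> (\<And>i. i \<in> I \<Longrightarrow> x i = y i) \<Longrightarrow> x = y"
  by (auto intro: PiE_ext)

lemma P_mult: "i \<in> I \<Longrightarrow> (x \<otimes>\<^bsub>P\<^esub> y) i = x i \<otimes>\<^bsub>H i\<^esub> y i"
  by simp

lemma P_inv: "x \<in> carrier P \<Longrightarrow> i \<in> I \<Longrightarrow> (inv\<^bsub>P\<^esub> x) i = inv\<^bsub>H i\<^esub> x i"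
  using grp by simp

lemma P_one: "i \<in> I \<Longrightarrow> \<one>\<^bsub>P\<^esub> i = \<one>\<^bsub>H i\<^esub>"
  by simp

lemma P_comp: "x \<in> carrier P \<Longrightarrow> i \<in> I \<Longrightarrow> x i \<in> carrier (H i)"
  by auto

lemma P_pow: "i \<in> I \<Longrightarrow> (x [^]\<^bsub>P\<^esub> (k::nat)) i = x i [^]\<^bsub>H i\<^esub> k"
  by (induction k) auto

lemma emb_closed: "a \<in> I \<Longrightarrow> x \<in> carrier (H a) \<Longrightarrow> emb a x \<in> carrier P"
  by (auto simp: emb_def one_c)

lemma proj_on_closed: "w \<in> carrier P \<Longrightarrow> proj_on B w \<in> carrier P"
  by (auto simp: proj_on_def one_c)

lemma emb_apply: "i \<in> I \<Longrightarrow> emb a x i = (if i = a then x else \<one>\<^bsub>H i\<^esub>)"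
  by (simp add: emb_def)

lemma proj_on_apply: "i \<in> I \<Longrightarrow> proj_on B w i = (if i \<in> B then w i else \<one>\<^bsub>H i\<^esub>)"
  by (simp add: proj_on_def)

lemma emb_hom: assumes "a \<in> I" shows "group_hom (H a) P (emb a)"
proof -
  interpret Ha: group "H a" by (rule grp[OF assms])
  have "emb a (x \<otimes>\<^bsub>H a\<^esub> y) = emb a x \<otimes>\<^bsub>P\<^esub> emb a y" if "x \<in> carrier (H a)" "y \<in> carrier (H a)" for x y
  proof (rule P_ext)
    fix i assume i: "i \<in> I"
    interpret Hi: group "H i" by (rule grp[OF i])
    show "emb a (x \<otimes>\<^bsub>H a\<^esub> y) i = (emb a x \<otimes>\<^bsub>P\<^esub> emb a y) i"
      unfolding P_mult[OF i] emb_apply[OF i] by simp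
  qed (intro P.m_closed emb_closed assms Ha.m_closed that)+
  then show ?thesis using emb_closed[OF assms]
    by unfold_locales (auto intro: homI)
qed

lemma apply_hom: assumes "a \<in> I" shows "group_hom P (H a) (\<lambda>w. w a)"
proof -
  interpret Ha: group "H a" by (rule grp[OF assms])
  show ?thesis by unfold_locales (use assms in \<open>auto intro!: homI\<close>)
qed

text \<open>On each coordinate the map is the identity or trivial, and both commute with
  conjugation. This makes sums of projections accessible to Fitting's lemma.\<close>

lemma proj_on_normal_endo: "normal_endo P (proj_on B)"
proof -
  have mult: "proj_on B (x \<otimes>\<^bsub>P\<^esub> y) = proj_on B x \<otimes>\<^bsub>P\<^esub> proj_on B y" if "x \<in> carrier P" "y \<in> carrier P" for x y
  proof (rule P_ext)
    fix i assume i: "i \<in> I"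
    interpret Hi: group "H i" by (rule grp[OF i])
    show "proj_on B (x \<otimes>\<^bsub>P\<^esub> y) i = (proj_on B x \<otimes>\<^bsub>P\<^esub> proj_on B y) i"
      unfolding P_mult[OF i] proj_on_apply[OF i] by simp
  qed (intro P.m_closed proj_on_closed that)+
  have conj: "proj_on B (g \<otimes>\<^bsub>P\<^esub> x \<otimes>\<^bsub>P\<^esub> inv\<^bsub>P\<^esub> g) = g \<otimes>\<^bsub>P\<^esub> proj_on B x \<otimes>\<^bsub>P\<^esub> inv\<^bsub>P\<^esub> g"
    if g: "g \<in> carrier P" and x: "x \<in> carrier P" for g x
  proof (rule P_ext)
    fix i assume i: "i \<in> I"
    interpret Hi: group "H i" by (rule grp[OF i])
    show "proj_on B (g \<otimes>\<^bsub>P\<^esub> x \<otimes>\<^bsub>P\<^esub> inv\<^bsub>P\<^esub> g) i = (g \<otimes>\<^bsub>P\<^esub> proj_on B x \<otimes>\<^bsub>P\<^esub> inv\<^bsub>P\<^esub> g) i"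
      unfolding P_mult[OF i] proj_on_apply[OF i] P_inv[OF g i]
      using P_comp[OF g i] P_comp[OF x i] by simp
  qed (intro P.m_closed P.inv_closed proj_on_closed that)+
  show ?thesis unfolding normal_endo_def
    by (intro conjI ballI homI proj_on_closed mult conj)
qed

lemma proj_on_insert:
  assumes "b \<notin> B" "w \<in> carrier P"
  shows "proj_on (insert b B) w = proj_on {b} w \<otimes>\<^bsub>P\<^esub> proj_on B w"
proof (rule P_ext)
  fix i assume i: "i \<in> I"
  interpret Hi: group "H i" by (rule grp[OF i])
  show "proj_on (insert b B) w i = (proj_on {b} w \<otimes>\<^bsub>P\<^esub> proj_on B w) i"
    unfolding P_mult[OF i] proj_on_apply[OF i] 
    using assms Hi.l_one[OF P_comp[OF assms(2) i]] Hi.r_one[OF P_comp[OF assms(2) i]]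
    by (cases "i = b") simp_all
qed (intro P.m_closed proj_on_closed assms)+

lemma proj_on_singleton: "b \<in> I \<Longrightarrow> proj_on {b} w = emb b (w b)"
  by (auto simp: proj_on_def emb_def intro!: restrict_ext)

lemma proj_on_UNIV: "w \<in> carrier P \<Longrightarrow> proj_on I w = w"
  by (auto simp: proj_on_def PiE_iff extensional_def)

lemma proj_on_empty: "proj_on {} w = \<one>\<^bsub>P\<^esub>"
  by (auto simp: proj_on_def)

lemma split_off:
  assumes "b \<in> I" "w \<in> carrier P"
  shows "w = emb b (w b) \<otimes>\<^bsub>P\<^esub> proj_on (I - {b}) w"
  using proj_on_insert[of b "I - {b}" w] assms
  by (simp only: proj_on_singleton insert_Diff proj_on_UNIV) (auto simp: insert_absorb proj_on_UNIV)

lemma emb_commute: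
  assumes "b \<in> I" "x \<in> carrier (H b)" "w \<in> carrier P" "w b = \<one>\<^bsub>H b\<^esub>"
  shows "emb b x \<otimes>\<^bsub>P\<^esub> w = w \<otimes>\<^bsub>P\<^esub> emb b x"
proof (rule P_ext)
  fix i assume i: "i \<in> I"
  interpret Hi: group "H i" by (rule grp[OF i])
  show "(emb b x \<otimes>\<^bsub>P\<^esub> w) i = (w \<otimes>\<^bsub>P\<^esub> emb b x) i"
    unfolding P_mult[OF i] emb_apply[OF i] 
    using assms Hi.l_one[of x] Hi.r_one[of x] Hi.l_one[OF P_comp[OF assms(3) i]] Hi.r_one[OF P_comp[OF assms(3) i]]
    by (cases "i = b") simp_all
qed (intro P.m_closed emb_closed assms)+

lemma center_P: "center P = (\<Pi>\<^sub>E i\<in>I. center (H i))"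
  by (rule center_product_group[OF grp])

lemma center_P_comp: "z \<in> center P \<Longrightarrow> i \<in> I \<Longrightarrow> z i \<in> center (H i)"
  unfolding center_P by (rule PiE_mem)

lemma center_PI: "z \<in> carrier P \<Longrightarrow> (\<And>i. i \<in> I \<Longrightarrow> z i \<in> center (H i)) \<Longrightarrow> z \<in> center P"
  unfolding center_P carrier_product_group by (simp add: PiE_iff)

end

section \<open>Krull-Schmidt for a family of virtually indecomposable groups\<close>

locale indecomposable_family = group_family I H for I :: "'i set" and H :: "'i \<Rightarrow> 'a monoid" +
  fixes \<psi> :: "('i \<Rightarrow> 'a) \<Rightarrow> 'i \<Rightarrow> 'a"
  assumes fin: "finite I"
    and noeth: "\<And>i. i \<in> I \<Longrightarrow> noetherian_group (H i)"
    and ur: "\<And>i. i \<in> I \<Longrightarrow> unique_roots (H i)"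
    and vi: "\<And>i. i \<in> I \<Longrightarrow> virtually_indecomposable (H i)"
    and nc: "\<And>i. i \<in> I \<Longrightarrow> \<not> comm_group (H i)"
    and \<psi>: "\<psi> \<in> iso P P"
begin

definition \<psi>' :: "('i \<Rightarrow> 'a) \<Rightarrow> 'i \<Rightarrow> 'a" where "\<psi>' = inv_into (carrier P) \<psi>"

text \<open>Matrix entry of \<open>\<psi>\<close>, with the target index first and the source index
  second.\<close>

definition component :: "'i \<Rightarrow> 'i \<Rightarrow> 'a \<Rightarrow> 'a" where "component a b x = \<psi> (emb b x) a"

text \<open>The contribution of the indices in \<open>B\<close> to the matrix product of
  \<open>\<psi>\<close> with its inverse at the diagonal place \<open>a\<close>; for
  \<open>B = I\<close> it is the identity of the factor.\<close>

definition partial :: "'i \<Rightarrow> 'i set \<Rightarrow> 'a \<Rightarrow> 'a" where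
  "partial a B x = \<psi> (proj_on B (\<psi>' (emb a x))) a"

lemma \<psi>'_iso: "\<psi>' \<in> iso P P" unfolding \<psi>'_def using P.iso_set_sym[OF \<psi>] .

sublocale \<psi>: group_hom P P \<psi> using \<psi> by unfold_locales (simp add: iso_def)
sublocale \<psi>': group_hom P P \<psi>' using \<psi>'_iso by unfold_locales (simp add: iso_def)

lemma \<psi>_bij: "bij_betw \<psi> (carrier P) (carrier P)"
  using \<psi> by (simp only: iso_def mem_Collect_eq)

lemma \<psi>_\<psi>': "w \<in> carrier P \<Longrightarrow> \<psi> (\<psi>' w) = w"
  unfolding \<psi>'_def by (rule bij_betw_inv_into_right[OF \<psi>_bij])

lemma \<psi>'_\<psi>: "w \<in> carrier P \<Longrightarrow> \<psi>' (\<psi> w) = w"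
  unfolding \<psi>'_def by (rule bij_betw_inv_into_left[OF \<psi>_bij])

lemma component_hom: assumes "a \<in> I" "b \<in> I" shows "group_hom (H b) (H a) (component a b)"
proof -
  interpret e: group_hom "H b" P "emb b" by (rule emb_hom[OF assms(2)])
  interpret p: group_hom P "H a" "\<lambda>w. w a" by (rule apply_hom[OF assms(1)])
  have "component a b \<in> hom (H b) (H a)"
    unfolding component_def
    by (intro homI) (simp_all only: e.hom_mult \<psi>.hom_mult p.hom_mult e.hom_closed \<psi>.hom_closed p.hom_closed)
  then show ?thesis by unfold_locales
qed

text \<open>A single entry maps between different factors, but
  \<open>\<psi> \<circ> proj_on B \<circ> \<psi>'\<close> is a normal map conjugated by an
  automorphism and so normal again. Restricting it to the factor \<open>a\<close> and reading
  coordinate \<open>a\<close> preserves this.\<close>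

lemma partial_normal_endo: assumes a: "a \<in> I" shows "normal_endo (H a) (partial a B)"
proof -
  interpret e: group_hom "H a" P "emb a" by (rule emb_hom[OF a])
  interpret p: group_hom P "H a" "\<lambda>w. w a" by (rule apply_hom[OF a])
  interpret q: group_hom P P "proj_on B" by (rule P.normal_endo_hom[OF proj_on_normal_endo])
  show ?thesis
    unfolding normal_endo_def
  proof (intro conjI ballI)
    show "partial a B \<in> hom (H a) (H a)"
      unfolding partial_def
      by (intro homI) (simp_all only: e.hom_mult \<psi>.hom_mult p.hom_mult e.hom_closed \<psi>.hom_closed p.hom_closed
          \<psi>'.hom_mult \<psi>'.hom_closed q.hom_mult q.hom_closed)
    fix g x assume g: "g \<in> carrier (H a)" and x: "x \<in> carrier (H a)"
    let ?g = "\<psi>' (emb a g)" and ?x = "\<psi>' (emb a x)"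
    have c: "?g \<in> carrier P" "?x \<in> carrier P" "emb a g \<in> carrier P" "emb a x \<in> carrier P"
      using g x by (simp_all only: e.hom_closed \<psi>'.hom_closed)
    have "partial a B (g \<otimes>\<^bsub>H a\<^esub> x \<otimes>\<^bsub>H a\<^esub> inv\<^bsub>H a\<^esub> g) = \<psi> (proj_on B (?g \<otimes>\<^bsub>P\<^esub> ?x \<otimes>\<^bsub>P\<^esub> inv\<^bsub>P\<^esub> ?g)) a"
      unfolding partial_def using g x c
      by (simp only: e.hom_mult e.hom_inv e.G.m_closed e.G.inv_closed \<psi>'.hom_mult \<psi>'.hom_inv P.m_closed P.inv_closed)
    also have "\<dots> = \<psi> (?g \<otimes>\<^bsub>P\<^esub> proj_on B ?x \<otimes>\<^bsub>P\<^esub> inv\<^bsub>P\<^esub> ?g) a"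
      using P.normal_endoD[OF proj_on_normal_endo c(1,2)] by (simp only:)
    also have "\<dots> = (emb a g \<otimes>\<^bsub>P\<^esub> \<psi> (proj_on B ?x) \<otimes>\<^bsub>P\<^esub> inv\<^bsub>P\<^esub> emb a g) a"
      using c by (simp only: \<psi>.hom_mult \<psi>.hom_inv \<psi>_\<psi>' q.hom_closed P.m_closed P.inv_closed)
    also have "\<dots> = g \<otimes>\<^bsub>H a\<^esub> partial a B x \<otimes>\<^bsub>H a\<^esub> inv\<^bsub>H a\<^esub> g"
      using c a by (simp only: P_mult P_inv emb_apply partial_def simp_thms if_True)
    finally show "partial a B (g \<otimes>\<^bsub>H a\<^esub> x \<otimes>\<^bsub>H a\<^esub> inv\<^bsub>H a\<^esub> g) = g \<otimes>\<^bsub>H a\<^esub> partial a B x \<otimes>\<^bsub>H a\<^esub> inv\<^bsub>H a\<^esub> g" .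
  qed
qed

lemma partial_insert:
  assumes "a \<in> I" "b \<notin> B" "x \<in> carrier (H a)"
  shows "partial a (insert b B) x = partial a {b} x \<otimes>\<^bsub>H a\<^esub> partial a B x"
proof -
  have c: "\<psi>' (emb a x) \<in> carrier P" by (intro \<psi>'.hom_closed emb_closed assms)
  show ?thesis
    unfolding partial_def proj_on_insert[OF assms(2) c]
    using c assms(1) by (simp only: \<psi>.hom_mult proj_on_closed P_mult)
qed

lemma partial_all: "a \<in> I \<Longrightarrow> x \<in> carrier (H a) \<Longrightarrow> partial a I x = x"
  unfolding partial_def by (simp only: proj_on_UNIV \<psi>_\<psi>' emb_closed \<psi>'.hom_closed emb_apply simp_thms if_True)

text \<open>The identity \<open>partial a I\<close> is the product of the maps
  \<open>partial a {b}\<close>, and indices are split off until an injective one appears. If none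
  did, the empty product would be bijective, and the factor would be trivial and hence
  abelian.\<close>

lemma exists_injective_partial:
  assumes a: "a \<in> I"
  shows "\<exists>b \<in> I. inj_on (partial a {b}) (carrier (H a))"
proof -
  interpret Ha: group "H a" by (rule grp[OF a])
  have "\<exists>b \<in> B. inj_on (partial a {b}) (carrier (H a))"
    if "finite B" "bij_betw (partial a B) (carrier (H a)) (carrier (H a))" for B
    using that
  proof (induction B)
    case empty
    have "partial a {} x = \<one>\<^bsub>H a\<^esub>" for x
      unfolding partial_def proj_on_empty using a by (simp only: \<psi>.hom_one P_one)
    then have "carrier (H a) \<subseteq> {\<one>\<^bsub>H a\<^esub>}" using empty by (auto simp: bij_betw_def)
    then have "comm_group (H a)" by (intro Ha.group_comm_groupI) auto
    then show ?case using nc[OF a] by blast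
  next
    case (insert b B)
    show ?case
      using Ha.normal_endo_sum_bij[OF noeth[OF a] vi[OF a] partial_normal_endo[OF a, of "{b}"]
          partial_normal_endo[OF a, of B] partial_normal_endo[OF a, of "insert b B"]
          partial_insert[OF a insert.hyps(2)] insert.prems] insert.IH by blast
  qed
  moreover have "bij_betw (partial a I) (carrier (H a)) (carrier (H a))"
    using partial_all[OF a] bij_betw_cong[of "carrier (H a)" "partial a I" id] by simp
  ultimately show ?thesis using fin by blast
qed

text \<open>The injective endomorphism factors through the entry from \<open>b\<close> to
  \<open>a\<close>, and its image already contains a power of every element.\<close>

lemma exists_virtually_surjective_component:
  assumes a: "a \<in> I"
  shows "\<exists>b \<in> I. carrier (H a) \<subseteq> roots (H a) (component a b ` carrier (H b))"
proof -
  interpret Ha: group "H a" by (rule grp[OF a])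
  obtain b where b: "b \<in> I" "inj_on (partial a {b}) (carrier (H a))"
    using exists_injective_partial[OF a] by blast
  interpret f: group_hom "H a" "H a" "partial a {b}"
    by (rule Ha.normal_endo_hom[OF partial_normal_endo[OF a]])
  have "carrier (H a) \<subseteq> roots (H a) (partial a {b} ` carrier (H a))"
    by (rule Ha.normal_endo_inj_roots[OF noeth[OF a] partial_normal_endo[OF a] Ha.subgroup_self _ b(2)]) auto
  moreover have "partial a {b} ` carrier (H a) \<subseteq> component a b ` carrier (H b)"
  proof clarify
    fix x assume x: "x \<in> carrier (H a)"
    have "partial a {b} x = component a b (\<psi>' (emb a x) b)"
      unfolding partial_def component_def proj_on_singleton[OF b(1)] ..
    moreover have "\<psi>' (emb a x) b \<in> carrier (H b)"
      by (intro P_comp \<psi>'.hom_closed emb_closed a x b)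
    ultimately show "partial a {b} x \<in> component a b ` carrier (H b)" by blast
  qed
  ultimately have "carrier (H a) \<subseteq> roots (H a) (component a b ` carrier (H b))"
    using roots_mono by (meson order_trans)
  then show ?thesis using b(1) by blast
qed

text \<open>A separate choice for every target \<open>a\<close>. That different targets receive
  different sources is a consequence, \<open>\<sigma>_bij\<close>, and not built into the
  choice.\<close>

definition \<sigma> :: "'i \<Rightarrow> 'i" where
  "\<sigma> a = (SOME b. b \<in> I \<and> carrier (H a) \<subseteq> roots (H a) (component a b ` carrier (H b)))"

lemma \<sigma>:
  assumes "a \<in> I"
  shows "\<sigma> a \<in> I" "carrier (H a) \<subseteq> roots (H a) (component a (\<sigma> a) ` carrier (H (\<sigma> a)))"
  using someI_ex[of "\<lambda>b. b \<in> I \<and> carrier (H a) \<subseteq> roots (H a) (component a b ` carrier (H b))"]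
    exists_virtually_surjective_component[OF assms] unfolding \<sigma>_def by blast+

text \<open>An element with trivial coordinate \<open>\<sigma> a\<close> commutes with the embedded
  factor \<open>\<sigma> a\<close>. After applying \<open>\<psi>\<close> and reading coordinate
  \<open>a\<close>, the value commutes with a power of every element, and by uniqueness of roots
  with every element.\<close>

lemma off_component_central:
  assumes a: "a \<in> I" and w: "w \<in> carrier P" "w (\<sigma> a) = \<one>\<^bsub>H (\<sigma> a)\<^esub>"
  shows "\<psi> w a \<in> center (H a)"
proof -
  interpret Ha: group "H a" by (rule grp[OF a])
  interpret m: group_hom "H (\<sigma> a)" "H a" "component a (\<sigma> a)" by (rule component_hom[OF a \<sigma>(1)[OF a]])
  have wc: "\<psi> w a \<in> carrier (H a)" by (intro P_comp \<psi>.hom_closed w a)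
  have "y \<otimes>\<^bsub>H a\<^esub> \<psi> w a = \<psi> w a \<otimes>\<^bsub>H a\<^esub> y" if y: "y \<in> carrier (H a)" for y
  proof -
    obtain k :: nat and x where k: "k \<ge> 1" "x \<in> carrier (H (\<sigma> a))" "y [^]\<^bsub>H a\<^esub> k = component a (\<sigma> a) x"
      using \<sigma>(2)[OF a] y by (blast elim: Ha.rootsE)
    have "\<psi> (emb (\<sigma> a) x) \<otimes>\<^bsub>P\<^esub> \<psi> w = \<psi> w \<otimes>\<^bsub>P\<^esub> \<psi> (emb (\<sigma> a) x)"
      using emb_commute[OF \<sigma>(1)[OF a] k(2) w] emb_closed[OF \<sigma>(1)[OF a] k(2)] w(1)
      by (metis \<psi>.hom_mult)
    then have "component a (\<sigma> a) x \<otimes>\<^bsub>H a\<^esub> \<psi> w a = \<psi> w a \<otimes>\<^bsub>H a\<^esub> component a (\<sigma> a) x"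
      unfolding component_def using P_mult[OF a] by metis
    then show ?thesis using Ha.unique_roots_commute[OF ur[OF a] k(1) y wc] k(3) by simp
  qed
  then show ?thesis using wc by (simp add: center_def)
qed

lemma component_central:
  assumes "a \<in> I" "b \<in> I" "b \<noteq> \<sigma> a" "x \<in> carrier (H b)"
  shows "component a b x \<in> center (H a)"
  unfolding component_def
  by (rule off_component_central[OF assms(1) emb_closed[OF assms(2,4)]])
    (simp only: emb_apply[OF \<sigma>(1)[OF assms(1)]] assms(3)[symmetric] if_False simp_thms)

lemma center_emb:
  assumes b: "b \<in> I" and x: "x \<in> carrier (H b)" and c: "\<psi> (emb b x) \<in> center P"
  shows "x \<in> center (H b)"
proof -
  have "\<psi>' ` center P = center P" by (rule \<psi>'.iso_center[OF \<psi>'_iso])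
  moreover have "\<psi>' (\<psi> (emb b x)) \<in> \<psi>' ` center P" using c by (rule imageI)
  ultimately have "emb b x \<in> center P" using \<psi>'_\<psi>[OF emb_closed[OF b x]] by (simp only:)
  then have "emb b x b \<in> center (H b)" using b by (rule center_P_comp)
  then show ?thesis using b by (simp add: emb_apply)
qed

text \<open>A source missed by \<open>\<sigma>\<close> has only central entries, so
  \<open>\<psi>\<close> maps its whole factor into the center and the factor would be abelian.
  Finiteness of \<open>I\<close> turns surjectivity into bijectivity.\<close>

lemma \<sigma>_bij: "bij_betw \<sigma> I I"
proof -
  have sub: "\<sigma> ` I \<subseteq> I" using \<sigma>(1) by blast
  have "b \<in> \<sigma> ` I" if b: "b \<in> I" for b
  proof (rule ccontr)
    assume nb: "b \<notin> \<sigma> ` I"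
    interpret Hb: group "H b" by (rule grp[OF b])
    have "x \<in> center (H b)" if x: "x \<in> carrier (H b)" for x
    proof (rule center_emb[OF b x])
      have "\<psi> (emb b x) \<in> carrier P" by (intro \<psi>.hom_closed emb_closed b x)
      moreover have "\<psi> (emb b x) a \<in> center (H a)" if a: "a \<in> I" for a
        using component_central[OF a b _ x] nb a unfolding component_def by blast
      ultimately show "\<psi> (emb b x) \<in> center P" by (rule center_PI)
    qed
    then have "comm_group (H b)" using Hb.center_commute by (intro Hb.group_comm_groupI) blast
    then show False using nc[OF b] by blast
  qed
  then have "\<sigma> ` I = I" using sub by blast
  then show ?thesis using eq_card_imp_inj_on[OF fin, of \<sigma>] by (simp add: bij_betw_def)
qed

text \<open>The entry takes central values and so kills a power of \<open>z\<close>; uniqueness of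
  roots removes the exponent.\<close>

lemma component_kills_center:
  assumes a: "a \<in> I" and b: "b \<in> I" "b \<noteq> \<sigma> a" and z: "z \<in> center (H b)"
  shows "component a b z = \<one>\<^bsub>H a\<^esub>"
proof -
  interpret m: group_hom "H b" "H a" "component a b" by (rule component_hom[OF a b(1)])
  have "component a b ` carrier (H b) \<subseteq> center (H a)" using component_central[OF a b] by blast
  then have ker: "lower_central (H b) (Suc 0) \<subseteq> kernel (H b) (H a) (component a b)"
    by (rule m.commutator_kernel)
  obtain k :: nat where k: "k \<ge> 1" "z \<in> carrier (H b)" "z [^]\<^bsub>H b\<^esub> k \<in> lower_central (H b) (Suc 0)"
    using m.G.center_subset_roots_derived[OF vi[OF b(1)] nc[OF b(1)]] z by (blast elim: m.G.rootsE)
  then have "component a b z [^]\<^bsub>H a\<^esub> k = \<one>\<^bsub>H a\<^esub>"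
    using ker by (auto simp: kernel_def m.hom_nat_pow)
  then show ?thesis using m.H.unique_rootsD[OF ur[OF a] k(1)] k(2) by simp
qed

lemma \<psi>_split:
  assumes "a \<in> I" "w \<in> carrier P"
  shows "\<psi> w a = component a (\<sigma> a) (w (\<sigma> a)) \<otimes>\<^bsub>H a\<^esub> \<psi> (proj_on (I - {\<sigma> a}) w) a"
proof -
  have "\<psi> w = \<psi> (emb (\<sigma> a) (w (\<sigma> a)) \<otimes>\<^bsub>P\<^esub> proj_on (I - {\<sigma> a}) w)"
    using split_off[OF \<sigma>(1)[OF assms(1)] assms(2)] by (rule arg_cong)
  also have "\<dots> = \<psi> (emb (\<sigma> a) (w (\<sigma> a))) \<otimes>\<^bsub>P\<^esub> \<psi> (proj_on (I - {\<sigma> a}) w)"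
    by (intro \<psi>.hom_mult emb_closed proj_on_closed P_comp \<sigma>(1) assms)
  finally show ?thesis unfolding component_def using P_mult[OF assms(1)] by metis
qed

text \<open>The remaining coordinates are split off one at a time, and each contributes a trivial
  entry.\<close>

lemma \<psi>_center:
  assumes a: "a \<in> I" and z: "z \<in> center P"
  shows "\<psi> z a = component a (\<sigma> a) (z (\<sigma> a))"
proof -
  interpret Ha: group "H a" by (rule grp[OF a])
  have zP: "z \<in> carrier P" using z P.center_closed by blast
  have zi: "z i \<in> center (H i)" if "i \<in> I" for i using z that by (rule center_P_comp)
  have "\<psi> (proj_on B z) a = \<one>\<^bsub>H a\<^esub>" if "finite B" "B \<subseteq> I - {\<sigma> a}" for B
    using that
  proof (induction B)
    case empty
    show ?case unfolding proj_on_empty using a by (simp only: \<psi>.hom_one P_one)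
  next
    case (insert b B)
    have b: "b \<in> I" "b \<noteq> \<sigma> a" using insert.prems by auto
    have "\<psi> (proj_on (insert b B) z) a = component a b (z b) \<otimes>\<^bsub>H a\<^esub> \<psi> (proj_on B z) a"
      unfolding proj_on_insert[OF insert.hyps(2) zP] component_def proj_on_singleton[OF b(1), symmetric]
      using zP a by (simp only: \<psi>.hom_mult proj_on_closed P_mult)
    then show ?case using insert component_kills_center[OF a b zi[OF b(1)]] by simp
  qed
  then have "\<psi> (proj_on (I - {\<sigma> a}) z) a = \<one>\<^bsub>H a\<^esub>" using fin by blast
  moreover have "component a (\<sigma> a) (z (\<sigma> a)) \<in> carrier (H a)"
    using group_hom.hom_closed[OF component_hom[OF a \<sigma>(1)[OF a]]] P_comp[OF zP \<sigma>(1)[OF a]] by blast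
  ultimately show ?thesis using \<psi>_split[OF a zP] by simp
qed

text \<open>For injectivity, an element killed by the entry has central entries everywhere, is
  therefore central itself, and then has trivial entries everywhere. For surjectivity, the center is
  reached because \<open>\<psi>\<close> maps the center of the product onto itself and acts on it
  only through the entries along \<open>\<sigma>\<close>; any other element differs from a value of
  the entry by a central factor.\<close>

lemma component_iso:
  assumes a: "a \<in> I"
  shows "component a (\<sigma> a) \<in> iso (H (\<sigma> a)) (H a)"
proof -
  interpret m: group_hom "H (\<sigma> a)" "H a" "component a (\<sigma> a)" by (rule component_hom[OF a \<sigma>(1)[OF a]])
  have b: "\<sigma> a \<in> I" by (rule \<sigma>(1)[OF a])
  have "x = \<one>\<^bsub>H (\<sigma> a)\<^esub>" if x: "x \<in> carrier (H (\<sigma> a))" "component a (\<sigma> a) x = \<one>\<^bsub>H a\<^esub>" for x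
  proof -
    let ?w = "\<psi> (emb (\<sigma> a) x)"
    have wP: "?w \<in> carrier P" by (intro \<psi>.hom_closed emb_closed b x)
    have ne: "\<sigma> a \<noteq> \<sigma> a'" if "a' \<in> I" "a' \<noteq> a" for a'
      using \<sigma>_bij that a unfolding bij_betw_def inj_on_def by metis
    have "?w a' \<in> center (H a')" if a': "a' \<in> I" for a'
    proof (cases "a' = a")
      case True
      then show ?thesis using x(2) subgroup.one_closed[OF m.H.subgroup_center] by (simp add: component_def)
    next
      case False
      then show ?thesis using component_central[OF a' b ne[OF a' False] x(1)] by (simp add: component_def)
    qed
    with wP have "?w \<in> center P" by (rule center_PI)
    then have xc: "x \<in> center (H (\<sigma> a))" by (rule center_emb[OF b x(1)])
    have "?w = \<one>\<^bsub>P\<^esub>"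
    proof (rule P_ext[OF wP P.one_closed])
      fix a' assume a': "a' \<in> I"
      show "?w a' = \<one>\<^bsub>P\<^esub> a'"
      proof (cases "a' = a")
        case True
        then show ?thesis using x(2) a' by (simp add: component_def)
      next
        case False
        then show ?thesis using component_kills_center[OF a' b ne[OF a' False] xc] a' by (simp add: component_def)
      qed
    qed
    then have "emb (\<sigma> a) x = \<one>\<^bsub>P\<^esub>" using \<psi>'_\<psi>[OF emb_closed[OF b x(1)]] \<psi>'.hom_one by metis
    then have "emb (\<sigma> a) x (\<sigma> a) = \<one>\<^bsub>H (\<sigma> a)\<^esub>" using P_one[OF b] by metis
    then show ?thesis using emb_apply[OF b] by simp
  qed
  moreover have "y \<in> component a (\<sigma> a) ` carrier (H (\<sigma> a))" if y: "y \<in> carrier (H a)" for y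
  proof -
    have im: "subgroup (component a (\<sigma> a) ` carrier (H (\<sigma> a))) (H a)" by (rule m.img_is_subgroup)
    have cen: "c \<in> component a (\<sigma> a) ` carrier (H (\<sigma> a))" if c: "c \<in> center (H a)" for c
    proof -
      have cc: "c \<in> carrier (H a)" using c m.H.center_closed by blast
      have "emb a c i \<in> center (H i)" if "i \<in> I" for i
        using c that group.subgroup_center[OF grp[OF that]] by (auto simp: emb_apply subgroup.one_closed)
      with emb_closed[OF a cc] have "emb a c \<in> center P" by (rule center_PI)
      then have v: "\<psi>' (emb a c) \<in> center P" using \<psi>'.iso_center[OF \<psi>'_iso] by blast
      have "c = \<psi> (\<psi>' (emb a c)) a" using \<psi>_\<psi>'[OF emb_closed[OF a cc]] a by (simp add: emb_apply)
      also have "\<dots> = component a (\<sigma> a) (\<psi>' (emb a c) (\<sigma> a))" by (rule \<psi>_center[OF a v])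
      finally show ?thesis using P_comp[OF P.center_closed[OF v] b] by blast
    qed
    let ?w = "\<psi>' (emb a y)"
    have wP: "?w \<in> carrier P" by (intro \<psi>'.hom_closed emb_closed a y)
    have "y = \<psi> ?w a" using \<psi>_\<psi>'[OF emb_closed[OF a y]] a by (simp add: emb_apply)
    also have "\<dots> = component a (\<sigma> a) (?w (\<sigma> a)) \<otimes>\<^bsub>H a\<^esub> \<psi> (proj_on (I - {\<sigma> a}) ?w) a"
      by (rule \<psi>_split[OF a wP])
    also have "\<dots> \<in> component a (\<sigma> a) ` carrier (H (\<sigma> a))"
    proof (rule subgroup.m_closed[OF im])
      show "component a (\<sigma> a) (?w (\<sigma> a)) \<in> component a (\<sigma> a) ` carrier (H (\<sigma> a))"
        using P_comp[OF wP b] by blast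
      have "\<psi> (proj_on (I - {\<sigma> a}) ?w) a \<in> center (H a)"
        by (rule off_component_central[OF a proj_on_closed[OF wP]]) (simp add: proj_on_apply[OF b])
      then show "\<psi> (proj_on (I - {\<sigma> a}) ?w) a \<in> component a (\<sigma> a) ` carrier (H (\<sigma> a))" by (rule cen)
    qed
    finally show ?thesis .
  qed
  ultimately show ?thesis by (simp add: m.iso_iff subset_iff image_iff)
qed

text \<open>The two descriptions of \<open>\<psi>\<close>, exact on the center and up to central
  factors elsewhere, are the form in which Reidemeister numbers are compared modulo the
  center.\<close>

lemma monomial_form:
  obtains s \<theta> where "bij_betw s I I" "\<And>a. a \<in> I \<Longrightarrow> \<theta> a \<in> iso (H (s a)) (H a)"
    "\<And>a z. a \<in> I \<Longrightarrow> z \<in> center P \<Longrightarrow> \<psi> z a = \<theta> a (z (s a))"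
    "\<And>a w. a \<in> I \<Longrightarrow> w \<in> carrier P \<Longrightarrow> \<exists>c \<in> center (H a). \<psi> w a = \<theta> a (w (s a)) \<otimes>\<^bsub>H a\<^esub> c"
proof (rule that[of \<sigma> "\<lambda>a. component a (\<sigma> a)"])
  fix a w assume a: "a \<in> I" and w: "w \<in> carrier P"
  have "\<psi> (proj_on (I - {\<sigma> a}) w) a \<in> center (H a)"
    by (rule off_component_central[OF a proj_on_closed[OF w]]) (simp add: proj_on_apply[OF \<sigma>(1)[OF a]])
  then show "\<exists>c \<in> center (H a). \<psi> w a = component a (\<sigma> a) (w (\<sigma> a)) \<otimes>\<^bsub>H a\<^esub> c"
    using \<psi>_split[OF a w] by blast
qed (rule \<sigma>_bij component_iso \<psi>_center; assumption)+

end

section \<open>Reidemeister numbers modulo the center\<close>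

text \<open>Cardinality with all infinite values identified, matching the convention for
  Reidemeister numbers.\<close>

definition ecard :: "'a set \<Rightarrow> enat" where
  "ecard A = (if finite A then enat (card A) else \<infinity>)"

lemma ecard_bij_betw: "bij_betw f A B \<Longrightarrow> ecard A = ecard B"
  by (simp add: ecard_def bij_betw_finite bij_betw_same_card)

lemma ecard_Times: "ecard (A \<times> B) = ecard A * ecard B"
proof (cases "A = {} \<or> B = {}")
  case True
  then show ?thesis by (auto simp: ecard_def zero_enat_def[symmetric])
next
  case False
  then show ?thesis
    by (auto simp: ecard_def finite_cartesian_product_iff card_cartesian_product card_gt_0_iff
        times_enat_simps imult_is_infinity zero_enat_def)
qed

lemma equiv_iff:
  assumes "equiv A r" "(x, x') \<in> r" "(y, y') \<in> r"
  shows "(x, y) \<in> r \<longleftrightarrow> (x', y') \<in> r"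
  using assms(2,3) equivE[OF assms(1)] by (metis symD transD)

text \<open>\<open>h\<close> has to meet every class but may be neither injective nor surjective,
  which suits maps that choose representatives.\<close>

lemma quotient_transfer:
  assumes r: "equiv A r" and s: "equiv B s" and hB: "\<And>x. x \<in> A \<Longrightarrow> h x \<in> B"
    and iff: "\<And>x y. x \<in> A \<Longrightarrow> y \<in> A \<Longrightarrow> (x, y) \<in> r \<longleftrightarrow> (h x, h y) \<in> s"
    and surj: "\<And>b. b \<in> B \<Longrightarrow> \<exists>a \<in> A. (h a, b) \<in> s"
  shows "ecard (A // r) = ecard (B // s)"
proof -
  define f where "f C = s `` (h ` C)" for C
  have f: "f (r `` {x}) = s `` {h x}" if x: "x \<in> A" for x
  proof
    have "r `` {x} \<subseteq> A" using r by (auto simp: equiv_def refl_on_def)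
    then show "f (r `` {x}) \<subseteq> s `` {h x}"
      unfolding f_def using iff[OF x] equivE[OF s] by (auto dest: transD)
    have "x \<in> r `` {x}" using r x by (auto simp: equiv_def refl_on_def)
    then show "s `` {h x} \<subseteq> f (r `` {x})" unfolding f_def by blast
  qed
  have "bij_betw f (A // r) (B // s)"
    unfolding bij_betw_def
  proof
    show "inj_on f (A // r)"
    proof (rule inj_onI)
      fix C D assume "C \<in> A // r" "D \<in> A // r" and eq: "f C = f D"
      then obtain x y where x: "x \<in> A" "C = r `` {x}" and y: "y \<in> A" "D = r `` {y}"
        by (auto simp: quotient_def)
      have "s `` {h x} = s `` {h y}" using eq f x y by simp
      then have "(h x, h y) \<in> s" using eq_equiv_class[OF _ s] hB y by blast
      then show "C = D" using iff x y equiv_class_eq[OF r] by blast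
    qed
    show "f ` (A // r) = B // s"
    proof
      show "f ` (A // r) \<subseteq> B // s" using f hB by (auto simp: quotient_def)
      show "B // s \<subseteq> f ` (A // r)"
      proof
        fix D assume "D \<in> B // s"
        then obtain b where b: "b \<in> B" "D = s `` {b}" by (auto simp: quotient_def)
        obtain a where a: "a \<in> A" "(h a, b) \<in> s" using surj b by blast
        have "D = s `` {h a}" using equiv_class_eq[OF s a(2)] b by simp
        then have "D = f (r `` {a})" using f a by simp
        then show "D \<in> f ` (A // r)" using a by (blast intro: quotientI)
      qed
    qed
  qed
  then show ?thesis by (rule ecard_bij_betw)
qed

lemma reidemeister_number_ecard: "reidemeister_number G \<phi> = ecard (carrier G // twisted_conj G \<phi>)"
  by (simp add: reidemeister_number_def ecard_def Let_def)

lemma twisted_conj_iff: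
  "(x, y) \<in> twisted_conj G \<phi> \<longleftrightarrow> x \<in> carrier G \<and> y \<in> carrier G \<and>
    (\<exists>z \<in> carrier G. x = z \<otimes>\<^bsub>G\<^esub> y \<otimes>\<^bsub>G\<^esub> inv\<^bsub>G\<^esub> (\<phi> z))"
  by (simp add: twisted_conj_def)

lemma twisted_conj_cong:
  assumes "\<And>x. x \<in> carrier G \<Longrightarrow> \<phi> x = \<phi>' x"
  shows "twisted_conj G \<phi> = twisted_conj G \<phi>'"
  using assms by (auto simp: twisted_conj_def)

lemma (in group) equiv_twisted_conj:
  assumes "\<phi> \<in> hom G G"
  shows "equiv (carrier G) (twisted_conj G \<phi>)"
proof -
  interpret \<phi>: group_hom G G \<phi> using assms by unfold_locales
  show ?thesis
  proof (rule equivI)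
    show "twisted_conj G \<phi> \<subseteq> carrier G \<times> carrier G" by (auto simp: twisted_conj_def)
    show "refl_on (carrier G) (twisted_conj G \<phi>)"
    proof (rule refl_onI)
      fix x assume x: "x \<in> carrier G"
      then have "x = \<one> \<otimes> x \<otimes> inv (\<phi> \<one>)" by simp
      then show "(x, x) \<in> twisted_conj G \<phi>" using x one_closed unfolding twisted_conj_iff by blast
    qed
    show "sym (twisted_conj G \<phi>)"
    proof (rule symI)
      fix x y assume "(x, y) \<in> twisted_conj G \<phi>"
      then obtain z where z: "x \<in> carrier G" "y \<in> carrier G" "z \<in> carrier G" "x = z \<otimes> y \<otimes> inv (\<phi> z)"
        unfolding twisted_conj_iff by blast
      then have "y = inv z \<otimes> x \<otimes> inv (\<phi> (inv z))" by (simp add: m_assoc)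
      then show "(y, x) \<in> twisted_conj G \<phi>" using z inv_closed unfolding twisted_conj_iff by blast
    qed
    show "trans (twisted_conj G \<phi>)"
    proof (rule transI)
      fix x y w assume "(x, y) \<in> twisted_conj G \<phi>" "(y, w) \<in> twisted_conj G \<phi>"
      then obtain z v where z: "x \<in> carrier G" "y \<in> carrier G" "z \<in> carrier G" "x = z \<otimes> y \<otimes> inv (\<phi> z)"
        "w \<in> carrier G" "v \<in> carrier G" "y = v \<otimes> w \<otimes> inv (\<phi> v)"
        unfolding twisted_conj_iff by blast
      then have "x = (z \<otimes> v) \<otimes> w \<otimes> inv (\<phi> (z \<otimes> v))" by (simp add: m_assoc inv_mult_group)
      then show "(x, w) \<in> twisted_conj G \<phi>" using z m_closed unfolding twisted_conj_iff by blast
    qed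
  qed
qed

lemma reidemeister_number_transfer:
  assumes "group G" "\<phi> \<in> hom G G" "group G'" "\<phi>' \<in> hom G' G'"
    and "\<And>x. x \<in> carrier G \<Longrightarrow> h x \<in> carrier G'"
    and "\<And>x y. x \<in> carrier G \<Longrightarrow> y \<in> carrier G \<Longrightarrow> (x, y) \<in> twisted_conj G \<phi> \<longleftrightarrow> (h x, h y) \<in> twisted_conj G' \<phi>'"
    and "\<And>b. b \<in> carrier G' \<Longrightarrow> \<exists>a \<in> carrier G. (h a, b) \<in> twisted_conj G' \<phi>'"
  shows "reidemeister_number G \<phi> = reidemeister_number G' \<phi>'"
  unfolding reidemeister_number_ecard
  by (rule quotient_transfer[OF group.equiv_twisted_conj[OF assms(1,2)] group.equiv_twisted_conj[OF assms(3,4)]])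
    (rule assms; assumption)+

lemma reidemeister_number_iso:
  assumes G: "group G" "\<phi> \<in> hom G G" and G': "group G'" "\<phi>' \<in> hom G' G'"
    and h: "h \<in> iso G G'" and comm: "\<And>x. x \<in> carrier G \<Longrightarrow> h (\<phi> x) = \<phi>' (h x)"
  shows "reidemeister_number G \<phi> = reidemeister_number G' \<phi>'"
proof (rule reidemeister_number_transfer[OF G G', of h])
  interpret h: group_hom G G' h using G G' h by (simp add: group_hom_def group_hom_axioms_def iso_def)
  interpret f: group_hom G G \<phi> using G by (simp add: group_hom_def group_hom_axioms_def)
  have surj: "h ` carrier G = carrier G'" and inj: "inj_on h (carrier G)"
    using h by (auto simp: iso_def bij_betw_def)
  show "h x \<in> carrier G'" if "x \<in> carrier G" for x using that by simp
  show "(x, y) \<in> twisted_conj G \<phi> \<longleftrightarrow> (h x, h y) \<in> twisted_conj G' \<phi>'"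
    if x: "x \<in> carrier G" and y: "y \<in> carrier G" for x y
  proof -
    have "h x = h z \<otimes>\<^bsub>G'\<^esub> h y \<otimes>\<^bsub>G'\<^esub> inv\<^bsub>G'\<^esub> (\<phi>' (h z)) \<longleftrightarrow> x = z \<otimes>\<^bsub>G\<^esub> y \<otimes>\<^bsub>G\<^esub> inv\<^bsub>G\<^esub> (\<phi> z)"
      if z: "z \<in> carrier G" for z
    proof -
      have "h z \<otimes>\<^bsub>G'\<^esub> h y \<otimes>\<^bsub>G'\<^esub> inv\<^bsub>G'\<^esub> (\<phi>' (h z)) = h (z \<otimes>\<^bsub>G\<^esub> y \<otimes>\<^bsub>G\<^esub> inv\<^bsub>G\<^esub> (\<phi> z))"
        using z y by (simp add: comm[symmetric])
      then show ?thesis using inj_on_eq_iff[OF inj x, of "z \<otimes>\<^bsub>G\<^esub> y \<otimes>\<^bsub>G\<^esub> inv\<^bsub>G\<^esub> (\<phi> z)"] z y by simp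
    qed
    then show ?thesis unfolding twisted_conj_iff surj[symmetric] using x y by auto
  qed
  show "\<exists>a \<in> carrier G. (h a, b) \<in> twisted_conj G' \<phi>'" if b: "b \<in> carrier G'" for b
  proof -
    obtain a where a: "a \<in> carrier G" "b = h a" using b surj by blast
    have "(b, b) \<in> twisted_conj G' \<phi>'"
      using h.H.equiv_twisted_conj[OF G'(2)] b by (auto simp: equiv_def refl_on_def)
    then show ?thesis using a by blast
  qed
qed

text \<open>A finite set of representatives passes to quotients more easily than finiteness of a set
  of classes; \<open>finite_twisted\<close> names this form.\<close>

lemma finite_reidemeister_iff:
  assumes "group G" "\<phi> \<in> hom G G"
  shows "finite (carrier G // twisted_conj G \<phi>) \<longleftrightarrow>
    (\<exists>F. finite F \<and> F \<subseteq> carrier G \<and> (\<forall>x \<in> carrier G. \<exists>y \<in> F. (x, y) \<in> twisted_conj G \<phi>))"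
proof
  note eq = group.equiv_twisted_conj[OF assms]
  assume fin: "finite (carrier G // twisted_conj G \<phi>)"
  let ?F = "(\<lambda>C. SOME x. x \<in> C) ` (carrier G // twisted_conj G \<phi>)"
  have some: "(SOME x. x \<in> C) \<in> C" if "C \<in> carrier G // twisted_conj G \<phi>" for C
    using in_quotient_imp_non_empty[OF eq that] by (simp add: some_in_eq)
  have sub: "?F \<subseteq> carrier G" using some in_quotient_imp_subset[OF eq] by blast
  have ex: "\<exists>y \<in> ?F. (x, y) \<in> twisted_conj G \<phi>" if "x \<in> carrier G" for x
  proof -
    have "twisted_conj G \<phi> `` {x} \<in> carrier G // twisted_conj G \<phi>" using that by (rule quotientI)
    then show ?thesis using some by blast
  qed
  show "\<exists>F. finite F \<and> F \<subseteq> carrier G \<and> (\<forall>x \<in> carrier G. \<exists>y \<in> F. (x, y) \<in> twisted_conj G \<phi>)"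
    by (rule exI[of _ ?F]) (intro conjI ballI finite_imageI fin sub ex)
next
  note eq = group.equiv_twisted_conj[OF assms]
  assume "\<exists>F. finite F \<and> F \<subseteq> carrier G \<and> (\<forall>x \<in> carrier G. \<exists>y \<in> F. (x, y) \<in> twisted_conj G \<phi>)"
  then obtain F where F: "finite F" "\<And>x. x \<in> carrier G \<Longrightarrow> \<exists>y \<in> F. (x, y) \<in> twisted_conj G \<phi>" by blast
  have "carrier G // twisted_conj G \<phi> \<subseteq> (\<lambda>y. twisted_conj G \<phi> `` {y}) ` F"
  proof
    fix C assume "C \<in> carrier G // twisted_conj G \<phi>"
    then obtain x where x: "x \<in> carrier G" "C = twisted_conj G \<phi> `` {x}" by (auto simp: quotient_def)
    then obtain y where y: "y \<in> F" "(x, y) \<in> twisted_conj G \<phi>" using F by blast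
    then show "C \<in> (\<lambda>y. twisted_conj G \<phi> `` {y}) ` F" using equiv_class_eq[OF eq y(2)] x by blast
  qed
  then show "finite (carrier G // twisted_conj G \<phi>)" using F(1) by (blast intro: finite_subset)
qed

section \<open>Endomorphisms of finite index on abelian groups\<close>

lemma torsion_freeD:
  "torsion_free_group G \<Longrightarrow> x \<in> carrier G \<Longrightarrow> (k::nat) \<ge> 1 \<Longrightarrow> x [^]\<^bsub>G\<^esub> k = \<one>\<^bsub>G\<^esub> \<Longrightarrow> x = \<one>\<^bsub>G\<^esub>"
  unfolding torsion_free_group_def by blast

lemma noetherian_on_subset: "noetherian_on G K \<Longrightarrow> K' \<subseteq> K \<Longrightarrow> noetherian_on G K'"
  unfolding noetherian_on_def by (meson order_trans)

lemma (in group) noetherian_subgroup: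
  assumes "noetherian_group G" "subgroup K G"
  shows "noetherian_group (G\<lparr>carrier := K\<rparr>)"
  unfolding noetherian_on_def
proof (intro allI impI)
  fix A :: "nat \<Rightarrow> 'a set"
  assume "\<forall>n. subgroup (A n) (G\<lparr>carrier := K\<rparr>) \<and> A n \<subseteq> carrier (G\<lparr>carrier := K\<rparr>) \<and> A n \<subseteq> A (Suc n)"
  then have A: "subgroup (A n) (G\<lparr>carrier := K\<rparr>)" "A n \<subseteq> A (Suc n)" for n by simp_all
  have As: "subgroup (A n) G" for n using incl_subgroup[OF assms(2) A(1)] .
  obtain m where "\<And>n. n \<ge> m \<Longrightarrow> A n = A m"
    by (rule noetherian_onD[where A = A, OF assms(1) As subgroup.subset[OF As] A(2)]) blast
  then show "\<exists>m. \<forall>n\<ge>m. A n = A m" by blast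
qed

text \<open>A nontrivial kernel element would have infinitely many powers in \<open>ker D\<close>, which meets the
  image of \<open>D\<^sup>m\<close> trivially as soon as the kernels of the iterates are stable.\<close>

lemma (in comm_group) finite_index_endo_injective:
  assumes noeth: "noetherian_group G" and tf: "torsion_free_group G" and D: "D \<in> hom G G"
    and F: "finite F" "F \<subseteq> carrier G" "\<And>x. x \<in> carrier G \<Longrightarrow> \<exists>f \<in> F. \<exists>y \<in> carrier G. x = f \<otimes> D y"
    and x: "x \<in> carrier G" "D x = \<one>"
  shows "x = \<one>"
proof -
  interpret D: group_hom G G D using D by unfold_locales
  have Dn: "D ^^ n \<in> hom G G" for n
  proof (induction n)
    case (Suc n)
    then show ?case using Group.hom_compose[OF Suc D] by (simp add: comp_def)
  qed (auto simp: hom_def)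
  have ghn: "group_hom G G (D ^^ n)" for n using Dn by unfold_locales
  define K where "K n = kernel G G (D ^^ n)" for n
  obtain m where m: "\<And>n. n \<ge> m \<Longrightarrow> K n = K m"
  proof (rule noetherian_onD[OF noeth])
    show "subgroup (K n) G" for n unfolding K_def by (rule group_hom.subgroup_kernel[OF ghn])
    show "K n \<subseteq> carrier G" "K n \<subseteq> K (Suc n)" for n by (auto simp: K_def kernel_def)
  qed blast
  \<comment> \<open>The image of every iterate still has finite index: the representatives for
    \<open>D\<close> are pushed through \<open>D ^^ n\<close> and multiplied with those for
    \<open>D ^^ n\<close>.\<close>
  have "\<exists>F'. finite F' \<and> (\<forall>x \<in> carrier G. \<exists>f \<in> F'. f \<in> carrier G \<and> (\<exists>y \<in> carrier G. x = f \<otimes> (D ^^ n) y))" for n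
  proof (induction n)
    case 0
    have "\<forall>x \<in> carrier G. \<exists>f \<in> {\<one>}. f \<in> carrier G \<and> (\<exists>y \<in> carrier G. x = f \<otimes> (D ^^ 0) y)" by simp
    then show ?case by blast
  next
    case (Suc n)
    then obtain F' where F': "finite F'" "\<And>x. x \<in> carrier G \<Longrightarrow> \<exists>f \<in> F'. f \<in> carrier G \<and> (\<exists>y \<in> carrier G. x = f \<otimes> (D ^^ n) y)"
      by blast
    interpret Dn: group_hom G G "D ^^ n" by (rule ghn)
    let ?F = "(\<lambda>(f, g). f \<otimes> (D ^^ n) g) ` (F' \<times> F)"
    have "\<exists>f \<in> ?F. f \<in> carrier G \<and> (\<exists>y \<in> carrier G. x = f \<otimes> (D ^^ Suc n) y)" if x: "x \<in> carrier G" for x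
    proof -
      obtain f y where f: "f \<in> F'" "f \<in> carrier G" "y \<in> carrier G" "x = f \<otimes> (D ^^ n) y" using F'(2)[OF x] by blast
      obtain g w where g: "g \<in> F" "w \<in> carrier G" "y = g \<otimes> D w" using F(3)[OF f(3)] by blast
      have gc: "g \<in> carrier G" using g F by blast
      have "x = (f \<otimes> (D ^^ n) g) \<otimes> (D ^^ Suc n) w"
        using f g gc by (simp add: m_assoc funpow_swap1)
      moreover have "f \<otimes> (D ^^ n) g \<in> carrier G" using f gc by simp
      moreover have "f \<otimes> (D ^^ n) g \<in> ?F"
        by (rule image_eqI[of _ _ "(f, g)"]) (use f g in auto)
      ultimately show ?thesis using g(2) by (intro bexI[of _ "f \<otimes> (D ^^ n) g"]) auto
    qed
    moreover have "finite ?F" using F' F by blast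
    ultimately show ?case by blast
  qed
  from this[of m] obtain F' where F': "finite F'"
    "\<And>x. x \<in> carrier G \<Longrightarrow> \<exists>f \<in> F'. f \<in> carrier G \<and> (\<exists>y \<in> carrier G. x = f \<otimes> (D ^^ m) y)" by blast
  interpret Dm: group_hom G G "D ^^ m" by (rule ghn)
  have "\<forall>i::nat. \<exists>f. f \<in> F' \<and> f \<in> carrier G \<and> (\<exists>y \<in> carrier G. x [^] i = f \<otimes> (D ^^ m) y)"
    using F'(2) x by blast
  then obtain f where f: "\<And>i::nat. f i \<in> F'" "\<And>i. f i \<in> carrier G"
    "\<And>i. \<exists>y \<in> carrier G. x [^] i = f i \<otimes> (D ^^ m) y" by metis
  \<comment> \<open>Pigeonhole: two powers of \<open>x\<close> share a representative, so their
    quotient lies in the image of \<open>D ^^ m\<close>.\<close>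
  have "\<not> inj f" using F'(1) f(1) finite_imageD[of f UNIV] by (meson finite_subset image_subsetI infinite_UNIV_nat)
  then obtain i j where ij: "i < j" "f i = f j" by (metis injI linorder_neqE_nat)
  obtain u v where u: "u \<in> carrier G" "x [^] i = f i \<otimes> (D ^^ m) u" and v: "v \<in> carrier G" "x [^] j = f i \<otimes> (D ^^ m) v"
    using f(3) ij by metis
  let ?w = "v \<otimes> inv u"
  have "x [^] j = x [^] i \<otimes> x [^] (j - i)" using x ij by (simp add: nat_pow_mult)
  then have "x [^] (j - i) = inv (x [^] i) \<otimes> x [^] j" using x by simp
  also have "\<dots> = inv ((D ^^ m) u) \<otimes> (D ^^ m) v" using u v f(2)[of i] by (simp add: inv_mult_group m_assoc)
  also have "\<dots> = (D ^^ m) ?w" using u v by (simp add: m_comm)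
  finally have w: "x [^] (j - i) = (D ^^ m) ?w" .
  \<comment> \<open>Since \<open>x\<close> is killed by \<open>D\<close>, the element
    \<open>?w\<close> lies in the kernel of \<open>D ^^ Suc m\<close>, which equals that of
    \<open>D ^^ m\<close>.\<close>
  have "D (x [^] (j - i)) = \<one>" using x by (simp add: D.hom_nat_pow)
  then have "?w \<in> K (Suc m)" using w u v by (simp add: K_def kernel_def)
  then have "?w \<in> K m" using m[of "Suc m"] by simp
  then have "x [^] (j - i) = \<one>" using w by (simp add: K_def kernel_def)
  then show ?thesis using torsion_freeD[OF tf x(1), of "j - i"] ij by simp
qed

section \<open>The quotient by the center\<close>

lemma central_quotient:
  fixes G :: "'a monoid"
  assumes "group G"
  obtains Q :: "'a monoid" and p where "group_hom G Q p" "p ` carrier G = carrier Q"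
    "\<And>x. x \<in> carrier G \<Longrightarrow> p x = \<one>\<^bsub>Q\<^esub> \<longleftrightarrow> x \<in> center G"
    "\<And>c. lower_central G (Suc c) = {\<one>\<^bsub>G\<^esub>} \<Longrightarrow> lower_central Q c = {\<one>\<^bsub>Q\<^esub>}"
proof -
  interpret group G by fact
  interpret Z: normal "center G" G using normal_central[OF subgroup_center] by blast
  obtain Q :: "'a monoid" and p where Q: "group_hom G Q p" "p ` carrier G = carrier Q"
    "\<And>x. x \<in> carrier G \<Longrightarrow> p x = \<one>\<^bsub>Q\<^esub> \<longleftrightarrow> x \<in> center G"
    using Z.quotient_on_same_type by blast
  interpret p: group_hom G Q p by fact
  have "lower_central Q c = {\<one>\<^bsub>Q\<^esub>}" if c: "lower_central G (Suc c) = {\<one>\<^bsub>G\<^esub>}" for c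
  proof -
    have "p x = \<one>\<^bsub>Q\<^esub>" if "x \<in> lower_central G c" for x
      using Q(3) lower_central_central[OF c] center_closed that by blast
    then have "lower_central Q c \<subseteq> {\<one>\<^bsub>Q\<^esub>}" unfolding p.lower_central_epi[OF Q(2)] by blast
    then show ?thesis using subgroup.one_closed[OF p.H.subgroup_lower_central] by blast
  qed
  with Q show thesis using that by blast
qed

text \<open>If \<open>p x\<close> is central and has trivial \<open>k\<close>-th power, then every
  \<open>commutator G x y\<close> is central, and its \<open>k\<close>-th power is the commutator of
  the central element \<open>x [^] k\<close> with \<open>y\<close>. Assumption and conclusion both
  speak about torsion in the center, so the lemma can be iterated.\<close>

lemma central_quotient_center_torsion_free:
  assumes "group_hom G Q p" "p ` carrier G = carrier Q"
    "\<And>x. x \<in> carrier G \<Longrightarrow> p x = \<one>\<^bsub>Q\<^esub> \<longleftrightarrow> x \<in> center G"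
    and tf: "\<And>z k. z \<in> center G \<Longrightarrow> (k::nat) \<ge> 1 \<Longrightarrow> z [^]\<^bsub>G\<^esub> k = \<one>\<^bsub>G\<^esub> \<Longrightarrow> z = \<one>\<^bsub>G\<^esub>"
    and w: "w \<in> center Q" "(k::nat) \<ge> 1" "w [^]\<^bsub>Q\<^esub> k = \<one>\<^bsub>Q\<^esub>"
  shows "w = \<one>\<^bsub>Q\<^esub>"
proof -
  interpret p: group_hom G Q p by fact
  have "w \<in> carrier Q" using w(1) p.H.center_closed by blast
  then obtain x where x: "x \<in> carrier G" "w = p x" using assms(2) by blast
  have xk: "x [^]\<^bsub>G\<^esub> k \<in> center G" using assms(3)[of "x [^]\<^bsub>G\<^esub> k"] x w(3) by (simp add: p.hom_nat_pow)
  have "x \<otimes>\<^bsub>G\<^esub> y = y \<otimes>\<^bsub>G\<^esub> x" if y: "y \<in> carrier G" for y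
  proof -
    have "commutator Q (p x) (p y) = \<one>\<^bsub>Q\<^esub>"
      using p.H.center_commute[OF w(1), of "p y"] x y by (simp add: p.H.commutator_one_iff)
    then have c: "commutator G x y \<in> center G"
      using assms(3)[of "commutator G x y"] x y by (simp add: p.hom_commutator)
    have "commutator G x y [^]\<^bsub>G\<^esub> k = commutator G (x [^]\<^bsub>G\<^esub> k) y"
      using p.G.commutator_pow_left[OF x(1) y c] by simp
    also have "\<dots> = \<one>\<^bsub>G\<^esub>"
      using p.G.center_commute[OF xk y] x y by (simp add: p.G.commutator_one_iff)
    finally have "commutator G x y = \<one>\<^bsub>G\<^esub>" by (rule tf[OF c w(2)])
    then show ?thesis using x y by (simp add: p.G.commutator_one_iff)
  qed
  then have "x \<in> center G" using x by (simp add: center_def)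
  then show ?thesis using assms(3) x by blast
qed

text \<open>Climbs the upper central series: a torsion element becomes trivial in the quotient,
  hence is central, and the center has no torsion.\<close>

lemma nilpotent_center_torsion_free:
  fixes G :: "'a monoid"
  assumes "group G" "lower_central G c = {\<one>\<^bsub>G\<^esub>}"
    "\<And>z k. z \<in> center G \<Longrightarrow> (k::nat) \<ge> 1 \<Longrightarrow> z [^]\<^bsub>G\<^esub> k = \<one>\<^bsub>G\<^esub> \<Longrightarrow> z = \<one>\<^bsub>G\<^esub>"
  shows "torsion_free_group G"
  using assms
proof (induction c arbitrary: G)
  case 0
  then show ?case by (auto simp: torsion_free_group_def)
next
  case (Suc c)
  obtain Q :: "'a monoid" and p where Q: "group_hom G Q p" "p ` carrier G = carrier Q"
    "\<And>x. x \<in> carrier G \<Longrightarrow> p x = \<one>\<^bsub>Q\<^esub> \<longleftrightarrow> x \<in> center G"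
    "\<And>c. lower_central G (Suc c) = {\<one>\<^bsub>G\<^esub>} \<Longrightarrow> lower_central Q c = {\<one>\<^bsub>Q\<^esub>}"
    using central_quotient[OF Suc.prems(1)] by blast
  interpret p: group_hom G Q p by fact
  have tfQ: "torsion_free_group Q"
    by (rule Suc.IH[OF p.H.is_group Q(4)[OF Suc.prems(2)]])
      (rule central_quotient_center_torsion_free[OF Q(1-3) Suc.prems(3)])
  show ?case unfolding torsion_free_group_def
  proof (intro conjI ballI allI impI p.G.is_group)
    fix x and n :: nat assume x: "x \<in> carrier G" "n \<ge> 1" "x [^]\<^bsub>G\<^esub> n = \<one>\<^bsub>G\<^esub>"
    have "p x [^]\<^bsub>Q\<^esub> n = \<one>\<^bsub>Q\<^esub>" using p.hom_nat_pow[OF x(1), of n] x(3) by simp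
    then have "p x = \<one>\<^bsub>Q\<^esub>" using torsion_freeD[OF tfQ _ x(2)] x(1) by simp
    then have "x \<in> center G" using Q(3) x by blast
    then show "x = \<one>\<^bsub>G\<^esub>" using Suc.prems(3) x by blast
  qed
qed

lemma central_quotient_torsion_free:
  fixes G Q :: "'a monoid"
  assumes Q: "group_hom G Q p" "p ` carrier G = carrier Q"
    "\<And>x. x \<in> carrier G \<Longrightarrow> p x = \<one>\<^bsub>Q\<^esub> \<longleftrightarrow> x \<in> center G"
    and tf: "torsion_free_group G" and nil: "lower_central Q c = {\<one>\<^bsub>Q\<^esub>}"
  shows "torsion_free_group Q"
proof -
  interpret p: group_hom G Q p by fact
  have tfz: "z = \<one>\<^bsub>G\<^esub>" if "z \<in> center G" "(k::nat) \<ge> 1" "z [^]\<^bsub>G\<^esub> k = \<one>\<^bsub>G\<^esub>" for z k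
    using torsion_freeD[OF tf p.G.center_closed[OF that(1)] that(2,3)] .
  show ?thesis
    by (rule nilpotent_center_torsion_free[OF p.H.is_group nil])
      (rule central_quotient_center_torsion_free[OF Q tfz])
qed

text \<open>\<open>\<phi>\<close> maps the center onto itself, which makes the induced map both well
  defined and injective.\<close>

lemma central_quotient_induced_iso:
  assumes Q: "group_hom G Q p" "p ` carrier G = carrier Q"
    "\<And>x. x \<in> carrier G \<Longrightarrow> p x = \<one>\<^bsub>Q\<^esub> \<longleftrightarrow> x \<in> center G"
    and \<phi>: "\<phi> \<in> iso G G"
  obtains \<phi>' where "\<phi>' \<in> iso Q Q" "\<And>x. x \<in> carrier G \<Longrightarrow> \<phi>' (p x) = p (\<phi> x)"
proof -
  interpret p: group_hom G Q p by fact
  interpret \<phi>: group_hom G G \<phi> using \<phi> by unfold_locales (simp add: iso_def)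
  have \<phi>Z: "\<phi> ` center G = center G" by (rule \<phi>.iso_center[OF \<phi>])
  have \<phi>surj: "\<phi> ` carrier G = carrier G" and \<phi>inj: "inj_on \<phi> (carrier G)"
    using \<phi> by (auto simp: iso_def bij_betw_def)
  define \<phi>' where "\<phi>' y = p (\<phi> (inv_into (carrier G) p y))" for y
  have eq: "\<phi>' (p x) = p (\<phi> x)" if x: "x \<in> carrier G" for x
  proof -
    define x' where "x' = inv_into (carrier G) p (p x)"
    have x': "x' \<in> carrier G" "p x' = p x"
      unfolding x'_def using x by (auto intro: inv_into_into f_inv_into_f)
    then have "p (x' \<otimes>\<^bsub>G\<^esub> inv\<^bsub>G\<^esub> x) = \<one>\<^bsub>Q\<^esub>" using p.hom_eq_iff[of x' x] x by blast
    then have "x' \<otimes>\<^bsub>G\<^esub> inv\<^bsub>G\<^esub> x \<in> center G" using Q(3)[of "x' \<otimes>\<^bsub>G\<^esub> inv\<^bsub>G\<^esub> x"] x x' by blast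
    then have c: "\<phi> (x' \<otimes>\<^bsub>G\<^esub> inv\<^bsub>G\<^esub> x) \<in> center G" using \<phi>Z by blast
    then have "p (\<phi> (x' \<otimes>\<^bsub>G\<^esub> inv\<^bsub>G\<^esub> x)) = \<one>\<^bsub>Q\<^esub>" using Q(3)[OF p.G.center_closed[OF c]] by blast
    then have "p (\<phi> x' \<otimes>\<^bsub>G\<^esub> inv\<^bsub>G\<^esub> \<phi> x) = \<one>\<^bsub>Q\<^esub>" using x x' by simp
    then have "p (\<phi> x') = p (\<phi> x)" using p.hom_eq_iff[of "\<phi> x'" "\<phi> x"] x x' by simp
    then show ?thesis unfolding \<phi>'_def x'_def .
  qed
  have hom: "\<phi>' \<in> hom Q Q"
  proof (rule homI)
    fix y w assume "y \<in> carrier Q" "w \<in> carrier Q"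
    then obtain u v where "u \<in> carrier G" "y = p u" "v \<in> carrier G" "w = p v" using Q(2) by blast
    then show "\<phi>' (y \<otimes>\<^bsub>Q\<^esub> w) = \<phi>' y \<otimes>\<^bsub>Q\<^esub> \<phi>' w"
      using eq[of "u \<otimes>\<^bsub>G\<^esub> v"] by (simp add: eq)
  next
    fix y assume "y \<in> carrier Q"
    then obtain u where "u \<in> carrier G" "y = p u" using Q(2) by blast
    then show "\<phi>' y \<in> carrier Q" by (simp add: eq)
  qed
  interpret \<phi>': group_hom Q Q \<phi>' using hom by unfold_locales
  have "carrier Q \<subseteq> \<phi>' ` carrier Q"
  proof
    fix y assume "y \<in> carrier Q"
    then obtain u where u: "u \<in> carrier G" "y = p u" using Q(2) by blast
    then obtain v where v: "v \<in> carrier G" "u = \<phi> v" using \<phi>surj by blast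
    have "y = \<phi>' (p v)" using u v eq by simp
    then show "y \<in> \<phi>' ` carrier Q" using v by simp
  qed
  moreover have "y = \<one>\<^bsub>Q\<^esub>" if y: "y \<in> carrier Q" "\<phi>' y = \<one>\<^bsub>Q\<^esub>" for y
  proof -
    obtain u where u: "u \<in> carrier G" "y = p u" using Q(2) y by blast
    then have "\<phi> u \<in> center G" using eq y Q(3)[of "\<phi> u"] by simp
    then obtain z where z: "z \<in> center G" "\<phi> u = \<phi> z" using \<phi>Z by blast
    then have "u = z" using \<phi>inj u p.G.center_closed by (auto dest: inj_onD)
    then show ?thesis using Q(3) u z by blast
  qed
  ultimately have "\<phi>' \<in> iso Q Q" by (simp add: \<phi>'.iso_iff)
  then show thesis using that eq by blast
qed

section \<open>Finite Reidemeister numbers exclude fixed points\<close>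

definition finite_twisted :: "('a, 'm) monoid_scheme \<Rightarrow> ('a \<Rightarrow> 'a) \<Rightarrow> bool" where
  "finite_twisted G \<phi> \<longleftrightarrow>
     (\<exists>F. finite F \<and> F \<subseteq> carrier G \<and> (\<forall>x \<in> carrier G. \<exists>y \<in> F. (x, y) \<in> twisted_conj G \<phi>))"

lemma finite_twisted_quotient:
  assumes Q: "group_hom G Q p" "p ` carrier G = carrier Q" and \<phi>: "\<phi> \<in> carrier G \<rightarrow> carrier G"
    and eq: "\<And>x. x \<in> carrier G \<Longrightarrow> \<phi>' (p x) = p (\<phi> x)" and fin: "finite_twisted G \<phi>"
  shows "finite_twisted Q \<phi>'"
proof -
  interpret p: group_hom G Q p by fact
  have \<phi>c: "\<phi> x \<in> carrier G" if "x \<in> carrier G" for x using funcset_mem[OF \<phi> that] .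
  obtain F where F: "finite F" "F \<subseteq> carrier G" "\<And>x. x \<in> carrier G \<Longrightarrow> \<exists>y \<in> F. (x, y) \<in> twisted_conj G \<phi>"
    using fin unfolding finite_twisted_def by blast
  have "\<exists>y \<in> p ` F. (x, y) \<in> twisted_conj Q \<phi>'" if "x \<in> carrier Q" for x
  proof -
    have "x \<in> p ` carrier G" using that Q(2) by simp
    then obtain u where u: "u \<in> carrier G" "x = p u" by blast
    obtain y where y: "y \<in> F" "(u, y) \<in> twisted_conj G \<phi>" using F(3)[OF u(1)] by blast
    then obtain z where z: "z \<in> carrier G" "y \<in> carrier G" "u = z \<otimes>\<^bsub>G\<^esub> y \<otimes>\<^bsub>G\<^esub> inv\<^bsub>G\<^esub> (\<phi> z)"
      unfolding twisted_conj_iff by blast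
    then have "x = p z \<otimes>\<^bsub>Q\<^esub> p y \<otimes>\<^bsub>Q\<^esub> inv\<^bsub>Q\<^esub> (\<phi>' (p z))" using u \<phi>c by (simp add: eq)
    moreover have "p y \<in> carrier Q" "p z \<in> carrier Q" using z by auto
    ultimately have "(x, p y) \<in> twisted_conj Q \<phi>'" unfolding twisted_conj_iff using that by blast
    then show ?thesis using y(1) by (intro bexI[of _ "p y"]) auto
  qed
  moreover have "finite (p ` F)" "p ` F \<subseteq> carrier Q" using F by auto
  ultimately show ?thesis unfolding finite_twisted_def by blast
qed

text \<open>Induction along the quotient by the center. The induced map has no nontrivial fixed
  points, so a fixed \<open>x\<close> is central, and central elements can only be twisted conjugate
  by central elements. Hence the map \<open>D\<close> with
  \<open>D z = z \<otimes> inv (\<phi> z)\<close> has an image of finite index in the center and is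
  injective there, while \<open>x\<close> lies in its kernel.\<close>

lemma finite_twisted_fixed_point:
  fixes G :: "'a monoid"
  assumes "group G" "noetherian_group G" "torsion_free_group G" "lower_central G c = {\<one>\<^bsub>G\<^esub>}"
    "\<phi> \<in> iso G G" "finite_twisted G \<phi>" "x \<in> carrier G" "\<phi> x = x"
  shows "x = \<one>\<^bsub>G\<^esub>"
  using assms
proof (induction c arbitrary: G \<phi> x)
  case 0
  then show ?case by simp
next
  case (Suc c)
  obtain Q :: "'a monoid" and p where Q: "group_hom G Q p" "p ` carrier G = carrier Q"
    "\<And>x. x \<in> carrier G \<Longrightarrow> p x = \<one>\<^bsub>Q\<^esub> \<longleftrightarrow> x \<in> center G"
    "\<And>c. lower_central G (Suc c) = {\<one>\<^bsub>G\<^esub>} \<Longrightarrow> lower_central Q c = {\<one>\<^bsub>Q\<^esub>}"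
    using central_quotient[OF Suc.prems(1)] by blast
  interpret p: group_hom G Q p by fact
  interpret \<phi>: group_hom G G \<phi> using Suc.prems(5) by unfold_locales (simp add: iso_def)
  obtain \<phi>' where \<phi>': "\<phi>' \<in> iso Q Q" "\<And>x. x \<in> carrier G \<Longrightarrow> \<phi>' (p x) = p (\<phi> x)"
    using central_quotient_induced_iso[OF Q(1-3) Suc.prems(5)] by blast
  note nilQ = Q(4)[OF Suc.prems(4)]
  have finQ: "finite_twisted Q \<phi>'"
    by (rule finite_twisted_quotient[OF Q(1,2) _ \<phi>'(2) Suc.prems(6)]) auto
  have fixQ: "w = \<one>\<^bsub>Q\<^esub>" if "w \<in> carrier Q" "\<phi>' w = w" for w
    using Suc.IH[OF p.H.is_group p.noetherian_epi[OF Suc.prems(2) Q(2)]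
        central_quotient_torsion_free[OF Q(1-3) Suc.prems(3) nilQ] nilQ \<phi>'(1) finQ that] .
  have fixZ: "n \<in> center G" if n: "n \<in> carrier G" "p (\<phi> n) = p n" for n
    using fixQ[of "p n"] n \<phi>'(2) Q(3) by simp
  have \<phi>Z: "\<phi> z \<in> center G" if "z \<in> center G" for z using \<phi>.iso_center[OF Suc.prems(5)] that by blast
  obtain F where F: "finite F" "F \<subseteq> carrier G" "\<And>x. x \<in> carrier G \<Longrightarrow> \<exists>y \<in> F. (x, y) \<in> twisted_conj G \<phi>"
    using Suc.prems(6) unfolding finite_twisted_def by blast
  let ?Z = "G\<lparr>carrier := center G\<rparr>"
  interpret Z: group ?Z by (rule p.G.subgroup_imp_group[OF p.G.subgroup_center])
  have zc: "z \<in> carrier G" if "z \<in> center G" for z using that p.G.center_closed by blast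
  interpret Z: comm_group ?Z
    by (rule Z.group_comm_groupI) (simp add: p.G.center_commute zc)
  define D where "D z = z \<otimes>\<^bsub>G\<^esub> inv\<^bsub>G\<^esub> (\<phi> z)" for z
  have Zs: "subgroup (center G) G" by (rule p.G.subgroup_center)
  have Dz: "D z \<in> center G" if "z \<in> center G" for z
    unfolding D_def using that \<phi>Z subgroup.m_closed[OF Zs] subgroup.m_inv_closed[OF Zs] by blast
  have "D (z \<otimes>\<^bsub>G\<^esub> w) = D z \<otimes>\<^bsub>G\<^esub> D w" if z: "z \<in> center G" and w: "w \<in> center G" for z w
  proof -
    have "D (z \<otimes>\<^bsub>G\<^esub> w) = z \<otimes>\<^bsub>G\<^esub> (D w \<otimes>\<^bsub>G\<^esub> inv\<^bsub>G\<^esub> \<phi> z)"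
      unfolding D_def using zc[OF z] zc[OF w] by (simp add: p.G.m_assoc p.G.inv_mult_group)
    also have "\<dots> = z \<otimes>\<^bsub>G\<^esub> (inv\<^bsub>G\<^esub> \<phi> z \<otimes>\<^bsub>G\<^esub> D w)"
      using p.G.center_commute[OF Dz[OF w], of "inv\<^bsub>G\<^esub> \<phi> z"] zc[OF z] by simp
    also have "\<dots> = D z \<otimes>\<^bsub>G\<^esub> D w" using zc[OF z] zc[OF Dz[OF w]] by (simp add: D_def[of z] p.G.m_assoc)
    finally show ?thesis .
  qed
  then have Dhom: "D \<in> hom ?Z ?Z" using Dz by (auto intro!: homI)
  \<comment> \<open>The given representatives may lie outside the center; each one that is twisted
    conjugate to a central element is replaced by such an element.\<close>
  define rep where "rep f = (SOME z. z \<in> center G \<and> (z, f) \<in> twisted_conj G \<phi>)" for f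
  let ?F = "rep ` {f \<in> F. \<exists>z \<in> center G. (z, f) \<in> twisted_conj G \<phi>}"
  have rep: "rep f \<in> center G" "(rep f, f) \<in> twisted_conj G \<phi>"
    if "z \<in> center G" "(z, f) \<in> twisted_conj G \<phi>" for z f
    using someI[of "\<lambda>z. z \<in> center G \<and> (z, f) \<in> twisted_conj G \<phi>"] that unfolding rep_def by blast+
  have tfZ: "torsion_free_group ?Z"
    unfolding torsion_free_group_def
  proof (intro conjI ballI allI impI Z.is_group)
    fix z and n :: nat assume "z \<in> carrier ?Z" "n \<ge> 1" "z [^]\<^bsub>?Z\<^esub> n = \<one>\<^bsub>?Z\<^esub>"
    then have "z \<in> carrier G" "n \<ge> 1" "z [^]\<^bsub>G\<^esub> n = \<one>\<^bsub>G\<^esub>"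
      using zc by (simp_all flip: p.G.nat_pow_consistent)
    then show "z = \<one>\<^bsub>?Z\<^esub>" using torsion_freeD[OF Suc.prems(3)] by simp
  qed
  have cover: "\<exists>f \<in> ?F. \<exists>y \<in> carrier ?Z. z = f \<otimes>\<^bsub>?Z\<^esub> D y" if z: "z \<in> carrier ?Z" for z
  proof -
    have z: "z \<in> center G" using z by simp
    obtain f where f: "f \<in> F" "(z, f) \<in> twisted_conj G \<phi>" using F(3)[OF zc[OF z]] by blast
    have "(z, rep f) \<in> twisted_conj G \<phi>"
      using p.G.equiv_twisted_conj[OF \<phi>.homh] f(2) rep(2)[OF z f(2)]
      unfolding equiv_def by (blast dest: symD transD)
    then obtain n where n: "n \<in> carrier G" "z = n \<otimes>\<^bsub>G\<^esub> rep f \<otimes>\<^bsub>G\<^esub> inv\<^bsub>G\<^esub> (\<phi> n)"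
      unfolding twisted_conj_iff by blast
    have r: "rep f \<in> center G" "rep f \<in> carrier G" using rep(1)[OF z f(2)] zc by auto
    have "p z = \<one>\<^bsub>Q\<^esub>" "p (rep f) = \<one>\<^bsub>Q\<^esub>" using Q(3)[OF zc[OF z]] Q(3)[OF r(2)] z r by auto
    moreover have "p z = p n \<otimes>\<^bsub>Q\<^esub> p (rep f) \<otimes>\<^bsub>Q\<^esub> inv\<^bsub>Q\<^esub> (p (\<phi> n))"
      unfolding n(2) using n(1) r by simp
    ultimately have "\<one>\<^bsub>Q\<^esub> = p n \<otimes>\<^bsub>Q\<^esub> inv\<^bsub>Q\<^esub> (p (\<phi> n))" using n(1) by simp
    \<comment> \<open>Both central elements become trivial in the quotient, so what remains says
      that \<open>p n\<close> is fixed by the induced map.\<close>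
    then have "p (\<phi> n) = p n" using n by (metis \<phi>.hom_closed p.H.inv_equality p.H.inv_inv p.H.inv_closed p.hom_closed)
    then have nZ: "n \<in> center G" using fixZ n by blast
    have "z = rep f \<otimes>\<^bsub>G\<^esub> D n"
      using n r p.G.center_commute[OF nZ r(2)] by (simp add: D_def p.G.m_assoc)
    then show ?thesis using nZ f z by auto
  qed
  have "noetherian_group ?Z" using p.G.noetherian_subgroup[OF Suc.prems(2) Zs] .
  moreover have "finite ?F" using F by simp
  moreover have "?F \<subseteq> carrier ?Z" using rep by auto
  moreover have "x \<in> carrier ?Z" using fixZ Suc.prems by simp
  moreover have "D x = \<one>\<^bsub>?Z\<^esub>" using Suc.prems by (simp add: D_def)
  ultimately have "x = \<one>\<^bsub>?Z\<^esub>"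
    using Z.finite_index_endo_injective[of D ?F x] tfZ Dhom cover by blast
  then show ?case by simp
qed

text \<open>Since twisted conjugation in the quotient has no stabilisers, two representatives modulo the
  center can only be twisted conjugate via a central element, on which both maps agree.\<close>

lemma reidemeister_number_eq_mod_center:
  fixes G :: "'a monoid"
  assumes G: "group G" "noetherian_group G" "torsion_free_group G" "nilpotent_group G"
    and \<phi>: "\<phi> \<in> iso G G" and \<psi>: "\<psi> \<in> iso G G"
    and agree: "\<And>z. z \<in> center G \<Longrightarrow> \<phi> z = \<psi> z"
    and mod: "\<And>x. x \<in> carrier G \<Longrightarrow> \<exists>c \<in> center G. \<phi> x = \<psi> x \<otimes>\<^bsub>G\<^esub> c"
  shows "reidemeister_number G \<phi> = reidemeister_number G \<psi>"
proof -
  obtain c where c: "lower_central G c = {\<one>\<^bsub>G\<^esub>}" using G(4) by (auto simp: nilpotent_group_def)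
  interpret G: group G by (rule G(1))
  have "lower_central G (Suc c) = {\<one>\<^bsub>G\<^esub>}" using G.lower_central_trivial_add[OF c, of 1] by simp
  then obtain Q :: "'a monoid" and p where Q: "group_hom G Q p" "p ` carrier G = carrier Q"
    "\<And>x. x \<in> carrier G \<Longrightarrow> p x = \<one>\<^bsub>Q\<^esub> \<longleftrightarrow> x \<in> center G"
    and nilQ: "lower_central Q c = {\<one>\<^bsub>Q\<^esub>}"
    using central_quotient[OF G(1)] by metis
  interpret p: group_hom G Q p by fact
  interpret \<phi>: group_hom G G \<phi> using \<phi> by unfold_locales (simp add: iso_def)
  interpret \<psi>: group_hom G G \<psi> using \<psi> by unfold_locales (simp add: iso_def)
  obtain \<phi>' where \<phi>': "\<phi>' \<in> iso Q Q" "\<And>x. x \<in> carrier G \<Longrightarrow> \<phi>' (p x) = p (\<phi> x)"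
    using central_quotient_induced_iso[OF Q \<phi>] by blast
  have p\<psi>: "p (\<phi> x) = p (\<psi> x)" if x: "x \<in> carrier G" for x
  proof -
    obtain z where z: "z \<in> center G" "\<phi> x = \<psi> x \<otimes>\<^bsub>G\<^esub> z" using mod[OF x] by blast
    then show ?thesis using Q(3)[of z] G.center_closed[OF z(1)] x by simp
  qed
  have \<phi>'\<psi>: "\<phi>' (p x) = p (\<psi> x)" if "x \<in> carrier G" for x using \<phi>'(2) p\<psi> that by simp
  interpret \<phi>': group_hom Q Q \<phi>' using \<phi>' by unfold_locales (simp add: iso_def)
  show ?thesis
  proof (cases "finite_twisted Q \<phi>'")
    case False
    \<comment> \<open>With infinitely many classes in the quotient both numbers are infinite, and
      nothing has to be counted.\<close>
    have "\<not> finite_twisted G \<phi>" using finite_twisted_quotient[where \<phi> = \<phi> and \<phi>' = \<phi>', OF Q(1,2) _ \<phi>'(2)] False by auto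
    moreover have "\<not> finite_twisted G \<psi>" using finite_twisted_quotient[where \<phi> = \<psi> and \<phi>' = \<phi>', OF Q(1,2) _ \<phi>'\<psi>] False by auto
    ultimately show ?thesis
      using finite_reidemeister_iff[OF G(1) \<phi>.homh] finite_reidemeister_iff[OF G(1) \<psi>.homh]
      unfolding finite_twisted_def reidemeister_number_ecard ecard_def by simp
  next
    case True
    have stab: "n = \<one>\<^bsub>Q\<^esub>"
      if x: "x \<in> carrier Q" and n: "n \<in> carrier Q" and eq: "x = n \<otimes>\<^bsub>Q\<^esub> x \<otimes>\<^bsub>Q\<^esub> inv\<^bsub>Q\<^esub> (\<phi>' n)" for x n
    proof -
      \<comment> \<open>\<open>\<phi>'\<close> followed by conjugation with \<open>x\<close>. Its
        fixed points form the stabiliser of \<open>x\<close> under twisted conjugation.\<close>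
      define \<tau> where "\<tau> g = x \<otimes>\<^bsub>Q\<^esub> \<phi>' g \<otimes>\<^bsub>Q\<^esub> inv\<^bsub>Q\<^esub> x" for g
      have hom\<tau>: "\<tau> \<in> hom Q Q" unfolding \<tau>_def using x by (intro homI) (auto simp: p.H.m_assoc)
      interpret \<tau>: group_hom Q Q \<tau> using hom\<tau> by unfold_locales
      have "carrier Q \<subseteq> \<tau> ` carrier Q"
      proof
        fix y assume y: "y \<in> carrier Q"
        then have "inv\<^bsub>Q\<^esub> x \<otimes>\<^bsub>Q\<^esub> y \<otimes>\<^bsub>Q\<^esub> x \<in> \<phi>' ` carrier Q"
          using \<phi>'(1) x by (simp add: iso_def bij_betw_def)
        then obtain w where w: "w \<in> carrier Q" "\<phi>' w = inv\<^bsub>Q\<^esub> x \<otimes>\<^bsub>Q\<^esub> y \<otimes>\<^bsub>Q\<^esub> x" by force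
        then have "\<tau> w = y" using x y by (simp add: \<tau>_def p.H.m_assoc)
        then show "y \<in> \<tau> ` carrier Q" using w by blast
      qed
      moreover have "g = \<one>\<^bsub>Q\<^esub>" if g: "g \<in> carrier Q" "\<tau> g = \<one>\<^bsub>Q\<^esub>" for g
      proof -
        have "x \<otimes>\<^bsub>Q\<^esub> \<phi>' g = \<one>\<^bsub>Q\<^esub> \<otimes>\<^bsub>Q\<^esub> x"
          using g x p.H.inv_solve_right[of "\<one>\<^bsub>Q\<^esub>" "x \<otimes>\<^bsub>Q\<^esub> \<phi>' g" x] by (simp add: \<tau>_def)
        then have "\<phi>' g = \<phi>' \<one>\<^bsub>Q\<^esub>" using x g by simp
        moreover have "inj_on \<phi>' (carrier Q)" using \<phi>'(1) by (simp add: iso_def bij_betw_def)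
        ultimately show ?thesis using g(1) p.H.one_closed by (blast dest: inj_onD)
      qed
      ultimately have "\<tau> \<in> iso Q Q" by (simp add: \<tau>.iso_iff)
      moreover have "finite_twisted Q \<tau>"
      proof -
        obtain F where F: "finite F" "F \<subseteq> carrier Q" "\<And>x. x \<in> carrier Q \<Longrightarrow> \<exists>y \<in> F. (x, y) \<in> twisted_conj Q \<phi>'"
          using True unfolding finite_twisted_def by blast
        \<comment> \<open>Right translation by the inverse of \<open>x\<close> turns twisted
          conjugacy for \<open>\<phi>'\<close> into twisted conjugacy for \<open>\<tau>\<close>, so
          finiteness carries over.\<close>
        let ?F = "(\<lambda>y. y \<otimes>\<^bsub>Q\<^esub> inv\<^bsub>Q\<^esub> x) ` F"
        have "\<exists>y \<in> ?F. (w, y) \<in> twisted_conj Q \<tau>" if w: "w \<in> carrier Q" for w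
        proof -
          obtain y where y: "y \<in> F" "(w \<otimes>\<^bsub>Q\<^esub> x, y) \<in> twisted_conj Q \<phi>'" using F(3)[of "w \<otimes>\<^bsub>Q\<^esub> x"] w x by auto
          then obtain z where z: "z \<in> carrier Q" "y \<in> carrier Q" "w \<otimes>\<^bsub>Q\<^esub> x = z \<otimes>\<^bsub>Q\<^esub> y \<otimes>\<^bsub>Q\<^esub> inv\<^bsub>Q\<^esub> (\<phi>' z)"
            unfolding twisted_conj_iff by blast
          have "w = w \<otimes>\<^bsub>Q\<^esub> x \<otimes>\<^bsub>Q\<^esub> inv\<^bsub>Q\<^esub> x" using w x by (simp add: p.H.m_assoc)
          also have "\<dots> = z \<otimes>\<^bsub>Q\<^esub> (y \<otimes>\<^bsub>Q\<^esub> inv\<^bsub>Q\<^esub> x) \<otimes>\<^bsub>Q\<^esub> inv\<^bsub>Q\<^esub> (\<tau> z)"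
            unfolding z(3) \<tau>_def using z(1,2) x by (simp add: p.H.m_assoc p.H.inv_mult_group)
          finally have "(w, y \<otimes>\<^bsub>Q\<^esub> inv\<^bsub>Q\<^esub> x) \<in> twisted_conj Q \<tau>"
            unfolding twisted_conj_iff using z(1,2) w x by blast
          then show ?thesis using y(1) by blast
        qed
        moreover have "finite ?F" "?F \<subseteq> carrier Q" using F x by auto
        ultimately show ?thesis unfolding finite_twisted_def by (intro exI[of _ ?F] conjI ballI)
      qed
      moreover have "\<tau> n = n"
      proof -
        have "x \<otimes>\<^bsub>Q\<^esub> \<phi>' n = n \<otimes>\<^bsub>Q\<^esub> x"
          using eq x n p.H.inv_solve_right[of x "n \<otimes>\<^bsub>Q\<^esub> x" "\<phi>' n"] by simp
        then show ?thesis using x n by (simp add: \<tau>_def p.H.m_assoc)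
      qed
      ultimately show ?thesis
        using finite_twisted_fixed_point[OF p.H.is_group p.noetherian_epi[OF G(2) Q(2)]
            central_quotient_torsion_free[OF Q G(3) nilQ] nilQ] n by blast
    qed
    note eqQ = p.H.equiv_twisted_conj[OF \<phi>'.homh]
    \<comment> \<open>Over each class of the quotient one element of the group is chosen, and
      \<open>T\<close> below collects its translates by the center. The choice depends only on the
      class, so elements of \<open>T\<close> over one class have the same image in
      \<open>Q\<close>.\<close>
    define cls where "cls x = twisted_conj Q \<phi>' `` {p x}" for x
    define r where "r C = (SOME x. x \<in> carrier G \<and> p x \<in> C)" for C
    have r: "r (cls x) \<in> carrier G" "(p x, p (r (cls x))) \<in> twisted_conj Q \<phi>'" if x: "x \<in> carrier G" for x
    proof -
      have "p x \<in> cls x" unfolding cls_def using eqQ x by (auto simp: equiv_def refl_on_def)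
      then have "r (cls x) \<in> carrier G \<and> p (r (cls x)) \<in> cls x"
        unfolding r_def using someI[of "\<lambda>y. y \<in> carrier G \<and> p y \<in> cls x" x] x by blast
      then show "r (cls x) \<in> carrier G" "(p x, p (r (cls x))) \<in> twisted_conj Q \<phi>'"
        unfolding cls_def by auto
    qed
    define T where "T = {r (cls x) \<otimes>\<^bsub>G\<^esub> z | x z. x \<in> carrier G \<and> z \<in> center G}"
    have Tc: "T \<subseteq> carrier G" unfolding T_def using r(1) G.center_closed by blast
    \<comment> \<open>Stated for a general \<open>\<theta>\<close> because \<open>\<phi>\<close> and
      \<open>\<psi>\<close> induce the same map on the quotient and both need it.\<close>
    have hit: "\<exists>t \<in> T. (x, t) \<in> twisted_conj G \<theta>"
      if x: "x \<in> carrier G" and \<theta>: "group_hom G G \<theta>" "\<And>x. x \<in> carrier G \<Longrightarrow> \<phi>' (p x) = p (\<theta> x)" for x \<theta>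
    proof -
      interpret \<theta>: group_hom G G \<theta> by (rule \<theta>(1))
      obtain n where n: "n \<in> carrier G" "p x = p n \<otimes>\<^bsub>Q\<^esub> p (r (cls x)) \<otimes>\<^bsub>Q\<^esub> inv\<^bsub>Q\<^esub> (p (\<theta> n))"
        using r(2)[OF x] \<theta>(2) unfolding twisted_conj_iff Q(2)[symmetric] by auto
      note rx = r(1)[OF x]
      let ?z = "inv\<^bsub>G\<^esub> r (cls x) \<otimes>\<^bsub>G\<^esub> inv\<^bsub>G\<^esub> n \<otimes>\<^bsub>G\<^esub> x \<otimes>\<^bsub>G\<^esub> \<theta> n"
      have "p ?z = \<one>\<^bsub>Q\<^esub>" using n rx x by (simp add: p.H.m_assoc)
      then have "?z \<in> center G" using Q(3)[of ?z] n rx x by simp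
      then have "r (cls x) \<otimes>\<^bsub>G\<^esub> ?z \<in> T" unfolding T_def using x by blast
      moreover have "x = n \<otimes>\<^bsub>G\<^esub> (r (cls x) \<otimes>\<^bsub>G\<^esub> ?z) \<otimes>\<^bsub>G\<^esub> inv\<^bsub>G\<^esub> (\<theta> n)"
        using n(1) rx x by (simp add: G.m_assoc)
      ultimately show ?thesis unfolding twisted_conj_iff using x n(1) Tc by blast
    qed
    have restrict: "(t, t') \<in> twisted_conj G \<theta>'"
      if t: "t \<in> T" "t' \<in> T" and tt: "(t, t') \<in> twisted_conj G \<theta>" and \<theta>: "group_hom G G \<theta>"
        "\<And>x. x \<in> carrier G \<Longrightarrow> \<phi>' (p x) = p (\<theta> x)" "\<And>z. z \<in> center G \<Longrightarrow> \<theta> z = \<theta>' z" for t t' \<theta> \<theta>'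
    proof -
      interpret \<theta>: group_hom G G \<theta> by (rule \<theta>(1))
      obtain x z where x: "x \<in> carrier G" "z \<in> center G" "t = r (cls x) \<otimes>\<^bsub>G\<^esub> z" using t unfolding T_def by blast
      obtain x' z' where x': "x' \<in> carrier G" "z' \<in> center G" "t' = r (cls x') \<otimes>\<^bsub>G\<^esub> z'" using t unfolding T_def by blast
      obtain n where n: "n \<in> carrier G" "t = n \<otimes>\<^bsub>G\<^esub> t' \<otimes>\<^bsub>G\<^esub> inv\<^bsub>G\<^esub> (\<theta> n)" "t \<in> carrier G" "t' \<in> carrier G"
        using tt unfolding twisted_conj_iff by blast
      have pt: "p t = p (r (cls x))" "p t' = p (r (cls x'))"
        using x x' r(1) G.center_closed Q(3)[of z] Q(3)[of z'] by auto
      have "p t = p n \<otimes>\<^bsub>Q\<^esub> p t' \<otimes>\<^bsub>Q\<^esub> inv\<^bsub>Q\<^esub> (p (\<theta> n))" unfolding n(2) using n(1,4) by simp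
      then have ptt: "p t = p n \<otimes>\<^bsub>Q\<^esub> p t' \<otimes>\<^bsub>Q\<^esub> inv\<^bsub>Q\<^esub> (\<phi>' (p n))" using \<theta>(2) n(1) by simp
      then have "(p t, p t') \<in> twisted_conj Q \<phi>'"
        unfolding twisted_conj_iff using p.hom_closed[OF n(1)] p.hom_closed[OF n(3)] p.hom_closed[OF n(4)] by blast
      then have "(p x, p x') \<in> twisted_conj Q \<phi>'"
        using r(2)[OF x(1)] r(2)[OF x'(1)] eqQ unfolding pt equiv_def by (blast dest: symD transD)
      then have "cls x = cls x'" unfolding cls_def by (rule equiv_class_eq[OF eqQ])
      then have "p t = p t'" using pt by simp
      then have "p n = \<one>\<^bsub>Q\<^esub>" using stab[OF p.hom_closed[OF n(4)] p.hom_closed[OF n(1)]] ptt by simp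
      then have "\<theta> n = \<theta>' n" using Q(3)[OF n(1)] \<theta>(3) by blast
      then show ?thesis unfolding twisted_conj_iff using n by auto
    qed
    note eq\<phi> = G.equiv_twisted_conj[OF \<phi>.homh]
    note eq\<psi> = G.equiv_twisted_conj[OF \<psi>.homh]
    \<comment> \<open>Every element is moved into \<open>T\<close> inside its class for
      \<open>\<phi>\<close>; on \<open>T\<close> the two relations coincide.\<close>
    define h where "h x = (SOME t. t \<in> T \<and> (x, t) \<in> twisted_conj G \<phi>)" for x
    have h: "h x \<in> T" "(x, h x) \<in> twisted_conj G \<phi>" if "x \<in> carrier G" for x
      using someI_ex[of "\<lambda>t. t \<in> T \<and> (x, t) \<in> twisted_conj G \<phi>"] hit[OF that \<phi>.group_hom_axioms \<phi>'(2)]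
      unfolding h_def by blast+
    have iff: "(t, t') \<in> twisted_conj G \<phi> \<longleftrightarrow> (t, t') \<in> twisted_conj G \<psi>" if "t \<in> T" "t' \<in> T" for t t'
      using restrict[OF that _ \<phi>.group_hom_axioms \<phi>'(2) agree]
        restrict[OF that _ \<psi>.group_hom_axioms \<phi>'\<psi> agree[symmetric]] by blast
    show ?thesis
    proof (rule reidemeister_number_transfer[OF G(1) \<phi>.homh G(1) \<psi>.homh, of h])
      show "h x \<in> carrier G" if "x \<in> carrier G" for x using h(1)[OF that] Tc by blast
      show "(x, y) \<in> twisted_conj G \<phi> \<longleftrightarrow> (h x, h y) \<in> twisted_conj G \<psi>"
        if x: "x \<in> carrier G" and y: "y \<in> carrier G" for x y
      proof -
        have "(x, y) \<in> twisted_conj G \<phi> \<longleftrightarrow> (h x, h y) \<in> twisted_conj G \<phi>"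
          by (rule equiv_iff[OF eq\<phi> h(2)[OF x] h(2)[OF y]])
        then show ?thesis using iff[OF h(1)[OF x] h(1)[OF y]] by simp
      qed
      show "\<exists>a \<in> carrier G. (h a, b) \<in> twisted_conj G \<psi>" if b: "b \<in> carrier G" for b
      proof -
        obtain t where t: "t \<in> T" "(b, t) \<in> twisted_conj G \<psi>"
          using hit[OF b \<psi>.group_hom_axioms \<phi>'\<psi>] by blast
        have tc: "t \<in> carrier G" using t Tc by blast
        have "(t, h t) \<in> twisted_conj G \<psi>" using iff[OF t(1) h(1)[OF tc]] h(2)[OF tc] by simp
        then have "(h t, b) \<in> twisted_conj G \<psi>"
          using t(2) equivE[OF eq\<psi>] by (metis symD transD)
        then show ?thesis using tc by blast
      qed
    qed
  qed
qed

lemma reidemeister_number_cong: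
  assumes "\<And>x. x \<in> carrier G \<Longrightarrow> \<phi> x = \<phi>' x"
  shows "reidemeister_number G \<phi> = reidemeister_number G \<phi>'"
  unfolding reidemeister_number_ecard using twisted_conj_cong[of G \<phi> \<phi>', OF assms] by simp

text \<open>Members of \<open>auto G\<close> are undefined outside the carrier, which composites of
  isomorphisms need not be. The Reidemeister number only depends on the restriction to the
  carrier.\<close>

lemma reidemeister_spectrum_iso:
  assumes "group G"
  shows "reidemeister_spectrum G = {reidemeister_number G \<phi> | \<phi>. \<phi> \<in> iso G G}"
proof -
  interpret group G by fact
  have auto_iso: "\<phi> \<in> iso G G" if "\<phi> \<in> auto G" for \<phi>
    using that by (auto simp: auto_def iso_def Bij_def)
  have iso_auto: "restrict \<phi> (carrier G) \<in> auto G" if "\<phi> \<in> iso G G" for \<phi>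
    using that hom_restrict[of \<phi> G "restrict \<phi> (carrier G)"]
    by (auto simp: auto_def iso_def Bij_def cong: bij_betw_cong)
  show ?thesis
    unfolding reidemeister_spectrum_def
  proof (intro equalityI subsetI; elim CollectE exE conjE)
    fix v \<phi> assume "v = reidemeister_number G \<phi>" "\<phi> \<in> auto G"
    then show "v \<in> {reidemeister_number G \<phi> | \<phi>. \<phi> \<in> iso G G}" using auto_iso by blast
  next
    fix v \<phi> assume v: "v = reidemeister_number G \<phi>" and \<phi>: "\<phi> \<in> iso G G"
    have "v = reidemeister_number G (restrict \<phi> (carrier G))"
      unfolding v by (rule reidemeister_number_cong) simp
    then show "v \<in> {reidemeister_number G \<psi> | \<psi>. \<psi> \<in> auto G}" using iso_auto[OF \<phi>] by blast
  qed
qed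

text \<open>Needed because \<open>0 * \<infinity> = 0\<close> in \<open>enat\<close>.\<close>

lemma reidemeister_number_nonzero:
  assumes "group G" "\<phi> \<in> hom G G"
  shows "reidemeister_number G \<phi> \<noteq> 0"
proof -
  interpret group G by fact
  have "carrier G // twisted_conj G \<phi> \<noteq> {}" using one_closed by (auto simp: quotient_def)
  then show ?thesis
    by (auto simp: reidemeister_number_ecard ecard_def zero_enat_def card_eq_0_iff)
qed

section \<open>Reidemeister numbers of direct products\<close>

lemma quotient_Times:
  assumes r: "equiv A r" and s: "equiv B s"
  defines "t \<equiv> {((x, y), (x', y')). (x, x') \<in> r \<and> (y, y') \<in> s}"
  shows "equiv (A \<times> B) t" "ecard ((A \<times> B) // t) = ecard (A // r) * ecard (B // s)"
proof -
  show t: "equiv (A \<times> B) t"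
    using equivE[OF r] equivE[OF s] unfolding t_def
    by (intro equivI) (auto simp: refl_on_def intro!: symI transI dest: symD transD)
  have cls: "t `` {(x, y)} = r `` {x} \<times> s `` {y}" for x y by (auto simp: t_def)
  have "bij_betw (\<lambda>(C, D). C \<times> D) (A // r \<times> B // s) ((A \<times> B) // t)"
    unfolding bij_betw_def
  proof
    show "inj_on (\<lambda>(C, D). C \<times> D) (A // r \<times> B // s)"
      using in_quotient_imp_non_empty[OF r] in_quotient_imp_non_empty[OF s]
      by (auto simp: inj_on_def times_eq_iff)
    show "(\<lambda>(C, D). C \<times> D) ` (A // r \<times> B // s) = (A \<times> B) // t"
    proof (intro equalityI subsetI)
      fix E assume "E \<in> (\<lambda>(C, D). C \<times> D) ` (A // r \<times> B // s)"
      then obtain C D where CD: "E = C \<times> D" "C \<in> A // r" "D \<in> B // s" by auto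
      obtain x where x: "x \<in> A" "C = r `` {x}" using CD(2) by (rule quotientE)
      obtain y where y: "y \<in> B" "D = s `` {y}" using CD(3) by (rule quotientE)
      have "E = t `` {(x, y)}" unfolding cls CD(1) x(2) y(2) ..
      then show "E \<in> (A \<times> B) // t" using x(1) y(1) by (simp add: quotientI)
    next
      fix E assume "E \<in> (A \<times> B) // t"
      then obtain w where w: "w \<in> A \<times> B" "E = t `` {w}" by (rule quotientE)
      then obtain x y where "x \<in> A" "y \<in> B" "E = r `` {x} \<times> s `` {y}" using cls by blast
      then show "E \<in> (\<lambda>(C, D). C \<times> D) ` (A // r \<times> B // s)"
        by (intro image_eqI[of _ _ "(r `` {x}, s `` {y})"]) (auto intro: quotientI)
    qed
  qed
  then show "ecard ((A \<times> B) // t) = ecard (A // r) * ecard (B // s)"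
    unfolding ecard_Times[symmetric] using ecard_bij_betw by metis
qed

lemma (in group_family) twisted_conj_product_iff:
  assumes "\<phi> \<in> hom P P" "x \<in> carrier P" "y \<in> carrier P"
  shows "(x, y) \<in> twisted_conj P \<phi> \<longleftrightarrow>
    (\<exists>z \<in> carrier P. \<forall>i \<in> I. x i = z i \<otimes>\<^bsub>H i\<^esub> y i \<otimes>\<^bsub>H i\<^esub> inv\<^bsub>H i\<^esub> (\<phi> z i))"
proof -
  interpret \<phi>: group_hom P P \<phi> using assms(1) by unfold_locales
  have "x = z \<otimes>\<^bsub>P\<^esub> y \<otimes>\<^bsub>P\<^esub> inv\<^bsub>P\<^esub> (\<phi> z) \<longleftrightarrow>
      (\<forall>i \<in> I. x i = z i \<otimes>\<^bsub>H i\<^esub> y i \<otimes>\<^bsub>H i\<^esub> inv\<^bsub>H i\<^esub> (\<phi> z i))" if z: "z \<in> carrier P" for z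
  proof -
    have c: "z \<otimes>\<^bsub>P\<^esub> y \<otimes>\<^bsub>P\<^esub> inv\<^bsub>P\<^esub> (\<phi> z) \<in> carrier P"
      by (intro P.m_closed P.inv_closed \<phi>.hom_closed z assms)
    have e: "(z \<otimes>\<^bsub>P\<^esub> y \<otimes>\<^bsub>P\<^esub> inv\<^bsub>P\<^esub> (\<phi> z)) i = z i \<otimes>\<^bsub>H i\<^esub> y i \<otimes>\<^bsub>H i\<^esub> inv\<^bsub>H i\<^esub> (\<phi> z i)" if "i \<in> I" for i
      using that \<phi>.hom_closed[OF z] by (simp only: P_mult P_inv)
    show ?thesis
    proof
      assume eq: "x = z \<otimes>\<^bsub>P\<^esub> y \<otimes>\<^bsub>P\<^esub> inv\<^bsub>P\<^esub> (\<phi> z)"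
      show "\<forall>i \<in> I. x i = z i \<otimes>\<^bsub>H i\<^esub> y i \<otimes>\<^bsub>H i\<^esub> inv\<^bsub>H i\<^esub> (\<phi> z i)"
        using e unfolding eq[symmetric] by blast
    next
      assume "\<forall>i \<in> I. x i = z i \<otimes>\<^bsub>H i\<^esub> y i \<otimes>\<^bsub>H i\<^esub> inv\<^bsub>H i\<^esub> (\<phi> z i)"
      then show "x = z \<otimes>\<^bsub>P\<^esub> y \<otimes>\<^bsub>P\<^esub> inv\<^bsub>P\<^esub> (\<phi> z)"
        using e by (intro P_ext[OF assms(2) c]) simp
    qed
  qed
  then show ?thesis unfolding twisted_conj_iff using assms(2,3) by blast
qed

text \<open>\<open>\<phi>\<close> is described pointwise as \<open>f\<close> on the coordinate
  \<open>a\<close> and \<open>g\<close> on the others, so that coordinatewise maps and permutation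
  maps fixing the index \<open>a\<close> are both instances.\<close>

lemma reidemeister_number_insert:
  fixes H :: "'i \<Rightarrow> 'a monoid"
  assumes a: "a \<notin> J" and grp: "\<And>i. i \<in> insert a J \<Longrightarrow> group (H i)"
    and f: "f \<in> hom (H a) (H a)" and g: "g \<in> hom (product_group J H) (product_group J H)"
    and \<phi>: "\<phi> \<in> hom (product_group (insert a J) H) (product_group (insert a J) H)"
    and \<phi>f: "\<And>x. x \<in> carrier (product_group (insert a J) H) \<Longrightarrow> \<phi> x a = f (x a)"
    and \<phi>g: "\<And>x i. x \<in> carrier (product_group (insert a J) H) \<Longrightarrow> i \<in> J \<Longrightarrow> \<phi> x i = g (restrict x J) i"
  shows "reidemeister_number (product_group (insert a J) H) \<phi>
       = reidemeister_number (H a) f * reidemeister_number (product_group J H) g"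
proof -
  interpret L: group_family "insert a J" H by (rule group_family.intro, rule grp)
  interpret M: group_family J H by (rule group_family.intro, rule grp, simp)
  interpret Ha: group "H a" using grp by simp
  note eqf = Ha.equiv_twisted_conj[OF f]
  note eqg = M.P.equiv_twisted_conj[OF g]
  note eqt = quotient_Times[OF eqf eqg]
  define join where "join u v = (\<lambda>i\<in>insert a J. if i = a then u else v i)" for u :: 'a and v
  have join_c: "join u v \<in> carrier L.P" if "u \<in> carrier (H a)" "v \<in> carrier M.P" for u v
    using that by (auto simp: join_def)
  have join_a: "join u v a = u" for u v by (simp add: join_def)
  have join_J: "restrict (join u v) J = v" if "v \<in> carrier M.P" for u v
    using that a by (auto simp: join_def restrict_def fun_eq_iff PiE_iff extensional_def)
  have res_c: "restrict x J \<in> carrier M.P" if "x \<in> carrier L.P" for x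
    using that by (auto simp: PiE_iff)
  have a_c: "x a \<in> carrier (H a)" if "x \<in> carrier L.P" for x using L.P_comp[OF that] by simp
  have iff: "(x, y) \<in> twisted_conj L.P \<phi> \<longleftrightarrow>
      (x a, y a) \<in> twisted_conj (H a) f \<and> (restrict x J, restrict y J) \<in> twisted_conj M.P g"
    if x: "x \<in> carrier L.P" and y: "y \<in> carrier L.P" for x y
    unfolding L.twisted_conj_product_iff[OF \<phi> x y] M.twisted_conj_product_iff[OF g res_c[OF x] res_c[OF y]]
      twisted_conj_iff[of _ _ "H a"]
  proof
    assume "\<exists>z\<in>carrier L.P. \<forall>i\<in>insert a J. x i = z i \<otimes>\<^bsub>H i\<^esub> y i \<otimes>\<^bsub>H i\<^esub> inv\<^bsub>H i\<^esub> (\<phi> z i)"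
    then obtain z where z: "z \<in> carrier L.P"
      and eq: "\<And>i. i \<in> insert a J \<Longrightarrow> x i = z i \<otimes>\<^bsub>H i\<^esub> y i \<otimes>\<^bsub>H i\<^esub> inv\<^bsub>H i\<^esub> (\<phi> z i)" by blast
    have "x a = z a \<otimes>\<^bsub>H a\<^esub> y a \<otimes>\<^bsub>H a\<^esub> inv\<^bsub>H a\<^esub> (f (z a))"
      using eq[of a] \<phi>f[OF z] by simp
    moreover have "\<forall>i\<in>J. restrict x J i = restrict z J i \<otimes>\<^bsub>H i\<^esub> restrict y J i \<otimes>\<^bsub>H i\<^esub> inv\<^bsub>H i\<^esub> (g (restrict z J) i)"
    proof
      fix i assume i: "i \<in> J"
      show "restrict x J i = restrict z J i \<otimes>\<^bsub>H i\<^esub> restrict y J i \<otimes>\<^bsub>H i\<^esub> inv\<^bsub>H i\<^esub> (g (restrict z J) i)"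
        unfolding restrict_apply'[OF i] \<phi>g[OF z i, symmetric] by (rule eq) (use i in simp)
    qed
    ultimately show "(x a \<in> carrier (H a) \<and> y a \<in> carrier (H a) \<and>
        (\<exists>z\<in>carrier (H a). x a = z \<otimes>\<^bsub>H a\<^esub> y a \<otimes>\<^bsub>H a\<^esub> inv\<^bsub>H a\<^esub> (f z))) \<and>
        (\<exists>z\<in>carrier M.P. \<forall>i\<in>J. restrict x J i = z i \<otimes>\<^bsub>H i\<^esub> restrict y J i \<otimes>\<^bsub>H i\<^esub> inv\<^bsub>H i\<^esub> (g z i))"
      using a_c[OF x] a_c[OF y] a_c[OF z] res_c[OF z] by blast
  next
    assume "(x a \<in> carrier (H a) \<and> y a \<in> carrier (H a) \<and>
        (\<exists>z\<in>carrier (H a). x a = z \<otimes>\<^bsub>H a\<^esub> y a \<otimes>\<^bsub>H a\<^esub> inv\<^bsub>H a\<^esub> (f z))) \<and>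
        (\<exists>z\<in>carrier M.P. \<forall>i\<in>J. restrict x J i = z i \<otimes>\<^bsub>H i\<^esub> restrict y J i \<otimes>\<^bsub>H i\<^esub> inv\<^bsub>H i\<^esub> (g z i))"
    then obtain u v where u: "u \<in> carrier (H a)" "x a = u \<otimes>\<^bsub>H a\<^esub> y a \<otimes>\<^bsub>H a\<^esub> inv\<^bsub>H a\<^esub> (f u)"
      and v: "v \<in> carrier M.P"
        "\<And>i. i \<in> J \<Longrightarrow> restrict x J i = v i \<otimes>\<^bsub>H i\<^esub> restrict y J i \<otimes>\<^bsub>H i\<^esub> inv\<^bsub>H i\<^esub> (g v i)" by blast
    note jc = join_c[OF u(1) v(1)]
    have "x i = join u v i \<otimes>\<^bsub>H i\<^esub> y i \<otimes>\<^bsub>H i\<^esub> inv\<^bsub>H i\<^esub> (\<phi> (join u v) i)" if i: "i \<in> insert a J" for i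
    proof (cases "i = a")
      case True
      then show ?thesis using u(2) \<phi>f[OF jc] join_a by simp
    next
      case False
      then have iJ: "i \<in> J" using i by simp
      have "join u v i = v i" using False i by (simp add: join_def)
      then show ?thesis using v(2)[OF iJ] \<phi>g[OF jc iJ] join_J[OF v(1)] iJ by simp
    qed
    then show "\<exists>z\<in>carrier L.P. \<forall>i\<in>insert a J. x i = z i \<otimes>\<^bsub>H i\<^esub> y i \<otimes>\<^bsub>H i\<^esub> inv\<^bsub>H i\<^esub> (\<phi> z i)"
      using jc by blast
  qed
  have "ecard (carrier L.P // twisted_conj L.P \<phi>) =
      ecard ((carrier (H a) \<times> carrier M.P) //
        {((x, y), (x', y')). (x, x') \<in> twisted_conj (H a) f \<and> (y, y') \<in> twisted_conj M.P g})"
  proof (rule quotient_transfer[OF L.P.equiv_twisted_conj[OF \<phi>] eqt(1), of "\<lambda>x. (x a, restrict x J)"])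
    show "(x a, restrict x J) \<in> carrier (H a) \<times> carrier M.P" if "x \<in> carrier L.P" for x
      using a_c[OF that] res_c[OF that] by (rule SigmaI)
    show "(x, y) \<in> twisted_conj L.P \<phi> \<longleftrightarrow> ((x a, restrict x J), (y a, restrict y J)) \<in>
        {((x, y), (x', y')). (x, x') \<in> twisted_conj (H a) f \<and> (y, y') \<in> twisted_conj M.P g}"
      if "x \<in> carrier L.P" "y \<in> carrier L.P" for x y using iff[OF that] by simp
    fix b assume b: "b \<in> carrier (H a) \<times> carrier M.P"
    then obtain u v where uv: "b = (u, v)" "u \<in> carrier (H a)" "v \<in> carrier M.P" by blast
    have "(join u v a, restrict (join u v) J) = b" using uv join_a join_J by simp
    moreover have "(b, b) \<in> {((x, y), (x', y')). (x, x') \<in> twisted_conj (H a) f \<and> (y, y') \<in> twisted_conj M.P g}"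
      using eqt(1) b unfolding equiv_def refl_on_def by blast
    ultimately show "\<exists>x\<in>carrier L.P. ((x a, restrict x J), b) \<in>
        {((x, y), (x', y')). (x, x') \<in> twisted_conj (H a) f \<and> (y, y') \<in> twisted_conj M.P g}"
      by (intro bexI[OF _ join_c[OF uv(2,3)]]) simp
  qed
  then show ?thesis unfolding reidemeister_number_ecard using eqt(2) by simp
qed

lemma ecard_singleton: "ecard {x} = 1"
  by (simp add: ecard_def enat_1[unfolded One_nat_def])

lemma reidemeister_number_empty_product:
  "reidemeister_number (product_group {} H) \<phi> = 1"
proof -
  have "carrier (product_group {} H) // twisted_conj (product_group {} H) \<phi>
      = {twisted_conj (product_group {} H) \<phi> `` {\<lambda>_. undefined}}"
    unfolding carrier_product_group PiE_empty_domain by (rule singleton_quotient)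
  then show ?thesis by (simp only: reidemeister_number_ecard ecard_singleton)
qed

lemma product_map_hom:
  assumes "\<And>i. i \<in> I \<Longrightarrow> f i \<in> hom (H i) (H i)"
  shows "(\<lambda>x. \<lambda>i\<in>I. f i (x i)) \<in> hom (product_group I H) (product_group I H)"
proof (rule homI)
  have cl: "f i u \<in> carrier (H i)" if "i \<in> I" "u \<in> carrier (H i)" for i u
    using hom_in_carrier[OF assms[OF that(1)] that(2)] .
  fix x y assume x: "x \<in> carrier (product_group I H)" and y: "y \<in> carrier (product_group I H)"
  show "(\<lambda>i\<in>I. f i (x i)) \<in> carrier (product_group I H)" using x cl by (auto simp: PiE_iff)
  have "f i (x i \<otimes>\<^bsub>H i\<^esub> y i) = f i (x i) \<otimes>\<^bsub>H i\<^esub> f i (y i)" if "i \<in> I" for i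
    using hom_mult[OF assms[OF that]] x y that by (auto simp: PiE_iff)
  then show "(\<lambda>i\<in>I. f i ((x \<otimes>\<^bsub>product_group I H\<^esub> y) i))
      = (\<lambda>i\<in>I. f i (x i)) \<otimes>\<^bsub>product_group I H\<^esub> (\<lambda>i\<in>I. f i (y i))"
    by (auto intro!: restrict_ext)
qed

lemma reidemeister_number_product:
  fixes H :: "'i \<Rightarrow> 'a monoid"
  assumes "finite I" "\<And>i. i \<in> I \<Longrightarrow> group (H i)" "\<And>i. i \<in> I \<Longrightarrow> f i \<in> hom (H i) (H i)"
  shows "reidemeister_number (product_group I H) (\<lambda>x. \<lambda>i\<in>I. f i (x i)) = (\<Prod>i\<in>I. reidemeister_number (H i) (f i))"
  using assms
proof (induction I)
  case empty
  then show ?case by (simp add: reidemeister_number_empty_product)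
next
  case (insert a J)
  have "reidemeister_number (product_group (insert a J) H) (\<lambda>x. \<lambda>i\<in>insert a J. f i (x i))
      = reidemeister_number (H a) (f a) * reidemeister_number (product_group J H) (\<lambda>x. \<lambda>i\<in>J. f i (x i))"
    by (rule reidemeister_number_insert[OF insert.hyps(2) insert.prems(1)])
      (use insert.prems in \<open>auto intro: product_map_hom\<close>)
  moreover have "reidemeister_number (product_group J H) (\<lambda>x. \<lambda>i\<in>J. f i (x i)) = (\<Prod>i\<in>J. reidemeister_number (H i) (f i))"
    using insert.prems by (intro insert.IH) auto
  ultimately show ?case unfolding prod.insert[OF insert.hyps] by (simp only:)
qed

section \<open>Permutation maps on products and on powers of one group\<close>

definition monomial :: "'i set \<Rightarrow> ('i \<Rightarrow> 'i) \<Rightarrow> ('i \<Rightarrow> 'a \<Rightarrow> 'a) \<Rightarrow> ('i \<Rightarrow> 'a) \<Rightarrow> 'i \<Rightarrow> 'a" where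
  "monomial I s \<theta> w = (\<lambda>i\<in>I. \<theta> i (w (s i)))"

text \<open>\<open>s\<close> tells where coordinate \<open>i\<close> is read from, which is why
  \<open>\<theta> i\<close> goes from \<open>H (s i)\<close> to \<open>H i\<close>. Preimages are
  built with the inverse permutation.\<close>

lemma monomial_iso:
  fixes H :: "'i \<Rightarrow> 'a monoid"
  assumes grp: "\<And>i. i \<in> I \<Longrightarrow> group (H i)" and s: "bij_betw s I I"
    and \<theta>: "\<And>i. i \<in> I \<Longrightarrow> \<theta> i \<in> iso (H (s i)) (H i)"
  shows "monomial I s \<theta> \<in> iso (product_group I H) (product_group I H)"
proof -
  interpret group_family I H by (rule group_family.intro, rule grp)
  have sI: "s i \<in> I" if "i \<in> I" for i using s that by (auto simp: bij_betw_def)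
  have \<theta>h: "\<theta> i \<in> hom (H (s i)) (H i)" if "i \<in> I" for i using \<theta>[OF that] by (simp add: iso_def)
  have cl: "monomial I s \<theta> w \<in> carrier P" if w: "w \<in> carrier P" for w
    using hom_in_carrier[OF \<theta>h] P_comp[OF w sI] by (simp add: monomial_def)
  have hom: "monomial I s \<theta> \<in> hom P P"
  proof (rule homI[OF cl])
    fix x y assume x: "x \<in> carrier P" and y: "y \<in> carrier P"
    show "monomial I s \<theta> (x \<otimes>\<^bsub>P\<^esub> y) = monomial I s \<theta> x \<otimes>\<^bsub>P\<^esub> monomial I s \<theta> y"
    proof (rule P_ext)
      fix i assume i: "i \<in> I"
      show "monomial I s \<theta> (x \<otimes>\<^bsub>P\<^esub> y) i = (monomial I s \<theta> x \<otimes>\<^bsub>P\<^esub> monomial I s \<theta> y) i"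
        unfolding P_mult[OF i] using i hom_mult[OF \<theta>h[OF i] P_comp[OF x sI[OF i]] P_comp[OF y sI[OF i]]] sI[OF i]
        by (simp add: monomial_def)
    qed (intro cl P.m_closed x y)+
  qed
  interpret m: group_hom P P "monomial I s \<theta>" using hom by unfold_locales
  define t where "t = inv_into I s"
  have t: "t i \<in> I" "s (t i) = i" if "i \<in> I" for i
    using s that bij_betw_inv_into_right[OF s] bij_betwE[OF bij_betw_inv_into[OF s]] by (auto simp: t_def)
  have ts: "t (s i) = i" if "i \<in> I" for i using bij_betw_inv_into_left[OF s that] by (simp add: t_def)
  have "carrier P \<subseteq> monomial I s \<theta> ` carrier P"
  proof
    fix w assume w: "w \<in> carrier P"
    have "\<forall>i \<in> I. \<exists>u \<in> carrier (H (s i)). \<theta> i u = w i"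
    proof
      fix i assume i: "i \<in> I"
      have "w i \<in> \<theta> i ` carrier (H (s i))" using \<theta>[OF i] P_comp[OF w i] by (simp add: iso_def bij_betw_def)
      then show "\<exists>u \<in> carrier (H (s i)). \<theta> i u = w i" by (metis imageE)
    qed
    then obtain u where u: "\<And>i. i \<in> I \<Longrightarrow> u i \<in> carrier (H (s i))" "\<And>i. i \<in> I \<Longrightarrow> \<theta> i (u i) = w i" by metis
    let ?v = "\<lambda>i\<in>I. u (t i)"
    have v: "?v \<in> carrier P" using u(1)[OF t(1)] t by (simp add: PiE_iff)
    have "monomial I s \<theta> ?v = w"
    proof (rule P_ext[OF cl[OF v] w])
      fix i assume i: "i \<in> I"
      then show "monomial I s \<theta> ?v i = w i" using u(2)[OF i] sI[OF i] ts[OF i] by (simp add: monomial_def)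
    qed
    then show "w \<in> monomial I s \<theta> ` carrier P" using v by blast
  qed
  moreover have "w = \<one>\<^bsub>P\<^esub>" if w: "w \<in> carrier P" "monomial I s \<theta> w = \<one>\<^bsub>P\<^esub>" for w
  proof (rule P_ext[OF w(1) P.one_closed])
    fix j assume j: "j \<in> I"
    define i where "i = t j"
    have i: "i \<in> I" "s i = j" using t[OF j] by (simp_all add: i_def)
    have "\<theta> i (w j) = monomial I s \<theta> w i" using i by (simp add: monomial_def)
    also have "\<dots> = \<one>\<^bsub>H i\<^esub>" unfolding w(2) using i by simp
    also have "\<dots> = \<theta> i \<one>\<^bsub>H j\<^esub>" using hom_one[OF \<theta>h[OF i(1)]] grp i j by simp
    finally have eq: "\<theta> i (w j) = \<theta> i \<one>\<^bsub>H j\<^esub>" .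
    have "inj_on (\<theta> i) (carrier (H j))" using \<theta>[OF i(1)] i(2) by (simp add: iso_def bij_betw_def)
    then have "w j = \<one>\<^bsub>H j\<^esub>" using eq P_comp[OF w(1) j] one_c[OF j] by (rule inj_onD)
    then show "w j = \<one>\<^bsub>P\<^esub> j" using j by simp
  qed
  ultimately show ?thesis by (simp add: m.iso_iff)
qed

text \<open>Every twisted conjugacy class contains an element whose \<open>a\<close>-th coordinate is trivial, so a
  factor that is moved can be removed from its cycle.\<close>

lemma reidemeister_number_monomial_shorten:
  fixes G :: "'a monoid"
  assumes G: "group G" and s: "bij_betw s J J" and \<theta>: "\<And>i. i \<in> J \<Longrightarrow> \<theta> i \<in> iso G G"
    and ac: "a \<in> J" "c \<in> J" "c \<noteq> a" "s c = a"
  defines "J' \<equiv> J - {a}" and "s' \<equiv> s(c := s a)" and "\<theta>' \<equiv> \<theta>(c := \<theta> c \<circ> \<theta> a)"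
  shows "bij_betw s' J' J'" "\<And>i. i \<in> J' \<Longrightarrow> \<theta>' i \<in> iso G G"
    and "reidemeister_number (product_group J (\<lambda>_. G)) (monomial J s \<theta>)
       = reidemeister_number (product_group J' (\<lambda>_. G)) (monomial J' s' \<theta>')"
proof -
  interpret G: group G by (rule G)
  interpret L: group_family J "\<lambda>_. G" by (rule group_family.intro, rule G)
  interpret M: group_family J' "\<lambda>_. G" by (rule group_family.intro, rule G)
  have inj: "inj_on s J" and im: "s ` J = J" using s by (auto simp: bij_betw_def)
  have sJ: "s i \<in> J" if "i \<in> J" for i using im that by blast
  have sa: "s a \<noteq> a" using inj ac by (auto dest: inj_onD)
  have sne: "s i \<noteq> a" if "i \<in> J" "i \<noteq> c" for i using inj ac that by (auto dest: inj_onD)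
  have s'J: "s' i \<in> J'" if "i \<in> J'" for i
    using that sJ sa sne ac unfolding s'_def J'_def by auto
  show s': "bij_betw s' J' J'"
    unfolding bij_betw_def
  proof
    show "inj_on s' J'"
      using inj ac unfolding s'_def J'_def inj_on_def by auto
    show "s' ` J' = J'"
    proof
      show "s' ` J' \<subseteq> J'" using s'J by blast
      show "J' \<subseteq> s' ` J'"
      proof
        fix j assume j: "j \<in> J'"
        then have "j \<in> s ` J" unfolding im by (simp add: J'_def)
        then obtain i where i: "i \<in> J" "s i = j" by (metis imageE)
        have "i \<noteq> c" using i j ac unfolding J'_def by auto
        show "j \<in> s' ` J'"
        proof (cases "i = a")
          case True
          then have "s' c = j" using i by (simp add: s'_def)
          moreover have "c \<in> J'" using ac by (simp add: J'_def)
          ultimately show ?thesis by blast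
        next
          case False
          then have "s' i = j" "i \<in> J'" using i \<open>i \<noteq> c\<close> by (auto simp: s'_def J'_def)
          then show ?thesis by blast
        qed
      qed
    qed
  qed
  show \<theta>': "\<theta>' i \<in> iso G G" if "i \<in> J'" for i
    using that \<theta> ac iso_set_trans[OF \<theta>[OF ac(1)] \<theta>[OF ac(2)]] unfolding \<theta>'_def J'_def by auto
  have \<theta>c: "\<theta> i u \<in> carrier G" if "i \<in> J" "u \<in> carrier G" for i u
    using \<theta>[OF that(1)] that(2) by (auto simp: iso_def hom_def)
  have \<theta>1: "\<theta> i \<one>\<^bsub>G\<^esub> = \<one>\<^bsub>G\<^esub>" if "i \<in> J" for i
    using \<theta>[OF that] hom_one G by (auto simp: iso_def)
  have m: "monomial J s \<theta> \<in> hom L.P L.P" using monomial_iso[of J "\<lambda>_. G" s \<theta>] G s \<theta> by (simp add: iso_def)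
  have m': "monomial J' s' \<theta>' \<in> hom M.P M.P" using monomial_iso[of J' "\<lambda>_. G" s' \<theta>'] G s' \<theta>' by (simp add: iso_def)
  have mJ: "monomial J s \<theta> w i = \<theta> i (w (s i))" if "i \<in> J" for w i using that by (simp add: monomial_def)
  have m'J: "monomial J' s' \<theta>' w i = (if i = c then \<theta> c (\<theta> a (w (s a))) else \<theta> i (w (s i)))" if "i \<in> J'" for w i
    using that by (simp add: monomial_def s'_def \<theta>'_def)
  \<comment> \<open>Reinserts coordinate \<open>a\<close>; with the value \<open>\<one>\<close>
    there it embeds the shorter product into the longer one.\<close>
  define ext where "ext u y = (\<lambda>i\<in>J. if i = a then u else y i)" for u :: 'a and y
  have ext_c: "ext u y \<in> carrier L.P" if "u \<in> carrier G" "y \<in> carrier M.P" for u y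
    using that by (auto simp: ext_def J'_def PiE_iff)
  have ext_a: "ext u y a = u" for u y using ac by (simp add: ext_def)
  have ext_J: "ext u y i = y i" if "i \<in> J'" for u y i using that by (simp add: ext_def J'_def)
  have Jsplit: "i = a \<or> i = c \<or> (i \<in> J' \<and> i \<noteq> c)" if "i \<in> J" for i using that by (auto simp: J'_def)
  have cJ': "c \<in> J'" "s a \<in> J'" using ac sa sJ by (auto simp: J'_def)
  have sJ': "s i \<in> J'" if "i \<in> J" "i \<noteq> c" for i using that sne sJ by (auto simp: J'_def)
  have "reidemeister_number M.P (monomial J' s' \<theta>') = reidemeister_number L.P (monomial J s \<theta>)"
  proof (rule reidemeister_number_transfer[OF M.P.is_group m' L.P.is_group m, of "ext \<one>\<^bsub>G\<^esub>"])
    show "ext \<one>\<^bsub>G\<^esub> x \<in> carrier L.P" if "x \<in> carrier M.P" for x using ext_c[OF G.one_closed that] .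
    fix x y assume x: "x \<in> carrier M.P" and y: "y \<in> carrier M.P"
    have xc: "x i \<in> carrier G" "y i \<in> carrier G" if "i \<in> J'" for i using M.P_comp[OF x that] M.P_comp[OF y that] by auto
    note ex = ext_c[OF G.one_closed x] and ey = ext_c[OF G.one_closed y]
    show "(x, y) \<in> twisted_conj M.P (monomial J' s' \<theta>') \<longleftrightarrow>
        (ext \<one>\<^bsub>G\<^esub> x, ext \<one>\<^bsub>G\<^esub> y) \<in> twisted_conj L.P (monomial J s \<theta>)"
      unfolding L.twisted_conj_product_iff[OF m ex ey] M.twisted_conj_product_iff[OF m' x y]
    proof (intro iffI; elim bexE)
      fix z assume z: "z \<in> carrier M.P"
        and eq: "\<forall>i\<in>J'. x i = z i \<otimes>\<^bsub>G\<^esub> y i \<otimes>\<^bsub>G\<^esub> inv\<^bsub>G\<^esub> (monomial J' s' \<theta>' z i)"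
      have zc: "z i \<in> carrier G" if "i \<in> J'" for i using M.P_comp[OF z that] .
      \<comment> \<open>The value at \<open>a\<close> is forced, being the only one that keeps
        coordinate \<open>a\<close> trivial on both sides. Coordinate \<open>c\<close> reads it, and
        this produces \<open>\<theta> c \<circ> \<theta> a\<close>.\<close>
      let ?z = "ext (\<theta> a (z (s a))) z"
      have uc: "\<theta> a (z (s a)) \<in> carrier G" using \<theta>c zc ac cJ' by blast
      have "ext \<one>\<^bsub>G\<^esub> x i = ?z i \<otimes>\<^bsub>G\<^esub> ext \<one>\<^bsub>G\<^esub> y i \<otimes>\<^bsub>G\<^esub> inv\<^bsub>G\<^esub> (monomial J s \<theta> ?z i)" if i: "i \<in> J" for i
        using Jsplit[OF i]
      proof (elim disjE conjE)
        assume "i = a"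
        then show ?thesis using uc cJ' by (simp add: mJ ac ext_a ext_J)
      next
        assume "i = c"
        then show ?thesis using bspec[OF eq cJ'(1)] by (simp add: mJ m'J ac ext_a ext_J cJ')
      next
        assume i': "i \<in> J'" "i \<noteq> c"
        then show ?thesis using bspec[OF eq i'(1)] by (simp add: mJ[OF i] m'J ext_J sJ'[OF i])
      qed
      then show "\<exists>z\<in>carrier L.P. \<forall>i\<in>J. ext \<one>\<^bsub>G\<^esub> x i
          = z i \<otimes>\<^bsub>G\<^esub> ext \<one>\<^bsub>G\<^esub> y i \<otimes>\<^bsub>G\<^esub> inv\<^bsub>G\<^esub> (monomial J s \<theta> z i)"
        by (intro bexI[OF _ ext_c[OF uc z]] ballI)
    next
      fix z assume z: "z \<in> carrier L.P"
        and eq: "\<forall>i\<in>J. ext \<one>\<^bsub>G\<^esub> x i = z i \<otimes>\<^bsub>G\<^esub> ext \<one>\<^bsub>G\<^esub> y i \<otimes>\<^bsub>G\<^esub> inv\<^bsub>G\<^esub> (monomial J s \<theta> z i)"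
      have zc: "z i \<in> carrier G" if "i \<in> J" for i using L.P_comp[OF z that] .
      let ?z = "restrict z J'"
      have z': "?z \<in> carrier M.P" using zc by (auto simp: J'_def)
      have "\<one>\<^bsub>G\<^esub> = z a \<otimes>\<^bsub>G\<^esub> inv\<^bsub>G\<^esub> (\<theta> a (z (s a)))"
        using bspec[OF eq ac(1)] zc[OF ac(1)] by (simp add: mJ[OF ac(1)] ext_a)
      then have za: "z a = \<theta> a (z (s a))"
        using zc[OF ac(1)] \<theta>c[OF ac(1) zc[OF sJ[OF ac(1)]]]
        by (metis G.inv_closed G.inv_equality G.inv_inv)
      have "x i = ?z i \<otimes>\<^bsub>G\<^esub> y i \<otimes>\<^bsub>G\<^esub> inv\<^bsub>G\<^esub> (monomial J' s' \<theta>' ?z i)" if i: "i \<in> J'" for i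
      proof (cases "i = c")
        case True
        then show ?thesis
          using bspec[OF eq ac(2)] cJ' za by (simp add: mJ[OF ac(2)] m'J ac ext_J)
      next
        case False
        have iJ: "i \<in> J" using i by (simp add: J'_def)
        show ?thesis using bspec[OF eq iJ] False i sJ'[OF iJ False] by (simp add: mJ[OF iJ] m'J ext_J)
      qed
      then show "\<exists>z\<in>carrier M.P. \<forall>i\<in>J'. x i = z i \<otimes>\<^bsub>G\<^esub> y i \<otimes>\<^bsub>G\<^esub> inv\<^bsub>G\<^esub> (monomial J' s' \<theta>' z i)"
        by (intro bexI[OF _ z'] ballI)
    qed
  next
    fix x assume x: "x \<in> carrier L.P"
    have xc: "x i \<in> carrier G" if "i \<in> J" for i using L.P_comp[OF x that] .
    \<comment> \<open>Twisted conjugation by \<open>?z\<close>, the inverse of \<open>x a\<close> at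
      coordinate \<open>a\<close>, clears that coordinate and moves its content to \<open>c\<close>,
      the only coordinate that reads \<open>a\<close>.\<close>
    let ?y = "\<lambda>i\<in>J'. if i = c then x c \<otimes>\<^bsub>G\<^esub> \<theta> c (x a) else x i"
    have y: "?y \<in> carrier M.P" using xc \<theta>c ac by (auto simp: J'_def)
    let ?z = "\<lambda>i\<in>J. if i = a then inv\<^bsub>G\<^esub> x a else \<one>\<^bsub>G\<^esub>"
    have z: "?z \<in> carrier L.P" using xc[OF ac(1)] by auto
    have \<theta>inv: "\<theta> c (inv\<^bsub>G\<^esub> x a) = inv\<^bsub>G\<^esub> \<theta> c (x a)"
    proof -
      interpret t: group_hom G G "\<theta> c" using \<theta>[OF ac(2)] by unfold_locales (simp add: iso_def)
      show ?thesis using xc[OF ac(1)] by simp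
    qed
    have "(ext \<one>\<^bsub>G\<^esub> ?y, x) \<in> twisted_conj L.P (monomial J s \<theta>)"
      unfolding L.twisted_conj_product_iff[OF m ext_c[OF G.one_closed y] x]
    proof (intro bexI[OF _ z] ballI)
      fix i assume i: "i \<in> J"
      show "ext \<one>\<^bsub>G\<^esub> ?y i = ?z i \<otimes>\<^bsub>G\<^esub> x i \<otimes>\<^bsub>G\<^esub> inv\<^bsub>G\<^esub> (monomial J s \<theta> ?z i)"
        using Jsplit[OF i]
      proof (elim disjE conjE)
        assume "i = a"
        then show ?thesis using sa sJ[OF ac(1)] xc[OF ac(1)] ac \<theta>1[OF ac(1)] by (simp add: mJ ext_a)
      next
        assume "i = c"
        then show ?thesis using xc[OF ac(1)] xc[OF ac(2)] ac cJ' \<theta>c[OF ac(2) xc[OF ac(1)]] \<theta>inv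
          by (simp add: mJ ext_J)
      next
        assume i': "i \<in> J'" "i \<noteq> c"
        then show ?thesis using xc[OF i] i sJ[OF i] sne[OF i] \<theta>1[OF i] by (simp add: mJ ext_J) (simp add: J'_def)
      qed
    qed
    then show "\<exists>y\<in>carrier M.P. (ext \<one>\<^bsub>G\<^esub> y, x) \<in> twisted_conj L.P (monomial J s \<theta>)" using y by blast
  qed
  then show "reidemeister_number L.P (monomial J s \<theta>) = reidemeister_number M.P (monomial J' s' \<theta>')" ..
qed

text \<open>The witness for \<open>j\<close> is the number of cycles of \<open>s\<close>. A fixed
  index is a cycle of its own and splits off one element of the spectrum; a moved index is removed
  without changing the number of cycles.\<close>

lemma monomial_reidemeister_number_mem:
  fixes G :: "'a monoid"
  assumes G: "group G" and "finite J" "bij_betw s J J" "\<And>i. i \<in> J \<Longrightarrow> \<theta> i \<in> iso G G"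
  shows "\<exists>j \<le> card J. (J \<noteq> {} \<longrightarrow> 1 \<le> j) \<and>
    reidemeister_number (product_group J (\<lambda>_. G)) (monomial J s \<theta>) \<in> reidemeister_spectrum G ^ j"
  using assms(2-4)
proof (induction "card J" arbitrary: J s \<theta> rule: less_induct)
  case less
  show ?case
  proof (cases "J = {}")
    case True
    then show ?thesis by (auto simp: reidemeister_number_empty_product)
  next
    case False
    then obtain a where a: "a \<in> J" by blast
    define J' where "J' = J - {a}"
    have "Suc (card J') = card J" unfolding J'_def by (rule card_Suc_Diff1[OF less.prems(1) a])
    then have card: "card J' < card J" "Suc (card J') = card J" by simp_all
    have fin: "finite J'" unfolding J'_def using less.prems(1) by simp
    show ?thesis
    proof (cases "s a = a")
      case True
      have J: "J = insert a J'" "a \<notin> J'" using a by (auto simp: J'_def)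
      have s': "bij_betw s J' J'" unfolding J'_def
        using bij_betw_DiffI[OF less.prems(2), of "{a}" "{a}"] True a by (simp add: bij_betw_def)
      obtain j where j: "j \<le> card J'"
        "reidemeister_number (product_group J' (\<lambda>_. G)) (monomial J' s \<theta>) \<in> reidemeister_spectrum G ^ j"
        using less.hyps[OF card(1) fin s'] less.prems(3) J by auto
      have m: "monomial J s \<theta> \<in> hom (product_group J (\<lambda>_. G)) (product_group J (\<lambda>_. G))"
        using monomial_iso[of J "\<lambda>_. G" s \<theta>] G less.prems by (simp add: iso_def)
      have m': "monomial J' s \<theta> \<in> hom (product_group J' (\<lambda>_. G)) (product_group J' (\<lambda>_. G))"
        using monomial_iso[of J' "\<lambda>_. G" s \<theta>] G s' less.prems J by (simp add: iso_def)
      have "reidemeister_number (product_group (insert a J') (\<lambda>_. G)) (monomial (insert a J') s \<theta>)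
          = reidemeister_number G (\<theta> a) * reidemeister_number (product_group J' (\<lambda>_. G)) (monomial J' s \<theta>)"
      proof (rule reidemeister_number_insert[OF J(2) G _ m'])
        show "\<theta> a \<in> hom G G" using less.prems(3)[OF a] by (simp add: iso_def)
        show "monomial (insert a J') s \<theta> \<in> hom (product_group (insert a J') (\<lambda>_. G)) (product_group (insert a J') (\<lambda>_. G))"
          using m J by simp
        show "monomial (insert a J') s \<theta> x a = \<theta> a (x a)" for x by (simp add: monomial_def True)
        fix x i assume i: "i \<in> J'"
        have "s i \<in> J'" using s' i by (auto simp: bij_betw_def)
        then show "monomial (insert a J') s \<theta> x i = monomial J' s \<theta> (restrict x J') i"
          using i by (simp add: monomial_def)
      qed
      moreover have "reidemeister_number G (\<theta> a) \<in> reidemeister_spectrum G"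
        unfolding reidemeister_spectrum_iso[OF G] using less.prems(3)[OF a] by blast
      ultimately have "reidemeister_number (product_group J (\<lambda>_. G)) (monomial J s \<theta>) \<in> reidemeister_spectrum G ^ Suc j"
        using j J set_times_intro by simp
      then show ?thesis using j(1) card by (intro exI[of _ "Suc j"]) auto
    next
      case False
      have "a \<in> s ` J" using less.prems(2) a by (simp add: bij_betw_def)
      then obtain c where c: "c \<in> J" "s c = a" by (metis imageE)
      have "c \<noteq> a" using c False by auto
      note shorten = reidemeister_number_monomial_shorten[where \<theta> = \<theta>, OF G less.prems(2) _ a c(1) \<open>c \<noteq> a\<close> c(2), folded J'_def]
      have s': "bij_betw (s(c := s a)) J' J'" by (rule shorten(1)) (rule less.prems(3))
      have \<theta>': "(\<theta>(c := \<theta> c \<circ> \<theta> a)) i \<in> iso G G" if "i \<in> J'" for i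
        using that by (rule shorten(2)[rotated]) (rule less.prems(3))
      have R: "reidemeister_number (product_group J (\<lambda>_. G)) (monomial J s \<theta>)
          = reidemeister_number (product_group J' (\<lambda>_. G)) (monomial J' (s(c := s a)) (\<theta>(c := \<theta> c \<circ> \<theta> a)))"
        by (rule shorten(3)) (rule less.prems(3))
      have "J' \<noteq> {}" using c \<open>c \<noteq> a\<close> by (auto simp: J'_def)
      moreover have "\<exists>j \<le> card J'. (J' \<noteq> {} \<longrightarrow> 1 \<le> j) \<and>
          reidemeister_number (product_group J (\<lambda>_. G)) (monomial J s \<theta>) \<in> reidemeister_spectrum G ^ j"
        unfolding R by (rule less.hyps[OF card(1) fin s']) (rule \<theta>')
      ultimately obtain j where "j \<le> card J'" "1 \<le> j"
        "reidemeister_number (product_group J (\<lambda>_. G)) (monomial J s \<theta>) \<in> reidemeister_spectrum G ^ j" by blast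
      then show ?thesis using card(1) by (intro exI[of _ j]) simp
    qed
  qed
qed

text \<open>The converse construction adds one index at a time, either as a new cycle with a
  prescribed automorphism or inside an existing cycle with the identity map. The exponent 0 belongs
  to the empty index set only, since a permutation of a nonempty set has a cycle.\<close>

lemma monomial_reidemeister_number_exists:
  fixes G :: "'a monoid"
  assumes G: "group G" and "finite J" "j \<le> card J" "J \<noteq> {} \<longrightarrow> 1 \<le> j" "v \<in> reidemeister_spectrum G ^ j"
  shows "\<exists>s \<theta>. bij_betw s J J \<and> (\<forall>i \<in> J. \<theta> i \<in> iso G G) \<and>
    reidemeister_number (product_group J (\<lambda>_. G)) (monomial J s \<theta>) = v"
  using assms(2-5)
proof (induction J arbitrary: j v)
  case empty
  then show ?case by (auto simp: reidemeister_number_empty_product intro!: exI[of _ id])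
next
  case (insert a J)
  show ?case
  proof (cases "j \<le> card J")
    case False
    \<comment> \<open>As many factors as indices, so the new index has to become a fixed point with
      an automorphism of its own.\<close>
    then have j: "j = Suc (card J)" using insert by simp
    obtain u w where uw: "v = u * w" "u \<in> reidemeister_spectrum G" "w \<in> reidemeister_spectrum G ^ card J"
      using insert.prems(3) unfolding j power_Suc by (rule set_times_elim)
    have "J \<noteq> {} \<longrightarrow> 1 \<le> card J" using insert.hyps(1) by (simp add: Suc_le_eq card_gt_0_iff)
    then obtain s \<theta> where s: "bij_betw s J J" "\<And>i. i \<in> J \<Longrightarrow> \<theta> i \<in> iso G G"
      "reidemeister_number (product_group J (\<lambda>_. G)) (monomial J s \<theta>) = w"
      using insert.IH[OF order_refl _ uw(3)] by blast
    obtain \<phi> where \<phi>: "\<phi> \<in> iso G G" "u = reidemeister_number G \<phi>"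
      using uw(2) unfolding reidemeister_spectrum_iso[OF G] by blast
    let ?s = "s(a := a)" and ?\<theta> = "\<theta>(a := \<phi>)"
    have sJ: "s i \<in> J" if "i \<in> J" for i using s(1) that by (auto simp: bij_betw_def)
    have bs: "bij_betw ?s (insert a J) (insert a J)"
      using s(1) insert.hyps(2) unfolding bij_betw_def inj_on_def by auto
    have \<theta>: "\<And>i. i \<in> insert a J \<Longrightarrow> ?\<theta> i \<in> iso G G" using s(2) \<phi>(1) by auto
    have "reidemeister_number (product_group (insert a J) (\<lambda>_. G)) (monomial (insert a J) ?s ?\<theta>)
        = reidemeister_number G \<phi> * reidemeister_number (product_group J (\<lambda>_. G)) (monomial J s \<theta>)"
    proof (rule reidemeister_number_insert[OF insert.hyps(2) G])
      show "\<phi> \<in> hom G G" using \<phi> by (simp add: iso_def)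
      show "monomial J s \<theta> \<in> hom (product_group J (\<lambda>_. G)) (product_group J (\<lambda>_. G))"
        using monomial_iso[of J "\<lambda>_. G" s \<theta>] G s by (simp add: iso_def)
      show "monomial (insert a J) ?s ?\<theta> \<in> hom (product_group (insert a J) (\<lambda>_. G)) (product_group (insert a J) (\<lambda>_. G))"
        using monomial_iso[of "insert a J" "\<lambda>_. G" ?s ?\<theta>, OF G bs \<theta>] by (simp add: iso_def)
      show "monomial (insert a J) ?s ?\<theta> x a = \<phi> (x a)" for x by (simp add: monomial_def)
      show "monomial (insert a J) ?s ?\<theta> x i = monomial J s \<theta> (restrict x J) i" if i: "i \<in> J" for x i
        using i insert.hyps(2) sJ[OF i] by (auto simp: monomial_def)
    qed
    then show ?thesis using bs \<theta> uw(1) \<phi>(2) s(3) by blast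
  next
    case True
    have j1: "1 \<le> j" using insert.prems by simp
    then obtain c where c: "c \<in> J" using True by fastforce
    obtain s \<theta> where s: "bij_betw s J J" "\<And>i. i \<in> J \<Longrightarrow> \<theta> i \<in> iso G G"
      "reidemeister_number (product_group J (\<lambda>_. G)) (monomial J s \<theta>) = v"
      using insert.IH[OF True _ insert.prems(3)] j1 by blast
    have ac: "a \<notin> J" "c \<noteq> a" using insert.hyps(2) c by auto
    let ?J = "insert a J"
    \<comment> \<open>Splices \<open>a\<close> into the cycle between \<open>c\<close> and
      \<open>s c\<close>; shortening at \<open>a\<close> gives back \<open>s\<close> and
      \<open>\<theta>\<close> on \<open>J\<close>.\<close>
    define s' where "s' = s(c := a, a := s c)"
    define \<theta>' where "\<theta>' = \<theta>(a := \<lambda>x. x)"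
    have sJ: "s i \<in> J" if "i \<in> J" for i using s(1) that by (auto simp: bij_betw_def)
    have "s' ` ?J = ?J"
    proof
      show "s' ` ?J \<subseteq> ?J" using sJ c by (auto simp: s'_def)
      show "?J \<subseteq> s' ` ?J"
      proof
        fix j assume "j \<in> ?J"
        then consider "j = a" | "j \<in> J" by blast
        then show "j \<in> s' ` ?J"
        proof cases
          case 1
          have "s' c = a" using ac by (simp add: s'_def)
          then show ?thesis using 1 c by blast
        next
          case 2
          then have "j \<in> s ` J" using s(1) by (simp add: bij_betw_def)
          then obtain i where i: "i \<in> J" "j = s i" by blast
          show ?thesis
          proof (cases "i = c")
            case True
            then have "s' a = j" using i by (simp add: s'_def)
            then show ?thesis by blast
          next
            case False
            then have "s' i = j" using i ac by (auto simp: s'_def)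
            then show ?thesis using i by blast
          qed
        qed
      qed
    qed
    then have bs: "bij_betw s' ?J ?J"
      using eq_card_imp_inj_on[of ?J s'] insert.hyps(1) by (simp add: bij_betw_def)
    have \<theta>': "\<And>i. i \<in> ?J \<Longrightarrow> \<theta>' i \<in> iso G G" using s(2) iso_set_refl by (auto simp: \<theta>'_def)
    have s'c: "s' c = a" using ac by (simp add: s'_def)
    have J: "?J - {a} = J" using ac by auto
    have "monomial J (s'(c := s' a)) (\<theta>'(c := \<theta>' c \<circ> \<theta>' a)) = monomial J s \<theta>"
      using ac by (intro ext) (auto simp: monomial_def s'_def \<theta>'_def intro!: restrict_ext)
    moreover have "a \<in> ?J" "c \<in> ?J" using c by auto
    ultimately have "reidemeister_number (product_group ?J (\<lambda>_. G)) (monomial ?J s' \<theta>') = v"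
      using reidemeister_number_monomial_shorten(3)[OF G bs \<theta>' _ _ ac(2) s'c] s(3) unfolding J by simp
    then show ?thesis using bs \<theta>' by blast
  qed
qed

section \<open>Finiteness conditions for products\<close>

context group_family
begin

lemma torsion_free_product:
  assumes "\<And>i. i \<in> I \<Longrightarrow> torsion_free_group (H i)"
  shows "torsion_free_group P"
  unfolding torsion_free_group_def
proof (intro conjI ballI allI impI P.is_group)
  fix x and n :: nat assume x: "x \<in> carrier P" "n \<ge> 1" "x [^]\<^bsub>P\<^esub> n = \<one>\<^bsub>P\<^esub>"
  show "x = \<one>\<^bsub>P\<^esub>"
  proof (rule P_ext[OF x(1) P.one_closed])
    fix i assume i: "i \<in> I"
    have "x i [^]\<^bsub>H i\<^esub> n = \<one>\<^bsub>H i\<^esub>" using P_pow[OF i, of x n] x(3) P_one[OF i] by metis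
    then show "x i = \<one>\<^bsub>P\<^esub> i" using torsion_freeD[OF assms[OF i] P_comp[OF x(1) i] x(2)] P_one[OF i] by metis
  qed
qed

lemma nilpotent_product:
  assumes "finite I" "\<And>i. i \<in> I \<Longrightarrow> nilpotent_group (H i)"
  shows "nilpotent_group P"
proof -
  have "\<forall>i \<in> I. \<exists>c. lower_central (H i) c = {\<one>\<^bsub>H i\<^esub>}" using assms(2) by (simp add: nilpotent_group_def)
  then obtain c where c: "\<And>i. i \<in> I \<Longrightarrow> lower_central (H i) (c i) = {\<one>\<^bsub>H i\<^esub>}" by metis
  \<comment> \<open>Any common upper bound for the classes would do; the sum avoids a maximum over a
    possibly empty set.\<close>
  define m where "m = sum c I"
  have m: "lower_central (H i) m = {\<one>\<^bsub>H i\<^esub>}" if i: "i \<in> I" for i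
  proof -
    interpret group "H i" by (rule grp[OF i])
    have "c i \<le> m" unfolding m_def using member_le_sum[OF i, of c] assms(1) by simp
    then show ?thesis using lower_central_trivial_add[OF c[OF i], of "m - c i"] by simp
  qed
  have "w = \<one>\<^bsub>P\<^esub>" if w: "w \<in> lower_central P m" for w
  proof (rule P_ext[OF _ P.one_closed])
    show "w \<in> carrier P" using w lower_central_subset[OF P.is_group] by blast
    fix i assume i: "i \<in> I"
    interpret ap: group_hom P "H i" "\<lambda>w. w i" by (rule apply_hom[OF i])
    have "u \<in> (\<lambda>w. w i) ` carrier P" if u: "u \<in> carrier (H i)" for u
      using emb_closed[OF i u] emb_apply[OF i, of i u] by (intro image_eqI[of _ _ "emb i u"]) simp_all
    then have "(\<lambda>w. w i) ` carrier P = carrier (H i)" using P_comp[OF _ i] by blast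
    then have "lower_central (H i) m = (\<lambda>w. w i) ` lower_central P m" by (rule ap.lower_central_epi)
    then have "w i \<in> lower_central (H i) m" using w by blast
    then show "w i = \<one>\<^bsub>P\<^esub> i" using m[OF i] P_one[OF i] by simp
  qed
  then have "lower_central P m = {\<one>\<^bsub>P\<^esub>}" using subgroup.one_closed[OF P.subgroup_lower_central, of m] by blast
  then show ?thesis using P.is_group unfolding nilpotent_group_def by blast
qed

lemma noetherian_product:
  assumes "finite I" "\<And>i. i \<in> I \<Longrightarrow> noetherian_group (H i)"
  shows "noetherian_group P"
proof -
  \<comment> \<open>The elements supported in \<open>B\<close>. Evaluation at a new index
    \<open>b\<close> has its kernel supported in the smaller set, so factors can be added one at a
    time.\<close>
  let ?K = "\<lambda>B. {w \<in> carrier P. \<forall>i \<in> I - B. w i = \<one>\<^bsub>H i\<^esub>}"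
  have "noetherian_on P (?K B)" if "finite B" "B \<subseteq> I" for B
    using that
  proof (induction B)
    case empty
    have "w = \<one>\<^bsub>P\<^esub>" if "w \<in> ?K {}" for w
      using that by (intro P_ext) (simp_all add: P.one_closed[simplified])
    then show ?case by (intro noetherian_on_subset[OF P.noetherian_on_trivial]) blast
  next
    case (insert b B)
    have b: "b \<in> I" using insert.prems by simp
    interpret ap: group_hom P "H b" "\<lambda>w. w b" by (rule apply_hom[OF b])
    show ?case
    proof (rule ap.noetherian_on_extension)
      show "noetherian_on (H b) ((\<lambda>w. w b) ` ?K (insert b B))"
        by (rule noetherian_on_subset[OF assms(2)[OF b]]) (use P_comp[OF _ b] in blast)
      show "noetherian_on P (?K (insert b B) \<inter> kernel P (H b) (\<lambda>w. w b))"
        by (rule noetherian_on_subset[of _ "?K B"]) (use insert in \<open>auto simp: kernel_def\<close>)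
    qed
  qed
  from this[of I] show ?thesis using assms(1) by simp
qed

end

section \<open>Products of extended naturals and of sets\<close>

lemma enat_prod_eq_top_iff:
  fixes f :: "'i \<Rightarrow> enat"
  assumes "finite B" "\<And>i. i \<in> B \<Longrightarrow> f i \<noteq> 0"
  shows "prod f B = \<infinity> \<longleftrightarrow> (\<exists>i \<in> B. f i = \<infinity>)"
proof -
  \<comment> \<open>Nonvanishing is carried along because \<open>0 * \<infinity> = 0\<close> would
    break the induction step.\<close>
  have "prod f B \<noteq> 0 \<and> (prod f B = \<infinity> \<longleftrightarrow> (\<exists>i \<in> B. f i = \<infinity>))"
    using assms
  proof (induction B)
    case (insert b B)
    then have "f b \<noteq> 0" "prod f B \<noteq> 0 \<and> (prod f B = \<infinity> \<longleftrightarrow> (\<exists>i \<in> B. f i = \<infinity>))" by auto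
    then show ?case unfolding prod.insert[OF insert.hyps] imult_is_infinity imult_is_0 by blast
  qed simp
  then show ?thesis ..
qed

lemma mem_prod_set_iff:
  fixes A :: "'i \<Rightarrow> 'b::comm_monoid_mult set"
  assumes "finite B"
  shows "v \<in> (\<Prod>i\<in>B. A i) \<longleftrightarrow> (\<exists>f. (\<forall>i \<in> B. f i \<in> A i) \<and> v = prod f B)"
  using assms
proof (induction B arbitrary: v)
  case (insert b B)
  show ?case
  proof
    assume "v \<in> (\<Prod>i\<in>insert b B. A i)"
    then obtain u w where u: "v = u * w" "u \<in> A b" "w \<in> (\<Prod>i\<in>B. A i)"
      unfolding prod.insert[OF insert.hyps] by (rule set_times_elim)
    then obtain f where f: "\<forall>i \<in> B. f i \<in> A i" "w = prod f B" using insert.IH by blast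
    have "prod (f(b := u)) B = prod f B" using insert.hyps(2) by (intro prod.cong) auto
    then have "v = prod (f(b := u)) (insert b B)"
      unfolding prod.insert[OF insert.hyps] using u f by simp
    moreover have "\<forall>i \<in> insert b B. (f(b := u)) i \<in> A i" using u f insert.hyps(2) by simp
    ultimately show "\<exists>f. (\<forall>i \<in> insert b B. f i \<in> A i) \<and> v = prod f (insert b B)" by blast
  next
    assume "\<exists>f. (\<forall>i \<in> insert b B. f i \<in> A i) \<and> v = prod f (insert b B)"
    then obtain f where f: "\<forall>i \<in> insert b B. f i \<in> A i" "v = prod f (insert b B)" by blast
    have "prod f B \<in> (\<Prod>i\<in>B. A i)" using insert.IH f(1) by blast
    then show "v \<in> (\<Prod>i\<in>insert b B. A i)"
      unfolding f(2) prod.insert[OF insert.hyps] using f(1) by (intro set_times_intro) auto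
  qed
qed simp

text \<open>The Krull-Schmidt part needs all factors in one family indexed by pairs, while the
  counting needs them grouped by isomorphism type.\<close>

definition flatten_product :: "'i set \<Rightarrow> ('i \<Rightarrow> 'j set) \<Rightarrow> ('i \<Rightarrow> 'j \<Rightarrow> 'a) \<Rightarrow> 'i \<times> 'j \<Rightarrow> 'a" where
  "flatten_product B J x = (\<lambda>p\<in>Sigma B J. x (fst p) (snd p))"

lemma flatten_product_iso:
  fixes G :: "'i \<Rightarrow> 'a monoid"
  shows "flatten_product B J \<in> iso (product_group B (\<lambda>i. product_group (J i) (\<lambda>_. G i)))
    (product_group (Sigma B J) (\<lambda>p. G (fst p)))" (is "_ \<in> iso ?N ?F")
proof (rule isoI)
  show "flatten_product B J \<in> hom ?N ?F"
    by (intro homI) (auto simp: flatten_product_def PiE_iff intro!: restrict_ext)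
  show "bij_betw (flatten_product B J) (carrier ?N) (carrier ?F)"
  proof (rule bij_betw_byWitness[where f' = "\<lambda>w. \<lambda>i\<in>B. \<lambda>j\<in>J i. w (i, j)"])
    show "\<forall>x\<in>carrier ?N. (\<lambda>i\<in>B. \<lambda>j\<in>J i. flatten_product B J x (i, j)) = x"
    proof
      fix x assume x: "x \<in> carrier ?N"
      show "(\<lambda>i\<in>B. \<lambda>j\<in>J i. flatten_product B J x (i, j)) = x"
      proof
        fix i show "(\<lambda>i\<in>B. \<lambda>j\<in>J i. flatten_product B J x (i, j)) i = x i"
        proof (cases "i \<in> B")
          case True
          then have "x i \<in> extensional (J i)" using x by (auto simp: PiE_iff)
          then show ?thesis using True by (auto simp: flatten_product_def extensional_def fun_eq_iff)
        next
          case False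
          then show ?thesis using x by (simp add: PiE_iff extensional_def)
        qed
      qed
    qed
    show "\<forall>w\<in>carrier ?F. flatten_product B J (\<lambda>i\<in>B. \<lambda>j\<in>J i. w (i, j)) = w"
    proof
      fix w assume w: "w \<in> carrier ?F"
      show "flatten_product B J (\<lambda>i\<in>B. \<lambda>j\<in>J i. w (i, j)) = w"
      proof
        fix p show "flatten_product B J (\<lambda>i\<in>B. \<lambda>j\<in>J i. w (i, j)) p = w p"
          using w by (cases p) (auto simp: flatten_product_def PiE_iff extensional_def)
      qed
    qed
    show "flatten_product B J ` carrier ?N \<subseteq> carrier ?F"
    proof (rule image_subsetI)
      fix x assume x: "x \<in> carrier ?N"
      have "x i j \<in> carrier (G i)" if "i \<in> B" "j \<in> J i" for i j using x that by (simp add: PiE_iff)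
      then show "flatten_product B J x \<in> carrier ?F" by (auto simp: flatten_product_def)
    qed
    show "(\<lambda>w. \<lambda>i\<in>B. \<lambda>j\<in>J i. w (i, j)) ` carrier ?F \<subseteq> carrier ?N"
    proof (rule image_subsetI)
      fix w assume w: "w \<in> carrier ?F"
      have "w (i, j) \<in> carrier (G i)" if "i \<in> B" "j \<in> J i" for i j using w that by (simp add: PiE_iff)
      then show "(\<lambda>i\<in>B. \<lambda>j\<in>J i. w (i, j)) \<in> carrier ?N" by simp
    qed
  qed
qed

section \<open>The spectrum of the whole product\<close>

lemma iso_conjugate:
  assumes "group G" "group G'" "h \<in> iso G G'" "\<phi> \<in> iso G G"
  obtains \<phi>' where "\<phi>' \<in> iso G' G'" "\<And>x. x \<in> carrier G \<Longrightarrow> h (\<phi> x) = \<phi>' (h x)"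
    "reidemeister_number G \<phi> = reidemeister_number G' \<phi>'"
proof -
  define g where "g = inv_into (carrier G) h"
  define \<phi>' where "\<phi>' = h \<circ> \<phi> \<circ> g"
  have g: "g \<in> iso G' G" unfolding g_def by (rule group.iso_set_sym[OF assms(1,3)])
  have "\<phi>' \<in> iso G' G'" unfolding \<phi>'_def using iso_set_trans[OF g iso_set_trans[OF assms(4,3)]] by (simp add: comp_assoc)
  moreover have eq: "h (\<phi> x) = \<phi>' (h x)" if "x \<in> carrier G" for x
    using that assms(3) by (simp add: \<phi>'_def g_def iso_def bij_betw_def)
  moreover have "reidemeister_number G \<phi> = reidemeister_number G' \<phi>'"
    by (rule reidemeister_number_iso[where \<phi> = \<phi> and \<phi>' = \<phi>', OF assms(1) _ assms(2) _ assms(3) eq])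
      (use assms(4) \<open>\<phi>' \<in> iso G' G'\<close> in \<open>simp_all add: iso_def\<close>)
  ultimately show thesis by (rule that)
qed

text \<open>Both inclusions pass through block maps, with one \<open>monomial\<close> map on each
  power. From left to right such a map is extracted from an automorphism, from right to left it is
  built from prescribed values.\<close>

lemma reidemeister_spectrum_product:
  fixes G :: "'i \<Rightarrow> 'a monoid" and J :: "'i \<Rightarrow> 'j set"
  assumes finB: "finite B" and finJ: "\<And>i. i \<in> B \<Longrightarrow> finite (J i)" and neJ: "\<And>i. i \<in> B \<Longrightarrow> J i \<noteq> {}"
    and tf: "\<And>i. i \<in> B \<Longrightarrow> torsion_free_group (G i)" and nil: "\<And>i. i \<in> B \<Longrightarrow> nilpotent_group (G i)"
    and noeth: "\<And>i. i \<in> B \<Longrightarrow> noetherian_group (G i)" and ur: "\<And>i. i \<in> B \<Longrightarrow> unique_roots (G i)"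
    and vi: "\<And>i. i \<in> B \<Longrightarrow> virtually_indecomposable (G i)" and nc: "\<And>i. i \<in> B \<Longrightarrow> \<not> comm_group (G i)"
    and niso: "\<And>i j. i \<in> B \<Longrightarrow> j \<in> B \<Longrightarrow> i \<noteq> j \<Longrightarrow> \<not> G i \<cong> G j"
  shows "reidemeister_spectrum (product_group B (\<lambda>i. product_group (J i) (\<lambda>_. G i)))
    = (\<Prod>i\<in>B. \<Union>j\<in>{1..card (J i)}. reidemeister_spectrum (G i) ^ j)"
proof -
  have grp: "group (G i)" if "i \<in> B" for i using nil[OF that] by (simp add: nilpotent_group_def)
  let ?K = "\<lambda>i. product_group (J i) (\<lambda>_. G i)"
  let ?N = "product_group B ?K"
  have grpK: "group (?K i)" if "i \<in> B" for i using grp[OF that] by simp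
  have grpN: "group ?N" using grpK by simp
  let ?I = "Sigma B J"
  let ?H = "\<lambda>p. G (fst p)"
  have block: "reidemeister_number ?N (\<lambda>x. \<lambda>i\<in>B. monomial (J i) (s i) (\<theta> i) (x i))
      = (\<Prod>i\<in>B. reidemeister_number (?K i) (monomial (J i) (s i) (\<theta> i)))"
    if s: "\<And>i. i \<in> B \<Longrightarrow> bij_betw (s i) (J i) (J i)"
      and \<theta>: "\<And>i j. i \<in> B \<Longrightarrow> j \<in> J i \<Longrightarrow> \<theta> i j \<in> iso (G i) (G i)"
    for s :: "'i \<Rightarrow> 'j \<Rightarrow> 'j" and \<theta> :: "'i \<Rightarrow> 'j \<Rightarrow> 'a \<Rightarrow> 'a"
  proof (rule reidemeister_number_product[OF finB grpK])
    fix i assume i: "i \<in> B"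
    show "monomial (J i) (s i) (\<theta> i) \<in> hom (?K i) (?K i)"
      using monomial_iso[of "J i" "\<lambda>_. G i", OF grp[OF i] s[OF i] \<theta>[OF i]] by (simp add: iso_def)
  qed
  show ?thesis
  proof (intro equalityI subsetI)
    fix v assume "v \<in> reidemeister_spectrum ?N"
    then obtain \<phi> where \<phi>: "\<phi> \<in> iso ?N ?N" "v = reidemeister_number ?N \<phi>"
      unfolding reidemeister_spectrum_iso[OF grpN] by blast
    interpret F: group_family ?I ?H by (rule group_family.intro) (use grp in auto)
    obtain \<psi> where \<psi>: "\<psi> \<in> iso F.P F.P" "reidemeister_number ?N \<phi> = reidemeister_number F.P \<psi>"
      by (rule iso_conjugate[OF grpN F.P.is_group flatten_product_iso \<phi>(1)])
    have finI: "finite ?I" using finB finJ by simp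
    interpret F: indecomposable_family ?I ?H \<psi>
    proof unfold_locales
      show "finite ?I" by (rule finI)
      show "\<psi> \<in> iso F.P F.P" by (rule \<psi>(1))
      fix p assume "p \<in> ?I"
      then have p: "fst p \<in> B" by auto
      show "noetherian_group (?H p)" "unique_roots (?H p)" "virtually_indecomposable (?H p)" "\<not> comm_group (?H p)"
        by (rule noeth[OF p] ur[OF p] vi[OF p] nc[OF p])+
    qed
    obtain s \<theta> where s: "bij_betw s ?I ?I" and \<theta>: "\<And>p. p \<in> ?I \<Longrightarrow> \<theta> p \<in> iso (?H (s p)) (?H p)"
      and cen: "\<And>p z. p \<in> ?I \<Longrightarrow> z \<in> center F.P \<Longrightarrow> \<psi> z p = \<theta> p (z (s p))"
      and mod: "\<And>p w. p \<in> ?I \<Longrightarrow> w \<in> carrier F.P \<Longrightarrow> \<exists>c \<in> center (?H p). \<psi> w p = \<theta> p (w (s p)) \<otimes>\<^bsub>?H p\<^esub> c"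
      using F.monomial_form by blast
    let ?m = "monomial ?I s \<theta>"
    have m: "?m \<in> iso F.P F.P" by (rule monomial_iso[of ?I ?H s \<theta>, OF F.grp s \<theta>])
    have mc: "?m w \<in> carrier F.P" if "w \<in> carrier F.P" for w using m that by (auto simp: iso_def hom_def)
    \<comment> \<open>Discards the central factors: from here on only the permutation part is
      counted.\<close>
    have "reidemeister_number F.P \<psi> = reidemeister_number F.P ?m"
    proof (rule reidemeister_number_eq_mod_center[OF F.P.is_group _ _ _ \<psi>(1) m])
      show "noetherian_group F.P" by (rule F.noetherian_product[OF finI F.noeth])
      show "torsion_free_group F.P" by (rule F.torsion_free_product) (use tf in auto)
      show "nilpotent_group F.P" by (rule F.nilpotent_product[OF finI]) (use nil in auto)
      show "\<psi> z = ?m z" if z: "z \<in> center F.P" for z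
        by (rule F.P_ext[OF F.\<psi>.hom_closed[OF F.P.center_closed[OF z]] mc[OF F.P.center_closed[OF z]]])
          (simp only: cen[OF _ z] monomial_def restrict_apply')
      show "\<exists>c\<in>center F.P. \<psi> w = ?m w \<otimes>\<^bsub>F.P\<^esub> c" if w: "w \<in> carrier F.P" for w
      proof -
        obtain c where c: "\<And>p. p \<in> ?I \<Longrightarrow> c p \<in> center (?H p)"
          "\<And>p. p \<in> ?I \<Longrightarrow> \<psi> w p = \<theta> p (w (s p)) \<otimes>\<^bsub>?H p\<^esub> c p" using mod[OF _ w] by metis
        let ?c = "restrict c ?I"
        have cc: "?c \<in> center F.P" unfolding F.center_P using c(1) by (simp add: PiE_iff)
        have "\<psi> w = ?m w \<otimes>\<^bsub>F.P\<^esub> ?c"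
        proof (rule F.P_ext[OF F.\<psi>.hom_closed[OF w] F.P.m_closed[OF mc[OF w] F.P.center_closed[OF cc]]])
          fix p assume p: "p \<in> ?I"
          show "\<psi> w p = (?m w \<otimes>\<^bsub>F.P\<^esub> ?c) p"
            unfolding F.P_mult[OF p] c(2)[OF p] monomial_def restrict_apply'[OF p] ..
        qed
        then show ?thesis using cc by blast
      qed
    qed
    then have v: "v = reidemeister_number F.P ?m" using \<psi>(2) \<phi>(2) by simp
    have sI: "s p \<in> ?I" if "p \<in> ?I" for p using s that by (auto simp: bij_betw_def)
    \<comment> \<open>Each \<open>\<theta> p\<close> is an isomorphism between factors, and factors
      of different types are not isomorphic; so \<open>s\<close> permutes inside each power.\<close>
    have fst_s: "fst (s p) = fst p" if p: "p \<in> ?I" for p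
    proof (rule ccontr)
      assume ne: "fst (s p) \<noteq> fst p"
      have "fst (s p) \<in> B" "fst p \<in> B" using sI[OF p] p by auto
      then show False using niso ne is_isoI[OF \<theta>[OF p]] by blast
    qed
    define s' where "s' i j = snd (s (i, j))" for i j
    define \<theta>' where "\<theta>' i j = \<theta> (i, j)" for i j
    have s_eq: "s (i, j) = (i, s' i j)" if "i \<in> B" "j \<in> J i" for i j
      using fst_s[of "(i, j)"] that by (simp add: s'_def prod_eq_iff)
    have s': "bij_betw (s' i) (J i) (J i)" if i: "i \<in> B" for i
    proof -
      have "s' i ` J i \<subseteq> J i" using sI s_eq[OF i] i by fastforce
      moreover have "inj_on (s' i) (J i)"
      proof (rule inj_onI)
        fix j j' assume j: "j \<in> J i" "j' \<in> J i" "s' i j = s' i j'"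
        then have "s (i, j) = s (i, j')" using s_eq[OF i] by simp
        then show "j = j'" using s i j unfolding bij_betw_def inj_on_def by blast
      qed
      ultimately show ?thesis using endo_inj_surj[OF finJ[OF i]] by (simp add: bij_betw_def)
    qed
    have \<theta>': "\<theta>' i j \<in> iso (G i) (G i)" if "i \<in> B" "j \<in> J i" for i j
      using \<theta>[of "(i, j)"] that fst_s[of "(i, j)"] by (simp add: \<theta>'_def)
    let ?n = "\<lambda>x. \<lambda>i\<in>B. monomial (J i) (s' i) (\<theta>' i) (x i)"
    have n: "?n \<in> hom ?N ?N"
    proof (rule product_map_hom)
      fix i assume i: "i \<in> B"
      show "monomial (J i) (s' i) (\<theta>' i) \<in> hom (?K i) (?K i)"
        using monomial_iso[of "J i" "\<lambda>_. G i", OF grp[OF i] s'[OF i] \<theta>'[OF i]] by (simp add: iso_def)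
    qed
    have mh: "?m \<in> hom F.P F.P" using m by (simp add: iso_def)
    \<comment> \<open>Back from pairs to the grouped product, where the map acts on each block
      separately and the number factors.\<close>
    have "reidemeister_number ?N ?n = reidemeister_number F.P ?m"
    proof (rule reidemeister_number_iso[OF grpN n F.P.is_group mh flatten_product_iso])
      fix x assume "x \<in> carrier ?N"
      show "flatten_product B J (?n x) = ?m (flatten_product B J x)"
        unfolding flatten_product_def monomial_def
      proof (rule restrict_ext)
        fix p assume p: "p \<in> ?I"
        obtain i j where ij: "p = (i, j)" "i \<in> B" "j \<in> J i" using p by blast
        have "s p \<in> ?I" by (rule sI[OF p])
        then show "(\<lambda>i\<in>B. \<lambda>j\<in>J i. \<theta>' i j (x i (s' i j))) (fst p) (snd p)
            = \<theta> p ((\<lambda>p\<in>?I. x (fst p) (snd p)) (s p))"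
          using ij s_eq[OF ij(2,3)] by (simp add: \<theta>'_def)
      qed
    qed
    then have "v = (\<Prod>i\<in>B. reidemeister_number (?K i) (monomial (J i) (s' i) (\<theta>' i)))"
      using v block[OF s' \<theta>'] by simp
    moreover have "reidemeister_number (?K i) (monomial (J i) (s' i) (\<theta>' i))
        \<in> (\<Union>j\<in>{1..card (J i)}. reidemeister_spectrum (G i) ^ j)" if i: "i \<in> B" for i
    proof -
      have "\<exists>j \<le> card (J i). (J i \<noteq> {} \<longrightarrow> 1 \<le> j) \<and>
          reidemeister_number (?K i) (monomial (J i) (s' i) (\<theta>' i)) \<in> reidemeister_spectrum (G i) ^ j"
        by (rule monomial_reidemeister_number_mem[OF grp[OF i] finJ[OF i] s'[OF i]]) (rule \<theta>'[OF i])
      then show ?thesis using neJ[OF i] by auto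
    qed
    ultimately show "v \<in> (\<Prod>i\<in>B. \<Union>j\<in>{1..card (J i)}. reidemeister_spectrum (G i) ^ j)"
      unfolding mem_prod_set_iff[OF finB]
      by (intro exI[of _ "\<lambda>i. reidemeister_number (?K i) (monomial (J i) (s' i) (\<theta>' i))"] conjI ballI)
  next
    fix v assume "v \<in> (\<Prod>i\<in>B. \<Union>j\<in>{1..card (J i)}. reidemeister_spectrum (G i) ^ j)"
    then obtain f where fB: "\<forall>i\<in>B. f i \<in> (\<Union>j\<in>{1..card (J i)}. reidemeister_spectrum (G i) ^ j)"
      and v: "v = prod f B" unfolding mem_prod_set_iff[OF finB] by (elim exE conjE)
    note f = bspec[OF fB]
    have "\<forall>i \<in> B. \<exists>s \<theta>. bij_betw s (J i) (J i) \<and> (\<forall>j \<in> J i. \<theta> j \<in> iso (G i) (G i)) \<and>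
        reidemeister_number (?K i) (monomial (J i) s \<theta>) = f i"
    proof
      fix i assume i: "i \<in> B"
      obtain j where j: "j \<in> {1..card (J i)}" "f i \<in> reidemeister_spectrum (G i) ^ j" using f[OF i] by blast
      then show "\<exists>s \<theta>. bij_betw s (J i) (J i) \<and> (\<forall>j \<in> J i. \<theta> j \<in> iso (G i) (G i)) \<and>
          reidemeister_number (?K i) (monomial (J i) s \<theta>) = f i"
        using monomial_reidemeister_number_exists[OF grp[OF i] finJ[OF i], of j "f i"] by simp
    qed
    then obtain s \<theta> where s: "\<And>i. i \<in> B \<Longrightarrow> bij_betw (s i) (J i) (J i)"
      and \<theta>: "\<And>i j. i \<in> B \<Longrightarrow> j \<in> J i \<Longrightarrow> \<theta> i j \<in> iso (G i) (G i)"
      and R: "\<And>i. i \<in> B \<Longrightarrow> reidemeister_number (?K i) (monomial (J i) (s i) (\<theta> i)) = f i"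
      by metis
    let ?I' = "\<lambda>x. \<lambda>i\<in>B. monomial (J i) (s i) (\<theta> i) (x i)"
    have "reidemeister_number ?N ?I' = (\<Prod>i\<in>B. reidemeister_number (?K i) (monomial (J i) (s i) (\<theta> i)))"
      by (rule block) (rule s \<theta>; assumption)+
    also have "\<dots> = v" unfolding v by (rule prod.cong) (simp_all add: R)
    finally have "v = reidemeister_number ?N ?I'" ..
    moreover have "?I' \<in> iso ?N ?N"
    proof -
      \<comment> \<open>A product of automorphisms of the blocks is a permutation map over
        \<open>B\<close> with the trivial permutation, so \<open>monomial_iso\<close> applies once
        more.\<close>
      have "monomial B id (\<lambda>i. monomial (J i) (s i) (\<theta> i)) \<in> iso ?N ?N"
      proof (rule monomial_iso[OF grpK])
        fix i assume i: "i \<in> B"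
        show "monomial (J i) (s i) (\<theta> i) \<in> iso (?K (id i)) (?K i)"
          unfolding id_apply by (rule monomial_iso[of "J i" "\<lambda>_. G i", OF grp[OF i] s[OF i]]) (rule \<theta>[OF i])
      qed auto
      then show ?thesis unfolding monomial_def[of B] id_apply .
    qed
    ultimately show "v \<in> reidemeister_spectrum ?N" unfolding reidemeister_spectrum_iso[OF grpN] by blast
  qed
qed

section \<open>The value infinity in products of sets\<close>

lemma zero_notin_power:
  fixes A :: "enat set"
  assumes "0 \<notin> A"
  shows "0 \<notin> A ^ j"
proof (induction j)
  case (Suc j)
  show ?case
  proof
    assume "0 \<in> A ^ Suc j"
    then obtain a b where "0 = a * b" "a \<in> A" "b \<in> A ^ j" unfolding power_Suc by (rule set_times_elim)
    then show False using assms Suc by (metis imult_is_0)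
  qed
qed simp

text \<open>The exponent must be positive, since the zeroth power is \<open>{1}\<close>.\<close>

lemma power_singleton_top: "1 \<le> j \<Longrightarrow> {\<infinity> :: enat} ^ j = {\<infinity>}"
proof (induction j rule: dec_induct)
  case (step n)
  then show ?case by (simp add: set_times_def)
qed (simp add: set_times_def)

text \<open>If no \<open>A i\<close> is \<open>{\<infinity>}\<close>, finite values can be chosen
  everywhere and their product is finite. Conversely an infinite value absorbs all others because
  none of them is zero, and nonemptiness guarantees that some product exists.\<close>

lemma R_infinity_product_iff:
  fixes A :: "'i \<Rightarrow> enat set"
  assumes B: "finite B" and r: "\<And>i. i \<in> B \<Longrightarrow> 1 \<le> r i"
    and ne: "\<And>i. i \<in> B \<Longrightarrow> A i \<noteq> {}" and pos: "\<And>i. i \<in> B \<Longrightarrow> 0 \<notin> A i"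
  shows "(\<Prod>i\<in>B. \<Union>j\<in>{1..r i}. A i ^ j) = {\<infinity>} \<longleftrightarrow> (\<exists>i \<in> B. A i = {\<infinity>})"
proof -
  let ?U = "\<lambda>i. \<Union>j\<in>{1..r i}. A i ^ j"
  have AU: "A i \<subseteq> ?U i" if "i \<in> B" for i
  proof -
    have "1 \<in> {1..r i}" using r[OF that] by simp
    then have "A i ^ 1 \<subseteq> ?U i" by blast
    then show ?thesis by (simp only: power_one_right)
  qed
  have U0: "0 \<notin> ?U i" if "i \<in> B" for i using zero_notin_power[OF pos[OF that]] by blast
  show ?thesis
  proof
    assume eq: "(\<Prod>i\<in>B. ?U i) = {\<infinity>}"
    show "\<exists>i \<in> B. A i = {\<infinity>}"
    proof (rule ccontr)
      assume no: "\<not> (\<exists>i \<in> B. A i = {\<infinity>})"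
      have "\<forall>i \<in> B. \<exists>a. a \<in> A i \<and> a \<noteq> \<infinity>"
      proof (intro ballI, rule ccontr)
        fix i assume i: "i \<in> B" "\<not> (\<exists>a. a \<in> A i \<and> a \<noteq> \<infinity>)"
        then have "A i \<subseteq> {\<infinity>}" by auto
        then have "A i = {\<infinity>}" using ne[OF i(1)] by (simp add: subset_singleton_iff)
        then show False using no i(1) by blast
      qed
      then obtain f where f: "\<And>i. i \<in> B \<Longrightarrow> f i \<in> A i" "\<And>i. i \<in> B \<Longrightarrow> f i \<noteq> \<infinity>" by metis
      have "prod f B \<in> (\<Prod>i\<in>B. ?U i)"
        unfolding mem_prod_set_iff[OF B] by (intro exI[of _ f] conjI ballI subsetD[OF AU] f(1) refl)
      then have "prod f B = \<infinity>" using eq by simp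
      moreover have "f i \<noteq> 0" if "i \<in> B" for i using f(1)[OF that] pos[OF that] by auto
      ultimately have "\<exists>i \<in> B. f i = \<infinity>" using enat_prod_eq_top_iff[OF B, of f] by simp
      then show False using f(2) by blast
    qed
  next
    assume "\<exists>i \<in> B. A i = {\<infinity>}"
    then obtain i where i: "i \<in> B" "A i = {\<infinity>}" by blast
    have Ui: "?U i = {\<infinity>}" using r[OF i(1)] unfolding i(2) by (auto simp: power_singleton_top)
    have all: "v = \<infinity>" if v: "v \<in> (\<Prod>i\<in>B. ?U i)" for v
    proof -
      obtain f where f: "\<forall>i \<in> B. f i \<in> ?U i" "v = prod f B"
        using v unfolding mem_prod_set_iff[OF B] by (elim exE conjE)
      have "f i' \<noteq> 0" if "i' \<in> B" for i' using f(1) U0[OF that] that by metis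
      moreover have "f i = \<infinity>" using bspec[OF f(1) i(1)] unfolding Ui by simp
      ultimately show ?thesis unfolding f(2) using enat_prod_eq_top_iff[OF B, of f] i(1) by blast
    qed
    have "\<forall>i \<in> B. \<exists>a. a \<in> ?U i"
    proof
      fix i assume "i \<in> B"
      then show "\<exists>a. a \<in> ?U i" using ne AU by (meson all_not_in_conv subsetD)
    qed
    then obtain f where "\<forall>i \<in> B. f i \<in> ?U i" by metis
    then have mem: "prod f B \<in> (\<Prod>i\<in>B. ?U i)"
      unfolding mem_prod_set_iff[OF B] by (intro exI[of _ f] conjI) auto
    show "(\<Prod>i\<in>B. ?U i) = {\<infinity>}"
    proof (intro equalityI subsetI)
      fix v assume "v \<in> {\<infinity> :: enat}"
      then show "v \<in> (\<Prod>i\<in>B. ?U i)" using mem all[OF mem] by simp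
    qed (simp add: all)
  qed
qed

theorem theorem3p6:
  fixes k :: nat
    and G :: "nat \<Rightarrow> 'a monoid"
    and r :: "nat \<Rightarrow> nat"
    and N :: "(nat \<Rightarrow> nat \<Rightarrow> 'a) monoid"
  assumes "k \<ge> 1"
    and "\<And>i. i \<in> {1..k} \<Longrightarrow> finitely_generated_group (G i)"
    and "\<And>i. i \<in> {1..k} \<Longrightarrow> torsion_free_group (G i)"
    and "\<And>i. i \<in> {1..k} \<Longrightarrow> nilpotent_group (G i)"
    and "\<And>i. i \<in> {1..k} \<Longrightarrow> \<not> comm_group (G i)"
    and "\<And>i j. i \<in> {1..k} \<Longrightarrow> j \<in> {1..k} \<Longrightarrow> i \<noteq> j \<Longrightarrow> \<not> G i \<cong> G j"
    and "\<And>i. i \<in> {1..k} \<Longrightarrow> r i \<ge> 1"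
    and "N = product_group {1..k} (\<lambda>i. product_group {1..r i} (\<lambda>_. G i))"
    and "\<And>i. i \<in> {1..k} \<Longrightarrow> rationally_indecomposable (G i)"
  shows "reidemeister_spectrum N = (\<Prod>i\<in>{1..k}. \<Union>j\<in>{1..r i}. reidemeister_spectrum (G i) ^ j)
    \<and> (R_infinity N \<longleftrightarrow> (\<exists>i\<in>{1..k}. R_infinity (G i)))"
proof -
  have grp: "group (G i)" if "i \<in> {1..k}" for i using assms(4)[OF that] by (simp add: nilpotent_group_def)
  \<comment> \<open>Finite generation enters only here, as the maximal condition on
    subgroups.\<close>
  have noeth: "noetherian_group (G i)" if i: "i \<in> {1..k}" for i
  proof -
    obtain S where "finite S" "S \<subseteq> carrier (G i)" "generate (G i) S = carrier (G i)"
      using assms(2)[OF i] unfolding finitely_generated_group_def by blast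
    moreover obtain c where "lower_central (G i) c = {\<one>\<^bsub>G i\<^esub>}"
      using assms(4)[OF i] unfolding nilpotent_group_def by blast
    ultimately show ?thesis using noetherian_nilpotent[OF grp[OF i]] by blast
  qed
  have ur: "unique_roots (G i)" and vi: "virtually_indecomposable (G i)" if i: "i \<in> {1..k}" for i
  proof -
    obtain M :: "('a \<times> nat) monoid" and \<iota> where
      M: "rational_malcev_completion (G i) M \<iota>" "directly_indecomposable M"
      using assms(9)[OF i] unfolding rationally_indecomposable_def by blast
    show "unique_roots (G i)" by (rule rational_malcev_completion_unique_roots(2)[OF M(1) grp[OF i]])
    show "virtually_indecomposable (G i)"
      by (rule rational_malcev_completion_virtually_indecomposable[OF M(1) grp[OF i] M(2)])
  qed
  have "reidemeister_spectrum N
      = (\<Prod>i\<in>{1..k}. \<Union>j\<in>{1..card {1..r i}}. reidemeister_spectrum (G i) ^ j)"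
    unfolding assms(8)
  proof (rule reidemeister_spectrum_product)
    show "{1..r i} \<noteq> {}" if "i \<in> {1..k}" for i using assms(7)[OF that] by simp
  qed (use assms(3-6) noeth ur vi in \<open>simp_all\<close>)
  then have spec: "reidemeister_spectrum N = (\<Prod>i\<in>{1..k}. \<Union>j\<in>{1..r i}. reidemeister_spectrum (G i) ^ j)"
    by simp
  \<comment> \<open>The identity automorphism supplies an element of the spectrum, and positivity
    keeps a factor 0 from cancelling \<open>\<infinity>\<close>.\<close>
  have "reidemeister_spectrum (G i) \<noteq> {}" "0 \<notin> reidemeister_spectrum (G i)" if i: "i \<in> {1..k}" for i
  proof -
    show "reidemeister_spectrum (G i) \<noteq> {}"
      unfolding reidemeister_spectrum_iso[OF grp[OF i]] using id_iso by blast
    show "0 \<notin> reidemeister_spectrum (G i)"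
    proof
      assume "0 \<in> reidemeister_spectrum (G i)"
      then obtain \<phi> where "\<phi> \<in> iso (G i) (G i)" "reidemeister_number (G i) \<phi> = 0"
        unfolding reidemeister_spectrum_iso[OF grp[OF i]] by auto
      then show False using reidemeister_number_nonzero[OF grp[OF i]] by (auto simp: iso_def)
    qed
  qed
  then have "reidemeister_spectrum N = {\<infinity>} \<longleftrightarrow> (\<exists>i\<in>{1..k}. reidemeister_spectrum (G i) = {\<infinity>})"
    unfolding spec using assms(7) by (intro R_infinity_product_iff) auto
  then show ?thesis using spec unfolding R_infinity_def by blast
qed

end
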